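(* Let $(\Omega,\sigma,m,I,T,\varphi_c,H)$ be a random weighted open system, and let $\nu,\lambda,q,\eta$ be the associated objects (all as defined in the context). For $m$-a.e. $\omega\in\Omega$ the escape rates $R(\nu_{\omega,c})$ and $R(\eta_\omega)$ satisfy $$R(\nu_{\omega,c})=R(\eta_\omega)=\mathcal EP(\varphi_c)-\mathcal EP(\varphi),$$ where $\mathcal EP(\varphi_c):=\int_\Omega\log\lambda_{\omega,c}\,dm(\omega)$ and $\mathcal EP(\varphi):=\int_\Omega\log\lambda_\omega\,dm(\omega)$ are the expected pressures of the closed and open systems.
   Context: Closed system. $(\Omega,\mathscr F,m)$ is a probability space; $\sigma:\Omega\to\Omega$ is invertible, ergodic and $m$-preserving. $I\subset\mathbb R$ is a compact interval with Borel $\sigma$-algebra $\mathscr B$. For each $\omega\in\Omega$, $T_\omega:I\to I$ is surjective and $\mathcal Z_\omega$ is a finite partition of $I$ such that for each $Z\in\mathcal Z_\omega$, $T_\omega(Z)$ is an interval and $T_\omega|_Z$ is continuous and strictly monotone; $\log\#\mathcal Z_\omega\in L^1(m)$. $T_\omega^n:=T_{\sigma^{n-1}(\omega)}\circ\dots\circ T_\omega$, $\mathcal Z_\omega^{(n)}:=\bigvee_{j=0}^{n-1}T_\omega^{-j}(\mathcal Z_{\sigma^j(\omega)})$, and $\bigvee_{n\ge1}\mathcal Z_\omega^{(n)}=\mathscr B$ (generating). The skew product $T(\omega,x)=(\sigma(\omega),T_\omega(x))$ on $\Omega\times I$ is measurable. $\mathrm{var}_A(f)$ is the total variation of $f$ over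 finite increasing sequences of points of $A\subset I$; $\mathrm{var}=\mathrm{var}_I$; $\mathrm{BV}(I)$ is the set of bounded $f:I\to\mathbb R$ with $\mathrm{var}(f)<\infty$. For $f:\Omega\times I\to\mathbb R$, $f_\omega:=f(\omega,\cdot)$. $\mathrm{BV}_\Omega(I)$ is the set of $f:\Omega\times I\to\mathbb R$ with $f_\omega\in \mathrm{BV}(I)$ for every $\omega$, $\omega\mapsto f_\omega(x)$ measurable for every $x$, and $\omega\mapsto\|f_\omega\|_\infty$ measurable. A random probability measure on $I$ is a family $\zeta=(\zeta_\omega)_{\omega\in\Omega}$ with $\omega\mapsto\zeta_\omega(B)$ measurable for all $B\in\mathscr B$ and $\zeta_\omega$ a Borel probability measure for $m$-a.e. $\omega$; it is identified with the measure on $\Omega\times I$ with marginal $m$ given by $\zeta(f)=\int_\Omega\int_I f_\omega\,d\zeta_\omega\,dm(\omega)$. It is supported in a set $\bigcup_\omega\{\omega\}\times A_\omega$ if $\zeta_\omega(A_\omega)=1$ for $m$-a.e. $\omega$. The potential $\varphi_c:\Omega\times I\to\mathbb R$ is measurable with $\inf\varphi_{\omega,c},\sup\varphi_{\omega,c}\in L^1(m)$; $g_{\omega,c}^{(n)}:=\exp(\sum_{j=0}^{n-1}\varphi_{\sigma^j(\omega),c}\circ T_\omega^j)$, and $g_{\omega,c}:=g_{\omega,c}^{(1)}\in \mathrm{BV}(I)$ for $m$-a.e. $\omega$. $\mathcal L_{\omega,c}f(x):=\sum_{y\in T_\omega^{-1}(x)}g_{\omega,c}(y)f(y)$, $\mathcal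 L_{\omega,c}^n:=\mathcal L_{\sigma^{n-1}(\omega),c}\circ\dots\circ\mathcal L_{\omega,c}$. It is assumed that there is a random probability measure $\nu_c=(\nu_{\omega,c})$ with $\nu_{\sigma^n(\omega),c}(\mathcal L_{\omega,c}^nf)=\lambda_{\omega,c}^n\nu_{\omega,c}(f)$ for $m$-a.e. $\omega$, all $n\in\mathbb N$, $f\in \mathrm{BV}(I)$, where $\lambda_{\omega,c}^n:=\nu_{\sigma^n(\omega),c}(\mathcal L_{\omega,c}^n1)$, and $\log\lambda_{\omega,c}\in L^1(m)$ ($\lambda_{\omega,c}:=\lambda_{\omega,c}^1$). Open system. $H\in\mathscr F\otimes\mathscr B$ (the hole), $H_\omega:=\{x:(\omega,x)\in H\}$, $0<\int_\Omega\nu_{\omega,c}(H_\omega)\,dm<1$. $I_\omega:=I\setminus H_\omega$, $1_\omega:=1_{I_\omega}$, $\mathcal I:=\bigcup_\omega\{\omega\}\times I_\omega$. $X_{\omega,n}:=\bigcap_{j=0}^nT_\omega^{-j}(I_{\sigma^j(\omega)})$, $X_{\omega,\infty}:=\bigcap_{n\ge0}X_{\omega,n}$, $\mathcal X_\infty:=\bigcup_\omega\{\omega\}\times X_{\omega,\infty}$. The open potential is $\varphi_\omega:=\varphi_{\omega,c}|_{I_\omega}$; $g_\omega^{(n)}:=g_{\omega,c}^{(n)}|_{X_{\omega,n-1}}$. Open operator: $\mathcal L_\omega f:=\mathcal L_{\omega,c}(f1_\omega)$, $\mathcal L_\omega^n:=\mathcal L_{\sigma^{n-1}(\omega)}\circ\dots\circ\mathcal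 L_\omega$. $D_{\omega,n}:=\{x\in I:\mathcal L_{\sigma^{-n}(\omega)}^n1_{\sigma^{-n}(\omega)}(x)\ne0\}$, $D_{\omega,\infty}:=\bigcap_nD_{\omega,n}$, and $D_{\omega,\infty}\neq\emptyset$ for $m$-a.e. $\omega$. Functional: for $f\in \mathrm{BV}(I)$, $\Lambda_\omega(f):=\lim_{n\to\infty}\inf_{x\in D_{\sigma^n(\omega),n}}\frac{\mathcal L_\omega^nf(x)}{\mathcal L_\omega^n1_\omega(x)}$ (a bounded increasing limit). $\rho_\omega:=\Lambda_{\sigma(\omega)}(\mathcal L_\omega1_\omega)$, $\rho_\omega^n:=\prod_{j=0}^{n-1}\rho_{\sigma^j(\omega)}$. Partitions: for each $\omega,n$ a finite partition $\mathcal A$ of $I$ with $\mathrm{var}_A(g_\omega^{(n)})\le2\|g_\omega^{(n)}\|_\infty$ for all $A\in\mathcal A$ is chosen; $\widehat{\mathcal Z}_\omega^{(n)}$ is the coarsest partition among those finer than $\mathcal A$ and $\mathcal Z_\omega^{(n)}$ all of whose elements are either disjoint from or contained in $X_{\omega,n-1}$. $\mathcal Z_{\omega,*}^{(n)}$ is the set of its elements contained in $X_{\omega,n-1}$; $\mathcal Z_{\omega,b}^{(n)}$ (resp. $\mathcal Z_{\omega,g}^{(n)}$) is the set of $Z\in\mathcal Z_{\omega,*}^{(n)}$ with $\Lambda_\omega(1_Z)=0$ (resp. $>0$). Two elements of $\mathcal Z_{\omega,*}^{(n)}$ are contiguous if they share a boundary point or are separated by a connected component of $\bigcup_{j=0}^{n-1}T_\omega^{-j}(H_{\sigma^j(\omega)})$.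 $\xi_\omega^{(n)}$ is the maximum number of contiguous elements of $\mathcal Z_{\omega,b}^{(n)}$; $\delta_{\omega,n}:=\min_{Z\in\mathcal Z_{\omega,g}^{(n)}}\Lambda_\omega(1_Z)$. Assume: $\lim\frac1n\log\|g_\omega^{(n)}\|_\infty+\limsup\frac1n\log\xi_\omega^{(n)}<\lim\frac1n\log\rho_\omega^n=\int_\Omega\log\rho_\omega\,dm$; and $\log\xi_\omega^{(n)},\log\delta_{\omega,n}\in L^1(m)$ for each $n\in\mathbb N$. $(\Omega,\sigma,m,I,T,\varphi_c,H)$ is called a random weighted open system when: each $T_\omega$ is surjective, each $T_\omega(Z)$ with $Z\in\mathcal Z_\omega$ is an interval and $T_\omega|_Z$ is continuous and strictly monotone, $\log\#\mathcal Z_\omega\in L^1(m)$, $\bigvee_{n\ge1}\mathcal Z_\omega^{(n)}=\mathscr B$, $T$ is measurable, $\inf\varphi_{\omega,c},\sup\varphi_{\omega,c}\in L^1(m)$ and $g_{\omega,c}\in\mathrm{BV}(I)$ for $m$-a.e. $\omega$, there is a random probability measure $\nu_c$ with $\nu_{\sigma^n(\omega),c}(\mathcal L_{\omega,c}^nf)=\lambda_{\omega,c}^n\nu_{\omega,c}(f)$ and $\log\lambda^1_{\omega,c}\in L^1(m)$, $0<\int_\Omega\nu_{\omega,c}(H_\omega)\,dm<1$, $D_{\omega,\infty}\ne\emptyset$ for $m$-a.e. $\omega$, $\lim\frac1n\log\|g_\omega^{(n)}\|_\infty+\limsup\frac1n\log\xi_\omega^{(n)}<\lim\frac1n\log\rho_\omega^n=\int_\Omega\log\rho_\omega\,dm$,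 and $\log\xi_\omega^{(n)},\log\delta_{\omega,n}\in L^1(m)$ for each $n\in\mathbb N$. Associated objects. $\nu$ is the unique random probability measure supported in $\mathcal X_\infty$ with $\nu_{\sigma(\omega)}(\mathcal L_\omega f)=\lambda_\omega\nu_\omega(f)$ for all $f\in \mathrm{BV}(I)$ and $m$-a.e. $\omega$, where $\lambda_\omega:=\nu_{\sigma(\omega)}(\mathcal L_\omega1_\omega)$. $q\in \mathrm{BV}_\Omega(I)$ is the (unique modulo $\nu$) function with $\nu(q)=1$ and $\mathcal L_\omega q_\omega=\lambda_\omega q_{\sigma(\omega)}$; explicitly $q_\omega=\lim_{n}\mathcal L_{\sigma^{-n}(\omega)}^n1_{\sigma^{-n}(\omega)}/\Lambda_\omega(\mathcal L_{\sigma^{-n}(\omega)}^n1_{\sigma^{-n}(\omega)})$ in sup norm. $\eta_\omega(f):=\nu_{\omega,c}(1_\omega q_\omega f)/\nu_{\omega,c}(1_\omega q_\omega)$. Escape rate. For a random probability measure $\varrho$, $\underline R(\varrho_\omega):=-\liminf_{n}\frac1n\log\varrho_\omega(X_{\omega,n})$ and $\overline R(\varrho_\omega):=-\limsup_{n}\frac1n\log\varrho_\omega(X_{\omega,n})$; if they are equal the escape rate exists and $R(\varrho_\omega)$ denotes the common value.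
   Formalization: The formal theorem additionally assumes that ν_{ω,c}(1_ω q_ω) > 0 for m-a.e. ω, so that η_ω is defined (otherwise the claim can fail), and that ω ↦ λ_ω is measurable, so that ∫ log λ_ω dm makes sense. *)

theory Defs
  imports "HOL-Probability.Probability"
begin

section \<open>Functions of bounded variation, logarithms\<close>

definition variation_on :: "real set \<Rightarrow> (real \<Rightarrow> real) \<Rightarrow> ereal" where
  "variation_on A f =
     (SUP xs \<in> {xs. sorted_wrt (<) xs \<and> set xs \<subseteq> A}.
        ereal (\<Sum>i<length xs - 1. \<bar>f (xs ! Suc i) - f (xs ! i)\<bar>))"

text \<open>Only the values of \<open>f\<close> on \<open>A\<close> matter for membership.\<close>

definition BV :: "real set \<Rightarrow> (real \<Rightarrow> real) set" where
  "BV A = {f. bounded (f ` A) \<and> variation_on A f < \<infinity>}"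

definition sup_norm_on :: "real set \<Rightarrow> (real \<Rightarrow> real) \<Rightarrow> real" where
  "sup_norm_on A f = (SUP x\<in>A. \<bar>f x\<bar>)"

text \<open>Nonpositive arguments are sent to \<open>-\<infinity>\<close>.\<close>

definition elog :: "real \<Rightarrow> ereal" where
  "elog x = (if 0 < x then ereal (ln x) else -\<infinity>)"

text \<open>Positivity is required explicitly, because \<open>ln\<close> is total.\<close>

definition log_integrable :: "'w measure \<Rightarrow> ('w \<Rightarrow> real) \<Rightarrow> bool" where
  "log_integrable M f \<longleftrightarrow> (AE \<omega> in M. 0 < f \<omega>) \<and> integrable M (\<lambda>\<omega>. ln (f \<omega>))"

section \<open>The driving system\<close>

definition measure_preserving_automorphism :: "'w measure \<Rightarrow> ('w \<Rightarrow> 'w) \<Rightarrow> bool" where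
  "measure_preserving_automorphism M \<sigma> \<longleftrightarrow>
     bij_betw \<sigma> (space M) (space M) \<and>
     \<sigma> \<in> measurable M M \<and>
     inv_into (space M) \<sigma> \<in> measurable M M \<and>
     distr M M \<sigma> = M"

definition ergodic :: "'w measure \<Rightarrow> ('w \<Rightarrow> 'w) \<Rightarrow> bool" where
  "ergodic M \<sigma> \<longleftrightarrow>
     (\<forall>A\<in>sets M. \<sigma> -` A \<inter> space M = A \<longrightarrow> measure M A = 0 \<or> measure M A = 1)"

section \<open>Closed systems\<close>

text \<open>
  The tuple $(\Omega, \sigma, m, I, T, \varphi_c, H)$.  Only the values at
  \<open>\<omega> \<in> space (base S)\<close> and \<open>x \<in> fibre S\<close> are relevant.
\<close>

record 'w open_system =
  base :: "'w measure"
  shift :: "'w \<Rightarrow> 'w"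
  fibre :: "real set"
  fmap :: "'w \<Rightarrow> real \<Rightarrow> real"
  pot :: "'w \<Rightarrow> real \<Rightarrow> real"
  hole :: "('w \<times> real) set"

definition fibre_borel :: "'w open_system \<Rightarrow> real measure" where
  "fibre_borel S = restrict_space borel (fibre S)"

definition shift_pow :: "'w open_system \<Rightarrow> nat \<Rightarrow> 'w \<Rightarrow> 'w" where
  "shift_pow S n \<omega> = (shift S ^^ n) \<omega>"

definition shift_back :: "'w open_system \<Rightarrow> nat \<Rightarrow> 'w \<Rightarrow> 'w" where
  "shift_back S n \<omega> = (inv_into (space (base S)) (shift S) ^^ n) \<omega>"

primrec fmap_iter :: "'w open_system \<Rightarrow> nat \<Rightarrow> 'w \<Rightarrow> real \<Rightarrow> real" where
  "fmap_iter S 0 \<omega> x = x"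
| "fmap_iter S (Suc n) \<omega> x = fmap S (shift_pow S n \<omega>) (fmap_iter S n \<omega> x)"

definition skew_product :: "'w open_system \<Rightarrow> 'w \<times> real \<Rightarrow> 'w \<times> real" where
  "skew_product S = (\<lambda>(\<omega>, x). (shift S \<omega>, fmap S \<omega> x))"

text \<open>The join \<open>Z\<^sup>(\<^sup>n\<^sup>)\<close> of the pullbacks of the monotonicity partitions \<open>Z\<close>.\<close>

definition joined_partition ::
  "'w open_system \<Rightarrow> ('w \<Rightarrow> real set set) \<Rightarrow> nat \<Rightarrow> 'w \<Rightarrow> real set set" where
  "joined_partition S Z n \<omega> =
     {A. A \<noteq> {} \<and> (\<exists>C. (\<forall>j<n. C j \<in> Z (shift_pow S j \<omega>)) \<and>
                        A = {x \<in> fibre S. \<forall>j<n. fmap_iter S j \<omega> x \<in> C j})}"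

definition weight :: "'w open_system \<Rightarrow> nat \<Rightarrow> 'w \<Rightarrow> real \<Rightarrow> real" where
  "weight S n \<omega> x = exp (\<Sum>j<n. pot S (shift_pow S j \<omega>) (fmap_iter S j \<omega> x))"

definition closed_op :: "'w open_system \<Rightarrow> 'w \<Rightarrow> (real \<Rightarrow> real) \<Rightarrow> real \<Rightarrow> real" where
  "closed_op S \<omega> f x = (\<Sum>y | y \<in> fibre S \<and> fmap S \<omega> y = x. weight S 1 \<omega> y * f y)"

primrec closed_op_iter ::
  "'w open_system \<Rightarrow> nat \<Rightarrow> 'w \<Rightarrow> (real \<Rightarrow> real) \<Rightarrow> real \<Rightarrow> real" where
  "closed_op_iter S 0 \<omega> f = f"
| "closed_op_iter S (Suc n) \<omega> f = closed_op S (shift_pow S n \<omega>) (closed_op_iter S n \<omega> f)"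

definition random_prob_measure :: "'w open_system \<Rightarrow> ('w \<Rightarrow> real measure) \<Rightarrow> bool" where
  "random_prob_measure S \<zeta> \<longleftrightarrow>
     (\<forall>\<omega>\<in>space (base S). sets (\<zeta> \<omega>) = sets (fibre_borel S)) \<and>
     (\<forall>B\<in>sets (fibre_borel S). (\<lambda>\<omega>. emeasure (\<zeta> \<omega>) B) \<in> borel_measurable (base S)) \<and>
     (AE \<omega> in base S. prob_space (\<zeta> \<omega>))"

definition closed_eigenvalue ::
  "'w open_system \<Rightarrow> ('w \<Rightarrow> real measure) \<Rightarrow> nat \<Rightarrow> 'w \<Rightarrow> real" where
  "closed_eigenvalue S \<nu>c n \<omega> = (\<integral>x. closed_op_iter S n \<omega> (\<lambda>_. 1) x \<partial>\<nu>c (shift_pow S n \<omega>))"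

definition closed_conformal :: "'w open_system \<Rightarrow> ('w \<Rightarrow> real measure) \<Rightarrow> bool" where
  "closed_conformal S \<nu>c \<longleftrightarrow>
     random_prob_measure S \<nu>c \<and>
     (AE \<omega> in base S. \<forall>n. \<forall>f\<in>BV (fibre S).
        (\<integral>x. closed_op_iter S n \<omega> f x \<partial>\<nu>c (shift_pow S n \<omega>))
          = closed_eigenvalue S \<nu>c n \<omega> * (\<integral>x. f x \<partial>\<nu>c \<omega>)) \<and>
     log_integrable (base S) (closed_eigenvalue S \<nu>c 1)"

definition closed_system :: "'w open_system \<Rightarrow> ('w \<Rightarrow> real set set) \<Rightarrow> bool" where
  "closed_system S Z \<longleftrightarrow>
     prob_space (base S) \<and>
     measure_preserving_automorphism (base S) (shift S) \<and>
     ergodic (base S) (shift S) \<and>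
     compact (fibre S) \<and> is_interval (fibre S) \<and> fibre S \<noteq> {} \<and>
     (\<forall>\<omega>\<in>space (base S).
        fmap S \<omega> ` fibre S = fibre S \<and>
        finite (Z \<omega>) \<and> partition_on (fibre S) (Z \<omega>) \<and>
        (\<forall>A\<in>Z \<omega>. is_interval (fmap S \<omega> ` A) \<and> continuous_on A (fmap S \<omega>) \<and>
           (strict_mono_on A (fmap S \<omega>) \<or> strict_antimono_on A (fmap S \<omega>))) \<and>
        sigma_sets (fibre S) (\<Union>n\<in>{1..}. joined_partition S Z n \<omega>) = sets (fibre_borel S)) \<and>
     log_integrable (base S) (\<lambda>\<omega>. real (card (Z \<omega>))) \<and>
     skew_product S \<in> measurable (base S \<Otimes>\<^sub>M fibre_borel S) (base S \<Otimes>\<^sub>M fibre_borel S)"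

text \<open>
  Boundedness almost everywhere is stated separately, since \<open>INF\<close> and \<open>SUP\<close> over unbounded
  sets of reals are unspecified.
\<close>

definition admissible_potential :: "'w open_system \<Rightarrow> bool" where
  "admissible_potential S \<longleftrightarrow>
     (\<lambda>(\<omega>, x). pot S \<omega> x) \<in> borel_measurable (base S \<Otimes>\<^sub>M fibre_borel S) \<and>
     (AE \<omega> in base S. bounded (pot S \<omega> ` fibre S)) \<and>
     integrable (base S) (\<lambda>\<omega>. INF x\<in>fibre S. pot S \<omega> x) \<and>
     integrable (base S) (\<lambda>\<omega>. SUP x\<in>fibre S. pot S \<omega> x) \<and>
     (AE \<omega> in base S. weight S 1 \<omega> \<in> BV (fibre S))"

section \<open>Open systems\<close>

definition hole_at :: "'w open_system \<Rightarrow> 'w \<Rightarrow> real set" where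
  "hole_at S \<omega> = {x. (\<omega>, x) \<in> hole S}"

definition open_fibre :: "'w open_system \<Rightarrow> 'w \<Rightarrow> real set" where
  "open_fibre S \<omega> = fibre S - hole_at S \<omega>"

definition admissible_hole :: "'w open_system \<Rightarrow> ('w \<Rightarrow> real measure) \<Rightarrow> bool" where
  "admissible_hole S \<nu>c \<longleftrightarrow>
     hole S \<in> sets (base S \<Otimes>\<^sub>M fibre_borel S) \<and>
     0 < (\<integral>\<omega>. measure (\<nu>c \<omega>) (hole_at S \<omega>) \<partial>base S) \<and>
     (\<integral>\<omega>. measure (\<nu>c \<omega>) (hole_at S \<omega>) \<partial>base S) < 1"

definition survivors :: "'w open_system \<Rightarrow> nat \<Rightarrow> 'w \<Rightarrow> real set" where
  "survivors S n \<omega> =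
     {x \<in> fibre S. \<forall>j\<le>n. fmap_iter S j \<omega> x \<in> open_fibre S (shift_pow S j \<omega>)}"

definition survivors_inf :: "'w open_system \<Rightarrow> 'w \<Rightarrow> real set" where
  "survivors_inf S \<omega> = (\<Inter>n. survivors S n \<omega>)"

definition open_op :: "'w open_system \<Rightarrow> 'w \<Rightarrow> (real \<Rightarrow> real) \<Rightarrow> real \<Rightarrow> real" where
  "open_op S \<omega> f = closed_op S \<omega> (\<lambda>x. f x * indicator (open_fibre S \<omega>) x)"

primrec open_op_iter ::
  "'w open_system \<Rightarrow> nat \<Rightarrow> 'w \<Rightarrow> (real \<Rightarrow> real) \<Rightarrow> real \<Rightarrow> real" where
  "open_op_iter S 0 \<omega> f = f"
| "open_op_iter S (Suc n) \<omega> f = open_op S (shift_pow S n \<omega>) (open_op_iter S n \<omega> f)"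

abbreviation open_unit :: "'w open_system \<Rightarrow> 'w \<Rightarrow> real \<Rightarrow> real" where
  "open_unit S \<omega> \<equiv> indicator (open_fibre S \<omega>)"

abbreviation open_op_unit :: "'w open_system \<Rightarrow> nat \<Rightarrow> 'w \<Rightarrow> real \<Rightarrow> real" where
  "open_op_unit S n \<omega> \<equiv> open_op_iter S n \<omega> (open_unit S \<omega>)"

definition support_set :: "'w open_system \<Rightarrow> nat \<Rightarrow> 'w \<Rightarrow> real set" where
  "support_set S n \<omega> = {x \<in> fibre S. open_op_unit S n (shift_back S n \<omega>) x \<noteq> 0}"

text \<open>
  The intersection runs over \<open>n \<ge> 1\<close>, where the sets decrease.  Including \<open>n = 0\<close> would not
  change whether it is nonempty for almost every \<open>\<omega>\<close>.
\<close>

definition support_set_inf :: "'w open_system \<Rightarrow> 'w \<Rightarrow> real set" where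
  "support_set_inf S \<omega> = (\<Inter>n\<in>{1..}. support_set S n \<omega>)"

text \<open>The functional \<open>\<Lambda>\<^sub>\<omega>\<close>.\<close>

definition Lam :: "'w open_system \<Rightarrow> 'w \<Rightarrow> (real \<Rightarrow> real) \<Rightarrow> real" where
  "Lam S \<omega> f =
     lim (\<lambda>n. INF x\<in>support_set S n (shift_pow S n \<omega>).
                open_op_iter S n \<omega> f x / open_op_unit S n \<omega> x)"

definition rho :: "'w open_system \<Rightarrow> 'w \<Rightarrow> real" where
  "rho S \<omega> = Lam S (shift S \<omega>) (open_op S \<omega> (open_unit S \<omega>))"

definition rho_prod :: "'w open_system \<Rightarrow> nat \<Rightarrow> 'w \<Rightarrow> real" where
  "rho_prod S n \<omega> = (\<Prod>j<n. rho S (shift_pow S j \<omega>))"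

section \<open>Good and bad partition elements\<close>

text \<open>
  Below, \<open>n \<ge> 1\<close>.  The open weight is the restriction of \<open>weight S n \<omega>\<close> to
  \<open>survivors S (n - 1) \<omega>\<close>; hence the intersection in the variation.
\<close>

definition open_weight_norm :: "'w open_system \<Rightarrow> nat \<Rightarrow> 'w \<Rightarrow> real" where
  "open_weight_norm S n \<omega> = sup_norm_on (survivors S (n - 1) \<omega>) (weight S n \<omega>)"

definition variation_partition :: "'w open_system \<Rightarrow> nat \<Rightarrow> 'w \<Rightarrow> real set set \<Rightarrow> bool" where
  "variation_partition S n \<omega> P \<longleftrightarrow>
     finite P \<and> partition_on (fibre S) P \<and>
     (\<forall>A\<in>P. variation_on (A \<inter> survivors S (n - 1) \<omega>) (weight S n \<omega>)
              \<le> ereal (2 * open_weight_norm S n \<omega>))"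

definition adapted_partition ::
  "'w open_system \<Rightarrow> ('w \<Rightarrow> real set set) \<Rightarrow> (nat \<Rightarrow> 'w \<Rightarrow> real set set)
     \<Rightarrow> nat \<Rightarrow> 'w \<Rightarrow> real set set \<Rightarrow> bool" where
  "adapted_partition S Z \<A> n \<omega> P \<longleftrightarrow>
     refines (fibre S) P (\<A> n \<omega>) \<and>
     refines (fibre S) P (joined_partition S Z n \<omega>) \<and>
     (\<forall>A\<in>P. disjnt A (survivors S (n - 1) \<omega>) \<or> A \<subseteq> survivors S (n - 1) \<omega>)"

definition hat_partition ::
  "'w open_system \<Rightarrow> ('w \<Rightarrow> real set set) \<Rightarrow> (nat \<Rightarrow> 'w \<Rightarrow> real set set)
     \<Rightarrow> nat \<Rightarrow> 'w \<Rightarrow> real set set" where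
  "hat_partition S Z \<A> n \<omega> =
     (THE P. adapted_partition S Z \<A> n \<omega> P \<and>
             (\<forall>Q. adapted_partition S Z \<A> n \<omega> Q \<longrightarrow> refines (fibre S) Q P))"

definition surviving_elements ::
  "'w open_system \<Rightarrow> ('w \<Rightarrow> real set set) \<Rightarrow> (nat \<Rightarrow> 'w \<Rightarrow> real set set)
     \<Rightarrow> nat \<Rightarrow> 'w \<Rightarrow> real set set" where
  "surviving_elements S Z \<A> n \<omega> =
     {A \<in> hat_partition S Z \<A> n \<omega>. A \<subseteq> survivors S (n - 1) \<omega>}"

definition bad_elements ::
  "'w open_system \<Rightarrow> ('w \<Rightarrow> real set set) \<Rightarrow> (nat \<Rightarrow> 'w \<Rightarrow> real set set)
     \<Rightarrow> nat \<Rightarrow> 'w \<Rightarrow> real set set" where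
  "bad_elements S Z \<A> n \<omega> =
     {A \<in> surviving_elements S Z \<A> n \<omega>. Lam S \<omega> (indicator A) = 0}"

definition good_elements ::
  "'w open_system \<Rightarrow> ('w \<Rightarrow> real set set) \<Rightarrow> (nat \<Rightarrow> 'w \<Rightarrow> real set set)
     \<Rightarrow> nat \<Rightarrow> 'w \<Rightarrow> real set set" where
  "good_elements S Z \<A> n \<omega> =
     {A \<in> surviving_elements S Z \<A> n \<omega>. 0 < Lam S \<omega> (indicator A)}"

definition escaped_before :: "'w open_system \<Rightarrow> nat \<Rightarrow> 'w \<Rightarrow> real set" where
  "escaped_before S n \<omega> =
     {x \<in> fibre S. \<exists>j<n. fmap_iter S j \<omega> x \<in> hole_at S (shift_pow S j \<omega>)}"

definition gap_between :: "real set \<Rightarrow> real set \<Rightarrow> real set" where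
  "gap_between A B = {x. (\<forall>a\<in>A. a < x) \<and> (\<forall>b\<in>B. x < b)}"

text \<open>
  ``Separated by a connected component \<open>C\<close>'' means that \<open>C\<close> is exactly what lies between the
  two sets.
\<close>

definition contiguous :: "'w open_system \<Rightarrow> nat \<Rightarrow> 'w \<Rightarrow> real set \<Rightarrow> real set \<Rightarrow> bool" where
  "contiguous S n \<omega> A B \<longleftrightarrow>
     A \<noteq> B \<and>
     (frontier A \<inter> frontier B \<noteq> {} \<or>
      gap_between A B \<in> components (escaped_before S n \<omega>) \<or>
      gap_between B A \<in> components (escaped_before S n \<omega>))"

text \<open>
  A family of sets is a contiguous block if any two members are linked by a chain of pairwise
  contiguous members of the family.
\<close>

definition contiguous_block :: "'w open_system \<Rightarrow> nat \<Rightarrow> 'w \<Rightarrow> real set set \<Rightarrow> bool" where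
  "contiguous_block S n \<omega> \<C> \<longleftrightarrow>
     (\<forall>A\<in>\<C>. \<forall>B\<in>\<C>. (A, B) \<in> {(C, D). C \<in> \<C> \<and> D \<in> \<C> \<and> contiguous S n \<omega> C D}\<^sup>*)"

definition xi ::
  "'w open_system \<Rightarrow> ('w \<Rightarrow> real set set) \<Rightarrow> (nat \<Rightarrow> 'w \<Rightarrow> real set set)
     \<Rightarrow> nat \<Rightarrow> 'w \<Rightarrow> nat" where
  "xi S Z \<A> n \<omega> =
     Max {card \<C> |\<C>. \<C> \<subseteq> bad_elements S Z \<A> n \<omega> \<and> contiguous_block S n \<omega> \<C>}"

text \<open>In logarithms, \<open>\<xi>\<close> is replaced by 1 when there are no bad elements at all.\<close>

definition xi_pos ::
  "'w open_system \<Rightarrow> ('w \<Rightarrow> real set set) \<Rightarrow> (nat \<Rightarrow> 'w \<Rightarrow> real set set)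
     \<Rightarrow> nat \<Rightarrow> 'w \<Rightarrow> real" where
  "xi_pos S Z \<A> n \<omega> = real (max 1 (xi S Z \<A> n \<omega>))"

definition delta ::
  "'w open_system \<Rightarrow> ('w \<Rightarrow> real set set) \<Rightarrow> (nat \<Rightarrow> 'w \<Rightarrow> real set set)
     \<Rightarrow> nat \<Rightarrow> 'w \<Rightarrow> real" where
  "delta S Z \<A> n \<omega> = Min ((\<lambda>A. Lam S \<omega> (indicator A)) ` good_elements S Z \<A> n \<omega>)"

section \<open>Random weighted open systems\<close>

text \<open>
  The standing choices of the monotonicity partitions \<open>Z\<close>, the variation partitions \<open>\<A>\<close>, and
  the closed conformal measure \<open>\<nu>c\<close> are explicit arguments.  Existence of minima over good
  elements and positivity of \<open>\<rho>\<close> are part of the corresponding logarithms being integrable.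
\<close>

definition random_weighted_open_system ::
  "'w open_system \<Rightarrow> ('w \<Rightarrow> real set set) \<Rightarrow> (nat \<Rightarrow> 'w \<Rightarrow> real set set)
     \<Rightarrow> ('w \<Rightarrow> real measure) \<Rightarrow> bool" where
  "random_weighted_open_system S Z \<A> \<nu>c \<longleftrightarrow>
     closed_system S Z \<and>
     admissible_potential S \<and>
     closed_conformal S \<nu>c \<and>
     admissible_hole S \<nu>c \<and>
     (AE \<omega> in base S. support_set_inf S \<omega> \<noteq> {}) \<and>
     (\<forall>n\<ge>1. AE \<omega> in base S. variation_partition S n \<omega> (\<A> n \<omega>)) \<and>
     log_integrable (base S) (rho S) \<and>
     (AE \<omega> in base S. \<exists>G.
        ((\<lambda>n. elog (open_weight_norm S n \<omega>) / ereal (real n)) \<longlonglongrightarrow> G) \<and>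
        G + limsup (\<lambda>n. elog (xi_pos S Z \<A> n \<omega>) / ereal (real n))
          < ereal (\<integral>\<omega>'. ln (rho S \<omega>') \<partial>base S) \<and>
        ((\<lambda>n. elog (rho_prod S n \<omega>) / ereal (real n))
            \<longlonglongrightarrow> ereal (\<integral>\<omega>'. ln (rho S \<omega>') \<partial>base S))) \<and>
     (\<forall>n\<ge>1.
        log_integrable (base S) (xi_pos S Z \<A> n) \<and>
        (AE \<omega> in base S. good_elements S Z \<A> n \<omega> \<noteq> {}) \<and>
        log_integrable (base S) (delta S Z \<A> n))"

section \<open>Associated objects\<close>

definition open_eigenvalue :: "'w open_system \<Rightarrow> ('w \<Rightarrow> real measure) \<Rightarrow> 'w \<Rightarrow> real" where
  "open_eigenvalue S \<nu> \<omega> = (\<integral>x. open_op S \<omega> (open_unit S \<omega>) x \<partial>\<nu> (shift S \<omega>))"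

definition open_conformal :: "'w open_system \<Rightarrow> ('w \<Rightarrow> real measure) \<Rightarrow> bool" where
  "open_conformal S \<nu> \<longleftrightarrow>
     random_prob_measure S \<nu> \<and>
     (AE \<omega> in base S. measure (\<nu> \<omega>) (survivors_inf S \<omega>) = 1) \<and>
     (AE \<omega> in base S. \<forall>f\<in>BV (fibre S).
        (\<integral>x. open_op S \<omega> f x \<partial>\<nu> (shift S \<omega>))
          = open_eigenvalue S \<nu> \<omega> * (\<integral>x. f x \<partial>\<nu> \<omega>))"

definition random_BV :: "'w open_system \<Rightarrow> ('w \<Rightarrow> real \<Rightarrow> real) set" where
  "random_BV S =
     {f. (\<forall>\<omega>\<in>space (base S). f \<omega> \<in> BV (fibre S)) \<and>
         (\<forall>x\<in>fibre S. (\<lambda>\<omega>. f \<omega> x) \<in> borel_measurable (base S)) \<and>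
         (\<lambda>\<omega>. sup_norm_on (fibre S) (f \<omega>)) \<in> borel_measurable (base S)}"

text \<open>
  The limit formula is part of the definition: the other conditions determine \<open>q\<close> only up to
  \<open>\<nu>\<close>-null sets, while \<open>eta\<close> below integrates \<open>q\<close> against \<open>\<nu>c\<close>.
\<close>

definition open_eigenfunction ::
  "'w open_system \<Rightarrow> ('w \<Rightarrow> real measure) \<Rightarrow> ('w \<Rightarrow> real \<Rightarrow> real) \<Rightarrow> bool" where
  "open_eigenfunction S \<nu> q \<longleftrightarrow>
     q \<in> random_BV S \<and>
     (\<integral>\<omega>. (\<integral>x. q \<omega> x \<partial>\<nu> \<omega>) \<partial>base S) = 1 \<and>
     (AE \<omega> in base S. \<forall>x\<in>fibre S.
        open_op S \<omega> (q \<omega>) x = open_eigenvalue S \<nu> \<omega> * q (shift S \<omega>) x) \<and>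
     (AE \<omega> in base S. uniform_limit (fibre S)
        (\<lambda>n x. open_op_unit S n (shift_back S n \<omega>) x
                 / Lam S \<omega> (open_op_unit S n (shift_back S n \<omega>)))
        (q \<omega>) sequentially)"

definition eta_normalizer ::
  "'w open_system \<Rightarrow> ('w \<Rightarrow> real measure) \<Rightarrow> ('w \<Rightarrow> real \<Rightarrow> real) \<Rightarrow> 'w \<Rightarrow> real" where
  "eta_normalizer S \<nu>c q \<omega> = (\<integral>x. open_unit S \<omega> x * q \<omega> x \<partial>\<nu>c \<omega>)"

text \<open>
  The measure whose integral is
  $f \mapsto \nu_{\omega,c}(1_\omega q_\omega f) / \nu_{\omega,c}(1_\omega q_\omega)$;
  the conversion to extended nonnegative reals loses nothing, as \<open>q\<close> is nonnegative on the
  fibre for almost every \<open>\<omega>\<close>.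
\<close>

definition eta ::
  "'w open_system \<Rightarrow> ('w \<Rightarrow> real measure) \<Rightarrow> ('w \<Rightarrow> real \<Rightarrow> real) \<Rightarrow> 'w \<Rightarrow> real measure" where
  "eta S \<nu>c q \<omega> =
     density (\<nu>c \<omega>) (\<lambda>x. ennreal (open_unit S \<omega> x * q \<omega> x / eta_normalizer S \<nu>c q \<omega>))"

section \<open>Escape rates and expected pressure\<close>

definition lower_escape_rate :: "'w open_system \<Rightarrow> ('w \<Rightarrow> real measure) \<Rightarrow> 'w \<Rightarrow> ereal" where
  "lower_escape_rate S \<zeta> \<omega> =
     - liminf (\<lambda>n. elog (measure (\<zeta> \<omega>) (survivors S n \<omega>)) / ereal (real n))"

definition upper_escape_rate :: "'w open_system \<Rightarrow> ('w \<Rightarrow> real measure) \<Rightarrow> 'w \<Rightarrow> ereal" where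
  "upper_escape_rate S \<zeta> \<omega> =
     - limsup (\<lambda>n. elog (measure (\<zeta> \<omega>) (survivors S n \<omega>)) / ereal (real n))"

definition has_escape_rate ::
  "'w open_system \<Rightarrow> ('w \<Rightarrow> real measure) \<Rightarrow> 'w \<Rightarrow> ereal \<Rightarrow> bool" where
  "has_escape_rate S \<zeta> \<omega> r \<longleftrightarrow>
     lower_escape_rate S \<zeta> \<omega> = r \<and> upper_escape_rate S \<zeta> \<omega> = r"

definition expected_pressure :: "'w measure \<Rightarrow> ('w \<Rightarrow> real) \<Rightarrow> real" where
  "expected_pressure M l = (\<integral>\<omega>. ln (l \<omega>) \<partial>M)"

end

theory Submission
  imports Defs
begin

text \<open>
  Write \<open>N \<omega>\<close> for the normalizer of \<open>\<eta>\<^sub>\<omega>\<close> and \<open>a\<^sub>n \<omega>\<close> for the \<open>\<nu>\<^sub>c\<close>-mass of the survivors.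
  Conformality of \<open>\<nu>\<^sub>c\<close> and the eigenfunction equation for \<open>q\<close> express the \<open>\<eta>\<close>-mass of the
  survivors as the product of \<open>\<lambda> / \<lambda>\<^sub>c\<close> along the first \<open>n\<close> points of the orbit, times
  \<open>N (\<sigma>\<^sup>n \<omega>) / N \<omega>\<close>.  By the ergodic theorem it remains to see that \<open>ln (N (\<sigma>\<^sup>n \<omega>)) / n\<close> tends to 0.
  As \<open>ln N \<circ> \<sigma> - ln N\<close> is bounded above by the integrable function \<open>h = ln \<lambda>\<^sub>c - ln \<lambda>\<close>, this
  holds as soon as \<open>N\<close> is measurable.

  Measurability comes from the limit formula for \<open>q\<close>.  Always \<open>\<Lambda> \<le> \<nu>\<close>, so the limit formula gives
  \<open>\<nu>\<^sub>\<omega>(q\<^sub>\<omega>) \<ge> 1\<close>; the integral over \<open>\<omega>\<close> being 1, equality holds almost everywhere.  Hence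
  \<open>\<Lambda>\<close> may be replaced by \<open>\<nu>\<close> in the limit formula, and \<open>N \<omega>\<close> is the limit of
  \<open>b\<^sub>n (\<sigma>\<^sup>-\<^sup>n \<omega>)\<close>, where \<open>b\<^sub>n\<close> is \<open>a\<^sub>n\<close> times the product of \<open>\<lambda>\<^sub>c / \<lambda>\<close>.

  For \<open>\<nu>\<^sub>c\<close> itself, boundedness of \<open>q\<^sub>\<omega>\<close> bounds \<open>a\<^sub>n\<close> from below by the \<open>\<eta>\<close>-mass.  For the upper
  bound, \<open>ln b\<^sub>n\<close> is a sum along the orbit of the increments \<open>u\<^sub>j \<circ> \<sigma>\<^sup>j\<close>, where \<open>u\<^sub>j \<le> h\<close>
  because \<open>a\<^sub>n\<close> decreases, and \<open>u\<^sub>j\<close> converges to the coboundary \<open>ln N \<circ> \<sigma> - ln N\<close> of integral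
  zero; Maker's generalization of the ergodic theorem then gives \<open>limsup (ln b\<^sub>n / n) \<le> 0\<close>.
\<close>

section \<open>Ergodic averages\<close>

locale ergodic_automorphism = prob_space M for M :: "'w measure" +
  fixes s :: "'w \<Rightarrow> 'w"
  assumes automorphism: "measure_preserving_automorphism M s"
    and ergodic: "ergodic M s"
begin

abbreviation s_inv :: "'w \<Rightarrow> 'w" where
  "s_inv \<equiv> inv_into (space M) s"

section \<open>Iterates of the automorphism and almost sure statements along orbits\<close>

lemma s_measurable [measurable]: "s \<in> measurable M M"
  and s_inv_measurable [measurable]: "s_inv \<in> measurable M M"
  and distr_s: "distr M M s = M"
  and bij_s: "bij_betw s (space M) (space M)"
  using automorphism by (auto simp: measure_preserving_automorphism_def)

lemma s_inv_s: "\<omega> \<in> space M \<Longrightarrow> s_inv (s \<omega>) = \<omega>"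
  and s_s_inv: "\<omega> \<in> space M \<Longrightarrow> s (s_inv \<omega>) = \<omega>"
  using bij_s by (auto simp: bij_betw_def inv_into_f_f f_inv_into_f)

lemma s_space: "\<omega> \<in> space M \<Longrightarrow> s \<omega> \<in> space M"
  by (rule measurable_space[OF s_measurable])

lemma s_pow_measurable [measurable]: "(s ^^ n) \<in> measurable M M"
  and s_inv_pow_measurable [measurable]: "(s_inv ^^ n) \<in> measurable M M"
  by (induction n) (simp_all add: measurable_comp)

lemma s_pow_space: "\<omega> \<in> space M \<Longrightarrow> (s ^^ n) \<omega> \<in> space M"
  and s_inv_pow_space: "\<omega> \<in> space M \<Longrightarrow> (s_inv ^^ n) \<omega> \<in> space M"
  by (auto intro: measurable_space[OF s_pow_measurable] measurable_space[OF s_inv_pow_measurable])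

lemma s_pow_s_inv_pow: "\<omega> \<in> space M \<Longrightarrow> (s ^^ n) ((s_inv ^^ n) \<omega>) = \<omega>"
proof (induction n)
  case (Suc n)
  have "(s ^^ Suc n) ((s_inv ^^ Suc n) \<omega>) = (s ^^ n) (s (s_inv ((s_inv ^^ n) \<omega>)))"
    by (simp add: funpow_swap1)
  with Suc show ?case by (simp add: s_s_inv s_inv_pow_space)
qed simp

lemma s_inv_pow_s_pow: "\<omega> \<in> space M \<Longrightarrow> (s_inv ^^ n) ((s ^^ n) \<omega>) = \<omega>"
proof (induction n)
  case (Suc n)
  have "(s_inv ^^ Suc n) ((s ^^ Suc n) \<omega>) = (s_inv ^^ n) (s_inv (s ((s ^^ n) \<omega>)))"
    by (simp add: funpow_swap1)
  with Suc show ?case by (simp add: s_inv_s s_pow_space)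
qed simp

lemma distr_s_inv: "distr M M s_inv = M"
proof -
  have "distr M M s_inv = distr (distr M M s) M s_inv"
    by (simp add: distr_s)
  also have "\<dots> = distr M M (s_inv \<circ> s)"
    by (simp add: distr_distr)
  also have "\<dots> = distr M M (\<lambda>x. x)"
    by (intro distr_cong) (auto simp: s_inv_s)
  finally show ?thesis by (simp add: distr_id)
qed

lemma integrable_s: "integrable M f \<Longrightarrow> integrable M (\<lambda>\<omega>. f (s \<omega>))"
  for f :: "'w \<Rightarrow> real"
  using integrable_distr[OF s_measurable, of f] by (simp add: distr_s)

lemma integral_s: "integrable M f \<Longrightarrow> (\<integral>\<omega>. f (s \<omega>) \<partial>M) = (\<integral>\<omega>. f \<omega> \<partial>M)"
  for f :: "'w \<Rightarrow> real"
  using integral_distr[OF s_measurable, of f] by (simp add: distr_s)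

lemma AE_s: "AE \<omega> in M. P \<omega> \<Longrightarrow> AE \<omega> in M. P (s \<omega>)"
  using AE_distrD[OF s_measurable, of P] by (subst (asm) distr_s)

lemma AE_s_inv: "AE \<omega> in M. P \<omega> \<Longrightarrow> AE \<omega> in M. P (s_inv \<omega>)"
  using AE_distrD[OF s_inv_measurable, of P] by (subst (asm) distr_s_inv)

lemma AE_s_pow: "AE \<omega> in M. P \<omega> \<Longrightarrow> AE \<omega> in M. \<forall>n. P ((s ^^ n) \<omega>)"
  unfolding AE_all_countable
proof
  fix n assume "AE \<omega> in M. P \<omega>"
  then show "AE \<omega> in M. P ((s ^^ n) \<omega>)"
  proof (induction n)
    case (Suc n)
    from AE_s[OF Suc.IH[OF Suc.prems]] show ?case by (simp add: funpow_swap1)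
  qed simp
qed

lemma AE_s_inv_pow: "AE \<omega> in M. P \<omega> \<Longrightarrow> AE \<omega> in M. \<forall>n. P ((s_inv ^^ n) \<omega>)"
  unfolding AE_all_countable
proof
  fix n assume "AE \<omega> in M. P \<omega>"
  then show "AE \<omega> in M. P ((s_inv ^^ n) \<omega>)"
  proof (induction n)
    case (Suc n)
    from AE_s_inv[OF Suc.IH[OF Suc.prems]] show ?case by (simp add: funpow_swap1)
  qed simp
qed

text \<open>Garsia's argument: on the invariant set where the Birkhoff sums are unbounded above,
  \<open>F (Suc n) - F n \<circ> s\<close> decreases to \<open>f\<close>, where \<open>F n\<close> is the maximum of the
  first \<open>n\<close> Birkhoff sums, and has nonnegative integral.\<close>

lemma birkhoff_sums_bounded_above:
  fixes f :: "'w \<Rightarrow> real"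
  assumes f: "integrable M f" and neg: "(\<integral>\<omega>. f \<omega> \<partial>M) < 0"
  shows "AE \<omega> in M. \<exists>K. \<forall>n. (\<Sum>j<n. f ((s ^^ j) \<omega>)) \<le> K"
proof -
  have f_meas [measurable]: "f \<in> borel_measurable M" using f by auto
  \<comment> \<open>Integer thresholds describe unboundedness by the Archimedean property and make
    \<open>A\<close> a countable combination of measurable sets.\<close>
  define A where "A = {\<omega> \<in> space M. \<forall>K::nat. \<exists>n. (\<Sum>j<n. f ((s ^^ j) \<omega>)) > real K}"
  have A [measurable]: "A \<in> sets M" unfolding A_def by measurable
  have shift: "(\<Sum>j<Suc n. f ((s ^^ j) \<omega>)) = f \<omega> + (\<Sum>j<n. f ((s ^^ j) (s \<omega>)))" for n \<omega>
    by (subst sum.lessThan_Suc_shift) (simp add: funpow_swap1)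
  \<comment> \<open>The sums at \<open>\<omega>\<close> and at \<open>s \<omega>\<close> differ by
    an index shift and the single term \<open>f \<omega>\<close>, which does not affect
    unboundedness.\<close>
  have A_iff: "s \<omega> \<in> A \<longleftrightarrow> \<omega> \<in> A" if \<omega>: "\<omega> \<in> space M" for \<omega>
  proof
    assume "s \<omega> \<in> A"
    show "\<omega> \<in> A" unfolding A_def
    proof (safe intro!: \<omega>)
      fix K :: nat
      obtain K' :: nat where K': "real K' > real K - f \<omega>" using reals_Archimedean2 by blast
      obtain n where "(\<Sum>j<n. f ((s ^^ j) (s \<omega>))) > real K'"
        using \<open>s \<omega> \<in> A\<close> unfolding A_def by blast
      with K' shift[of \<omega> n] have "(\<Sum>j<Suc n. f ((s ^^ j) \<omega>)) > real K" by linarith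
      then show "\<exists>n. (\<Sum>j<n. f ((s ^^ j) \<omega>)) > real K" by blast
    qed
  next
    assume "\<omega> \<in> A"
    show "s \<omega> \<in> A" unfolding A_def
    proof (safe intro!: s_space[OF \<omega>])
      fix K :: nat
      obtain K' :: nat where K': "real K' > real K + f \<omega>" using reals_Archimedean2 by blast
      obtain n where n: "(\<Sum>j<n. f ((s ^^ j) \<omega>)) > real (max K' K)"
        using \<open>\<omega> \<in> A\<close> unfolding A_def by blast
      \<comment> \<open>The empty sum is 0 and cannot exceed a nonnegative threshold.\<close>
      then obtain m where "n = Suc m" by (cases n) (auto simp: of_nat_max)
      with K' shift[of \<omega> m] n have "(\<Sum>j<m. f ((s ^^ j) (s \<omega>))) > real K"
        by (auto simp: of_nat_max)
      then show "\<exists>n. (\<Sum>j<n. f ((s ^^ j) (s \<omega>))) > real K" by blast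
    qed
  qed
  then have "s -` A \<inter> space M = A" by (auto simp: A_def)
  with ergodic have "measure M A = 0 \<or> measure M A = 1" by (auto simp: ergodic_def)
  moreover have "measure M A \<noteq> 1"
  proof
    assume "measure M A = 1"
    then have AE_A: "AE \<omega> in M. \<omega> \<in> A"
      using A AE_prob_1 by blast
    \<comment> \<open>The range includes \<open>k = 0\<close>, the empty sum, so \<open>F n\<close>
      is nonnegative.\<close>
    define F where "F n \<omega> = (MAX k\<in>{..n}. \<Sum>j<k. f ((s ^^ j) \<omega>))" for n \<omega>
    have F_0: "F 0 \<omega> = 0" for \<omega> by (simp add: F_def)
    have F_Suc: "F (Suc n) \<omega> = max 0 (f \<omega> + F n (s \<omega>))" for n \<omega>
    proof -
      have "F (Suc n) \<omega> = Max (insert 0 ((\<lambda>k. \<Sum>j<Suc k. f ((s ^^ j) \<omega>)) ` {..n}))"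
        unfolding F_def by (subst atMost_Suc_eq_insert_0) (simp add: image_image)
      also have "\<dots> = max 0 (MAX k\<in>{..n}. f \<omega> + (\<Sum>j<k. f ((s ^^ j) (s \<omega>))))"
        unfolding shift by (subst Max_insert) auto
      also have "(MAX k\<in>{..n}. f \<omega> + (\<Sum>j<k. f ((s ^^ j) (s \<omega>)))) = f \<omega> + F n (s \<omega>)"
        unfolding F_def
        by (subst mono_Max_commute[of "(+) (f \<omega>)"]) (auto simp: mono_def image_image)
      finally show ?thesis .
    qed
    have F_mono: "F n \<omega> \<le> F (Suc n) \<omega>" for n \<omega>
      unfolding F_def by (intro Max_mono) auto
    have F_nonneg: "0 \<le> F n \<omega>" for n \<omega>
      by (cases n) (simp_all add: F_0 F_Suc)
    have F_int: "integrable M (F n)" for n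
    proof (induction n)
      case (Suc n)
      have "integrable M (\<lambda>\<omega>. max 0 (f \<omega> + F n (s \<omega>)))"
        using f integrable_s[OF Suc] by (intro integrable_max) auto
      then show ?case by (simp add: F_Suc)
    qed (simp add: F_0)
    define G where "G n \<omega> = max (- F n (s \<omega>)) (f \<omega>)" for n \<omega>
    have G_eq: "G n \<omega> = F (Suc n) \<omega> - F n (s \<omega>)" for n \<omega>
      unfolding G_def F_Suc by (auto simp: max_def)
    have G_int: "integrable M (G n)" for n
      unfolding G_eq using F_int integrable_s by (intro Bochner_Integration.integrable_diff) auto
    \<comment> \<open>By invariance \<open>F n\<close> and its composition with \<open>s\<close>
      have the same integral, and \<open>F\<close> increases with \<open>n\<close>.\<close>
    have G_nonneg: "(\<integral>\<omega>. G n \<omega> \<partial>M) \<ge> 0" for n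
    proof -
      have "(\<integral>\<omega>. G n \<omega> \<partial>M) = (\<integral>\<omega>. F (Suc n) \<omega> \<partial>M) - (\<integral>\<omega>. F n \<omega> \<partial>M)"
        unfolding G_eq using F_int integrable_s[OF F_int] integral_s[OF F_int]
        by (subst Bochner_Integration.integral_diff) auto
      also have "\<dots> \<ge> 0" using integral_mono[OF F_int F_int, of n "Suc n"] F_mono by simp
      finally show ?thesis .
    qed
    have "(\<lambda>n. \<integral>\<omega>. G n \<omega> \<partial>M) \<longlonglongrightarrow> (\<integral>\<omega>. f \<omega> \<partial>M)"
    proof (rule integral_dominated_convergence[where w = "\<lambda>\<omega>. \<bar>f \<omega>\<bar>"])
      show "AE \<omega> in M. (\<lambda>n. G n \<omega>) \<longlonglongrightarrow> f \<omega>"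
      proof -
        \<comment> \<open>On \<open>A\<close> some sum at \<open>s \<omega>\<close> exceeds
          \<open>- f \<omega>\<close>; from that index on the maximum defining
          \<open>G n \<omega>\<close> is \<open>f \<omega>\<close>.\<close>
        have *: "(\<lambda>n. G n \<omega>) \<longlonglongrightarrow> f \<omega>" if \<omega>: "\<omega> \<in> A" for \<omega>
        proof -
          have "s \<omega> \<in> A" using A_iff \<omega> by (auto simp: A_def)
          obtain K :: nat where K: "real K > - f \<omega>" using reals_Archimedean2 by blast
          obtain k where k: "(\<Sum>j<k. f ((s ^^ j) (s \<omega>))) > real K"
            using \<open>s \<omega> \<in> A\<close> unfolding A_def by blast
          have "G n \<omega> = f \<omega>" if "n \<ge> k" for n
          proof -
            have "(\<Sum>j<k. f ((s ^^ j) (s \<omega>))) \<le> F n (s \<omega>)"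
              unfolding F_def using that by (intro Max_ge) auto
            with k K show ?thesis by (auto simp: G_def)
          qed
          then have "eventually (\<lambda>n. G n \<omega> = f \<omega>) sequentially"
            by (auto simp: eventually_sequentially)
          then show ?thesis by (rule tendsto_eventually)
        qed
        show ?thesis using AE_A by eventually_elim (rule *)
      qed
      \<comment> \<open>As \<open>- F n (s \<omega>)\<close> is at most 0, the maximum lies between
        \<open>f \<omega>\<close> and \<open>max 0 (f \<omega>)\<close>.\<close>
      show "AE \<omega> in M. norm (G n \<omega>) \<le> \<bar>f \<omega>\<bar>" for n
        proof (rule AE_I2)
        fix \<omega>
        show "norm (G n \<omega>) \<le> \<bar>f \<omega>\<bar>"
          using F_nonneg[of n "s \<omega>"] unfolding G_def by (simp add: max_def abs_if)
      qed
    qed (use f G_int in auto)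
    then have "(\<integral>\<omega>. f \<omega> \<partial>M) \<ge> 0"
      by (rule LIMSEQ_le_const) (use G_nonneg in auto)
    with neg show False by simp
  qed
  ultimately have "measure M A = 0" by blast
  then have "AE \<omega> in M. \<omega> \<notin> A"
    using A by (auto intro!: AE_not_in simp: null_sets_def emeasure_eq_measure)
  with AE_space show ?thesis
  proof eventually_elim
    case (elim \<omega>)
    then obtain K :: nat where "\<And>n. \<not> (\<Sum>j<n. f ((s ^^ j) \<omega>)) > real K"
      by (auto simp: A_def)
    then show ?case by (auto simp: not_less)
  qed
qed

text \<open>Subtracting the mean plus \<open>e / 2\<close> makes the integral negative, so the sums
  are bounded above by some \<open>K\<close>, and \<open>K / n\<close> is eventually below
  \<open>e / 2\<close>.\<close>

lemma birkhoff_upper: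
  fixes f :: "'w \<Rightarrow> real"
  assumes f: "integrable M f" and e: "0 < e"
  shows "AE \<omega> in M. eventually (\<lambda>n. (\<Sum>j<n. f ((s ^^ j) \<omega>)) / n < (\<integral>\<omega>. f \<omega> \<partial>M) + e) sequentially"
proof -
  let ?I = "\<integral>\<omega>. f \<omega> \<partial>M"
  let ?f = "\<lambda>\<omega>. f \<omega> - (?I + e / 2)"
  have "AE \<omega> in M. \<exists>K. \<forall>n. (\<Sum>j<n. ?f ((s ^^ j) \<omega>)) \<le> K"
    using f e by (intro birkhoff_sums_bounded_above) (auto simp: prob_space)
  then show ?thesis
  proof eventually_elim
    case (elim \<omega>)
    then obtain K where K: "\<And>n. (\<Sum>j<n. ?f ((s ^^ j) \<omega>)) \<le> K" by blast
    have "(\<lambda>n. K / real n) \<longlonglongrightarrow> 0" by (rule lim_const_over_n)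
    then have "eventually (\<lambda>n. K / real n < e / 2) sequentially"
      using e by (intro order_tendstoD(2)) auto
    then show ?case using eventually_gt_at_top[of 0]
    proof eventually_elim
      case (elim n)
      have "(\<Sum>j<n. f ((s ^^ j) \<omega>)) \<le> K + n * (?I + e / 2)"
        using K[of n] by (simp add: sum_subtractf)
      then have "(\<Sum>j<n. f ((s ^^ j) \<omega>)) / n \<le> K / n + (?I + e / 2)"
        using elim by (simp add: field_simps)
      with elim show ?case by linarith
    qed
  qed
qed

text \<open>The one-sided bound is applied to \<open>f\<close> and to \<open>- f\<close>, with the
  countably many margins \<open>inverse (Suc k)\<close> so that the exceptional null sets can be
  united.\<close>

lemma birkhoff:
  fixes f :: "'w \<Rightarrow> real"
  assumes f: "integrable M f"
  shows "AE \<omega> in M. (\<lambda>n. (\<Sum>j<n. f ((s ^^ j) \<omega>)) / n) \<longlonglongrightarrow> (\<integral>\<omega>. f \<omega> \<partial>M)"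
proof -
  let ?I = "\<integral>\<omega>. f \<omega> \<partial>M"
  have "AE \<omega> in M. \<forall>k. eventually (\<lambda>n. (\<Sum>j<n. f ((s ^^ j) \<omega>)) / n < ?I + inverse (Suc k)) sequentially"
    using birkhoff_upper[OF f] by (simp add: AE_all_countable)
  moreover have "AE \<omega> in M. \<forall>k. eventually (\<lambda>n. (\<Sum>j<n. - f ((s ^^ j) \<omega>)) / n < - ?I + inverse (Suc k)) sequentially"
    using birkhoff_upper[of "\<lambda>\<omega>. - f \<omega>"] f by (simp add: AE_all_countable)
  ultimately show ?thesis
  proof eventually_elim
    case (elim \<omega>)
    show ?case
    proof (rule tendstoI)
      fix e :: real assume "e > 0"
      then obtain k where k: "inverse (Suc k) < e" using reals_Archimedean by blast
      from elim(1)[rule_format, of k] elim(2)[rule_format, of k]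
      show "eventually (\<lambda>n. dist ((\<Sum>j<n. f ((s ^^ j) \<omega>)) / n) ?I < e) sequentially"
        by eventually_elim (use k in \<open>auto simp: dist_real_def sum_negf abs_less_iff\<close>)
    qed
  qed
qed

text \<open>Truncating \<open>F\<close> at heights \<open>\<plusminus>K\<close> produces coboundaries of zero integral; Fatou's lemma gives
  integrability of the limit, and dominated convergence its integral.\<close>

lemma coboundary_bounded_above:
  fixes F h :: "'w \<Rightarrow> real"
  assumes F [measurable]: "F \<in> borel_measurable M"
    and h: "integrable M h"
    and le: "AE \<omega> in M. F (s \<omega>) - F \<omega> \<le> h \<omega>"
  shows "integrable M (\<lambda>\<omega>. F (s \<omega>) - F \<omega>)"
    and "AE \<omega> in M. (\<lambda>n. F ((s ^^ n) \<omega>) / n) \<longlonglongrightarrow> 0"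
proof -
  have [measurable]: "h \<in> borel_measurable M" using h by auto
  define D where "D \<omega> = F (s \<omega>) - F \<omega>" for \<omega>
  define clamp where "clamp k x = max (- real k) (min (real k) x)" for k and x :: real
  define E where "E k \<omega> = clamp k (F (s \<omega>)) - clamp k (F \<omega>)" for k \<omega>
  have [measurable]: "D \<in> borel_measurable M" unfolding D_def by measurable
  have clamp_int: "integrable M (\<lambda>\<omega>. clamp k (F \<omega>))" for k
    by (rule integrable_const_bound[where B = k]) (auto simp: clamp_def)
  have E_int: "integrable M (E k)" for k
    unfolding E_def using clamp_int integrable_s[OF clamp_int] by simp
  have E_integral: "(\<integral>\<omega>. E k \<omega> \<partial>M) = 0" for k
    unfolding E_def using clamp_int[of k] integrable_s[OF clamp_int, of k] integral_s[OF clamp_int, of k]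
    by simp
  have [measurable]: "E k \<in> borel_measurable M" for k using E_int by blast
  have E_lim: "(\<lambda>k. E k \<omega>) \<longlonglongrightarrow> D \<omega>" for \<omega>
  proof (rule tendsto_eventually)
    obtain N :: nat where N: "real N > max \<bar>F \<omega>\<bar> \<bar>F (s \<omega>)\<bar>" using reals_Archimedean2 by blast
    have "E k \<omega> = D \<omega>" if "k \<ge> N" for k
    proof -
      have "real N \<le> real k" using that by simp
      with N have "\<bar>F \<omega>\<bar> \<le> real k" "\<bar>F (s \<omega>)\<bar> \<le> real k" by linarith+
      then show ?thesis by (auto simp: E_def D_def clamp_def abs_le_iff)
    qed
    then show "eventually (\<lambda>k. E k \<omega> = D \<omega>) sequentially"
      by (auto simp: eventually_sequentially)
  qed
  \<comment> \<open>Clamping is nondecreasing and does not increase distances.\<close>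
  have E_abs: "\<bar>E k \<omega>\<bar> \<le> \<bar>D \<omega>\<bar>" and E_pos: "E k \<omega> \<le> max 0 (D \<omega>)" for k \<omega>
    by (auto simp: E_def D_def clamp_def max_def min_def)
  \<comment> \<open>Since \<open>E k\<close> is at most the positive part of \<open>D\<close>, the
    function \<open>hp\<close> dominates every \<open>E k\<close> almost everywhere. Fatou's lemma
    is applied to the nonnegative differences.\<close>
  define hp where "hp \<omega> = max 0 (h \<omega>)" for \<omega>
  have hp_int: "integrable M hp" unfolding hp_def using h by (intro integrable_max) auto
  have [measurable]: "hp \<in> borel_measurable M" using hp_int by blast
  have D_le: "AE \<omega> in M. D \<omega> \<le> hp \<omega>"
    using le by eventually_elim (auto simp: D_def hp_def)
  have nn: "(\<integral>\<^sup>+\<omega>. ennreal (hp \<omega> - E k \<omega>) \<partial>M) = ennreal (\<integral>\<omega>. hp \<omega> \<partial>M)" for k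
  proof -
    have "AE \<omega> in M. 0 \<le> hp \<omega> - E k \<omega>"
      using D_le
    proof eventually_elim
      case (elim \<omega>)
      with E_pos[of k \<omega>] show ?case by (auto simp: hp_def)
    qed
    then have "(\<integral>\<^sup>+\<omega>. ennreal (hp \<omega> - E k \<omega>) \<partial>M) = ennreal (\<integral>\<omega>. hp \<omega> - E k \<omega> \<partial>M)"
      using hp_int E_int by (intro nn_integral_eq_integral) auto
    then show ?thesis using hp_int E_int E_integral by simp
  qed
  have "(\<integral>\<^sup>+\<omega>. ennreal (hp \<omega> - D \<omega>) \<partial>M) \<le> liminf (\<lambda>k. \<integral>\<^sup>+\<omega>. ennreal (hp \<omega> - E k \<omega>) \<partial>M)"
  proof -
    have "ennreal (hp \<omega> - D \<omega>) = liminf (\<lambda>k. ennreal (hp \<omega> - E k \<omega>))" for \<omega>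
      by (rule lim_imp_Liminf[symmetric]) (auto intro!: tendsto_intros E_lim)
    then show ?thesis by (simp add: nn_integral_liminf)
  qed
  also have "\<dots> = ennreal (\<integral>\<omega>. hp \<omega> \<partial>M)" by (simp add: nn Liminf_const)
  finally have "(\<integral>\<^sup>+\<omega>. ennreal (hp \<omega> - D \<omega>) \<partial>M) < \<infinity>"
    by (rule le_less_trans) simp
  then have "integrable M (\<lambda>\<omega>. hp \<omega> - D \<omega>)"
    using D_le by (intro integrableI_nonneg) auto
  from Bochner_Integration.integrable_diff[OF hp_int this]
  have "integrable M (\<lambda>\<omega>. hp \<omega> - (hp \<omega> - D \<omega>))" .
  moreover have "(\<lambda>\<omega>. hp \<omega> - (hp \<omega> - D \<omega>)) = D" by auto
  ultimately have D_int: "integrable M D" by (simp only:)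
  then show "integrable M (\<lambda>\<omega>. F (s \<omega>) - F \<omega>)" by (simp add: D_def[abs_def])
  have "(\<lambda>k. \<integral>\<omega>. E k \<omega> \<partial>M) \<longlonglongrightarrow> (\<integral>\<omega>. D \<omega> \<partial>M)"
    by (rule integral_dominated_convergence[where w = "\<lambda>\<omega>. \<bar>D \<omega>\<bar>"])
       (use D_int E_lim E_abs in auto)
  then have "(\<integral>\<omega>. D \<omega> \<partial>M) = 0"
    by (simp add: E_integral LIMSEQ_const_iff)
  with birkhoff[OF D_int]
  have "AE \<omega> in M. (\<lambda>n. (\<Sum>j<n. D ((s ^^ j) \<omega>)) / n) \<longlonglongrightarrow> 0" by simp
  then show "AE \<omega> in M. (\<lambda>n. F ((s ^^ n) \<omega>) / n) \<longlonglongrightarrow> 0"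
  proof eventually_elim
    case (elim \<omega>)
    \<comment> \<open>The Birkhoff sums of a coboundary telescope.\<close>
    have "(\<Sum>j<n. D ((s ^^ j) \<omega>)) = F ((s ^^ n) \<omega>) - F \<omega>" for n
      by (induction n) (auto simp: D_def)
    then have "(\<lambda>n. F ((s ^^ n) \<omega>) / n) = (\<lambda>n. (\<Sum>j<n. D ((s ^^ j) \<omega>)) / n + F \<omega> / n)"
      by (simp add: diff_divide_distrib)
    then show ?case using tendsto_add[OF elim lim_const_over_n[of "F \<omega>"]] by simp
  qed
qed

text \<open>For fixed \<open>K\<close>, all terms with index at least \<open>K\<close> are dominated
  by the supremum \<open>v K\<close> of the tail. The averages of \<open>v K\<close> converge to its
  integral by the ergodic theorem, and these integrals tend to 0 by dominated convergence.\<close>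

lemma maker:
  fixes e :: "nat \<Rightarrow> 'w \<Rightarrow> real" and H :: "'w \<Rightarrow> real"
  assumes e [measurable]: "\<And>n. e n \<in> borel_measurable M"
    and H: "integrable M H"
    and nonneg: "\<And>n \<omega>. 0 \<le> e n \<omega>" and bound: "\<And>n \<omega>. e n \<omega> \<le> H \<omega>"
    and lim: "AE \<omega> in M. (\<lambda>n. e n \<omega>) \<longlonglongrightarrow> 0"
  shows "AE \<omega> in M. (\<lambda>n. (\<Sum>j<n. e j ((s ^^ j) \<omega>)) / n) \<longlonglongrightarrow> 0"
proof -
  define v where "v K \<omega> = (SUP i. e (K + i) \<omega>)" for K \<omega>
  have bdd: "bdd_above (range (\<lambda>i. e (K + i) \<omega>))" for K \<omega>
    by (rule bdd_aboveI2) (rule bound)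
  have e_le: "e j \<omega> \<le> v K \<omega>" if "K \<le> j" for j K \<omega>
    using cSUP_upper[of "j - K" UNIV "\<lambda>i. e (K + i) \<omega>", OF _ bdd] that
    by (simp add: v_def)
  have v_nonneg: "0 \<le> v K \<omega>" for K \<omega>
    using e_le[of K K \<omega>] nonneg[of K \<omega>] by simp
  have v_le: "v K \<omega> \<le> H \<omega>" for K \<omega>
    unfolding v_def by (intro cSUP_least) (auto simp: bound)
  have v_meas [measurable]: "v K \<in> borel_measurable M" for K
    unfolding v_def by (intro borel_measurable_cSUP bdd) auto
  have v_int: "integrable M (v K)" for K
    by (rule Bochner_Integration.integrable_bound[OF H])
       (use v_nonneg v_le in \<open>auto intro!: AE_I2 intro: order_trans[OF _ abs_ge_self]\<close>)
  have v_lim: "AE \<omega> in M. (\<lambda>K. v K \<omega>) \<longlonglongrightarrow> 0"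
    using lim
  proof eventually_elim
    case (elim \<omega>)
    show ?case
    proof (rule tendstoI)
      fix r :: real assume "r > 0"
      then have "eventually (\<lambda>n. e n \<omega> < r / 2) sequentially"
        using elim by (intro order_tendstoD) auto
      then obtain N where N: "\<And>n. n \<ge> N \<Longrightarrow> e n \<omega> < r / 2"
        by (auto simp: eventually_sequentially)
      have "dist (v K \<omega>) 0 < r" if "K \<ge> N" for K
      proof -
        have "v K \<omega> \<le> r / 2"
          unfolding v_def using that by (intro cSUP_least) (simp_all only: N[THEN less_imp_le] trans_le_add1 UNIV_not_empty not_False_eq_True)
        then show ?thesis using v_nonneg[of K \<omega>] \<open>r > 0\<close> by (simp add: dist_real_def)
      qed
      then show "eventually (\<lambda>K. dist (v K \<omega>) 0 < r) sequentially"
        by (auto simp: eventually_sequentially)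
    qed
  qed
  have v_integral: "(\<lambda>K. \<integral>\<omega>. v K \<omega> \<partial>M) \<longlonglongrightarrow> (\<integral>\<omega>. 0 \<partial>M)"
    by (rule integral_dominated_convergence[where w = H])
       (use H v_lim v_nonneg v_le in auto)
  have "AE \<omega> in M. \<forall>K. (\<lambda>n. (\<Sum>j<n. v K ((s ^^ j) \<omega>)) / n) \<longlonglongrightarrow> (\<integral>\<omega>. v K \<omega> \<partial>M)"
    unfolding AE_all_countable using birkhoff[OF v_int] by blast
  then show ?thesis
  proof eventually_elim
    case (elim \<omega>)
    show ?case
    proof (rule tendstoI)
      fix r :: real assume r: "r > 0"
      then have "eventually (\<lambda>K. (\<integral>\<omega>. v K \<omega> \<partial>M) < r / 2) sequentially"
        using v_integral by (intro order_tendstoD) auto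
      then obtain K where K: "(\<integral>\<omega>. v K \<omega> \<partial>M) < r / 2" by (auto simp: eventually_sequentially)
      have "eventually (\<lambda>n. (\<Sum>j<n. v K ((s ^^ j) \<omega>)) / n < r / 2) sequentially"
        using elim K by (intro order_tendstoD) auto
      \<comment> \<open>The first \<open>K\<close> terms, which the tail supremum does not control,
        form a constant that disappears after division by \<open>n\<close>.\<close>
      moreover define B where "B = (\<Sum>j<K. e j ((s ^^ j) \<omega>))"
      have "eventually (\<lambda>n. B / real n < r / 2) sequentially"
        using lim_const_over_n[of B] r by (intro order_tendstoD) auto
      ultimately show "eventually (\<lambda>n. dist ((\<Sum>j<n. e j ((s ^^ j) \<omega>)) / n) 0 < r) sequentially"
        using eventually_ge_at_top[of K]
      proof eventually_elim
        case (elim n)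
        have "(\<Sum>j<n. e j ((s ^^ j) \<omega>)) = B + (\<Sum>j=K..<n. e j ((s ^^ j) \<omega>))"
          unfolding B_def using elim(3) by (simp add: lessThan_atLeast0 sum.atLeastLessThan_concat)
        also have "(\<Sum>j=K..<n. e j ((s ^^ j) \<omega>)) \<le> (\<Sum>j=K..<n. v K ((s ^^ j) \<omega>))"
          by (intro sum_mono e_le) auto
        also have "\<dots> \<le> (\<Sum>j<n. v K ((s ^^ j) \<omega>))"
          by (intro sum_mono2) (auto simp: v_nonneg)
        finally have "(\<Sum>j<n. e j ((s ^^ j) \<omega>)) / n \<le> B / n + (\<Sum>j<n. v K ((s ^^ j) \<omega>)) / n"
          by (simp add: divide_right_mono flip: add_divide_distrib)
        then have "(\<Sum>j<n. e j ((s ^^ j) \<omega>)) / n < r" using elim by linarith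
        moreover have "0 \<le> (\<Sum>j<n. e j ((s ^^ j) \<omega>)) / n"
          by (intro divide_nonneg_nonneg sum_nonneg) (auto simp: nonneg)
        ultimately show ?case by (simp add: dist_real_def)
      qed
    qed
  qed
qed

text \<open>The increment of \<open>b\<close> at time \<open>n\<close>, viewed from the point
  reached at that time, converges to the coboundary of \<open>L\<close> and stays below
  \<open>h\<close>. The coboundary lemma gives the first claim. For the second, the increments are
  at most the coboundary plus errors to which \<open>maker\<close> applies.\<close>

lemma backward_limit_growth:
  fixes b :: "nat \<Rightarrow> 'w \<Rightarrow> real" and h L :: "'w \<Rightarrow> real"
  assumes b [measurable]: "\<And>n. b n \<in> borel_measurable M"
    and h: "integrable M h"
    and lim: "AE \<omega> in M. (\<lambda>n. b n ((s_inv ^^ n) \<omega>)) \<longlonglongrightarrow> L \<omega>"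
    and step: "AE \<omega> in M. \<forall>n. b (Suc n) \<omega> - b n \<omega> \<le> h ((s ^^ n) \<omega>)"
  shows "AE \<omega> in M. (\<lambda>n. L ((s ^^ n) \<omega>) / n) \<longlonglongrightarrow> 0"
    and "AE \<omega> in M. \<forall>r>0. eventually (\<lambda>n. b n \<omega> / n < r) sequentially"
proof -
  \<comment> \<open>This is a measurable version of \<open>L\<close>: \<open>lim\<close> is defined,
    with some default value, also where the sequence diverges.\<close>
  define F where "F \<omega> = lim (\<lambda>n. b n ((s_inv ^^ n) \<omega>))" for \<omega>
  have F [measurable]: "F \<in> borel_measurable M"
    unfolding F_def by (intro borel_measurable_lim_metric) measurable
  have limF: "AE \<omega> in M. (\<lambda>n. b n ((s_inv ^^ n) \<omega>)) \<longlonglongrightarrow> F \<omega> \<and> F \<omega> = L \<omega>"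
    using lim by eventually_elim (auto simp: F_def limI)
  have [measurable]: "h \<in> borel_measurable M" using h by auto
  define u where "u n \<omega> = b (Suc n) ((s_inv ^^ n) \<omega>) - b n ((s_inv ^^ n) \<omega>)" for n \<omega>
  define D where "D \<omega> = F (s \<omega>) - F \<omega>" for \<omega>
  have [measurable]: "u n \<in> borel_measurable M" "D \<in> borel_measurable M" for n
    unfolding u_def D_def by measurable
  have u_lim: "AE \<omega> in M. (\<lambda>n. u n \<omega>) \<longlonglongrightarrow> D \<omega>"
    using limF AE_s[OF limF] AE_space
  proof eventually_elim
    case (elim \<omega>)
    \<comment> \<open>The point that reaches \<open>\<omega>\<close> after \<open>n\<close> steps
      reaches \<open>s \<omega>\<close> after \<open>Suc n\<close> steps, so the first term of
      \<open>u n \<omega>\<close> belongs to the limit at \<open>s \<omega>\<close>.\<close>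
    have "(s_inv ^^ Suc n) (s \<omega>) = (s_inv ^^ n) \<omega>" for n
      using elim(3) by (simp add: funpow_swap1 s_inv_s del: funpow.simps(2) add: funpow_Suc_right)
    then have "(\<lambda>n. b (Suc n) ((s_inv ^^ n) \<omega>)) \<longlonglongrightarrow> F (s \<omega>)"
      using LIMSEQ_Suc[OF conjunct1[OF elim(2)]] by simp
    then show ?case
      unfolding u_def D_def using elim by (intro tendsto_diff) auto
  qed
  have u_le: "AE \<omega> in M. \<forall>n. u n \<omega> \<le> h \<omega>"
    using AE_s_inv_pow[OF step] AE_space
  proof eventually_elim
    case (elim \<omega>)
    show ?case
    proof
      fix n
      show "u n \<omega> \<le> h \<omega>"
        using elim(1)[rule_format, of n n] elim(2) by (simp add: u_def s_pow_s_inv_pow)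
    qed
  qed
  have D_le: "AE \<omega> in M. F (s \<omega>) - F \<omega> \<le> h \<omega>"
    using u_lim u_le unfolding D_def
    by eventually_elim (auto intro: LIMSEQ_le_const2)
  note cob = coboundary_bounded_above[OF F h D_le]
  have F_lim: "AE \<omega> in M. (\<lambda>n. F ((s ^^ n) \<omega>) / n) \<longlonglongrightarrow> 0" by (rule cob)
  show "AE \<omega> in M. (\<lambda>n. L ((s ^^ n) \<omega>) / n) \<longlonglongrightarrow> 0"
    using F_lim AE_s_pow[OF limF] by eventually_elim simp
  have D_int: "integrable M D" using cob(1) by (simp add: D_def[abs_def])
  define H where "H \<omega> = \<bar>h \<omega>\<bar> + \<bar>D \<omega>\<bar>" for \<omega>
  \<comment> \<open>Cutting off at \<open>H\<close> makes the domination required by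
    \<open>maker\<close> hold everywhere. Almost everywhere \<open>u n\<close> is at most
    \<open>h\<close>, so the cut does not change the positive part.\<close>
  define e where "e n \<omega> = min (max 0 (u n \<omega> - D \<omega>)) (H \<omega>)" for n \<omega>
  have H_int: "integrable M H" unfolding H_def using h D_int by auto
  have [measurable]: "H \<in> borel_measurable M" using H_int by blast
  have e_lim: "AE \<omega> in M. (\<lambda>n. (\<Sum>j<n. e j ((s ^^ j) \<omega>)) / n) \<longlonglongrightarrow> 0"
  proof (rule maker[OF _ H_int])
    show "AE \<omega> in M. (\<lambda>n. e n \<omega>) \<longlonglongrightarrow> 0"
      using u_lim
    proof eventually_elim
      case (elim \<omega>)
      have "(\<lambda>n. e n \<omega>) \<longlonglongrightarrow> min (max 0 (D \<omega> - D \<omega>)) (H \<omega>)"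
        unfolding e_def by (intro tendsto_intros elim)
      then show ?case by (simp add: H_def)
    qed
  qed (auto simp: e_def H_def)
  have "AE \<omega> in M. \<forall>n. u n \<omega> \<le> D \<omega> + e n \<omega>"
    using u_le
  proof eventually_elim
    case (elim \<omega>)
    show ?case
    proof
      fix n
      show "u n \<omega> \<le> D \<omega> + e n \<omega>"
        using elim[rule_format, of n] by (auto simp: e_def H_def)
    qed
  qed
  from F_lim e_lim AE_s_pow[OF this] AE_space
  show "AE \<omega> in M. \<forall>r>0. eventually (\<lambda>n. b n \<omega> / n < r) sequentially"
  proof eventually_elim
    case (elim \<omega>)
    \<comment> \<open>The increments telescope: \<open>u j\<close> at the \<open>j\<close>-th orbit
      point is \<open>b (Suc j) \<omega> - b j \<omega>\<close>.\<close>
    have b_eq: "b n \<omega> = b 0 \<omega> + (\<Sum>j<n. u j ((s ^^ j) \<omega>))" for n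
      using elim(4) by (induction n) (auto simp: u_def s_inv_pow_s_pow)
    have D_eq: "(\<Sum>j<n. D ((s ^^ j) \<omega>)) = F ((s ^^ n) \<omega>) - F \<omega>" for n
      by (induction n) (auto simp: D_def)
    have b_le: "b n \<omega> \<le> (b 0 \<omega> - F \<omega>) + F ((s ^^ n) \<omega>) + (\<Sum>j<n. e j ((s ^^ j) \<omega>))" for n
    proof -
      have "(\<Sum>j<n. u j ((s ^^ j) \<omega>)) \<le> (\<Sum>j<n. D ((s ^^ j) \<omega>) + e j ((s ^^ j) \<omega>))"
        using elim(3) by (intro sum_mono) auto
      then show ?thesis unfolding b_eq[of n] by (simp add: sum.distrib D_eq)
    qed
    have "(\<lambda>n. (b 0 \<omega> - F \<omega>) / n + F ((s ^^ n) \<omega>) / n + (\<Sum>j<n. e j ((s ^^ j) \<omega>)) / n) \<longlonglongrightarrow> 0 + 0 + 0"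
      by (intro tendsto_add lim_const_over_n elim)
    then have ub: "(\<lambda>n. (b 0 \<omega> - F \<omega>) / n + F ((s ^^ n) \<omega>) / n + (\<Sum>j<n. e j ((s ^^ j) \<omega>)) / n) \<longlonglongrightarrow> 0"
      by simp
    show ?case
    proof (intro allI impI)
      fix r :: real assume "r > 0"
      from order_tendstoD(2)[OF ub this]
      show "eventually (\<lambda>n. b n \<omega> / n < r) sequentially"
      proof eventually_elim
        case (elim n)
        have "b n \<omega> / n \<le> ((b 0 \<omega> - F \<omega>) + F ((s ^^ n) \<omega>) + (\<Sum>j<n. e j ((s ^^ j) \<omega>))) / n"
          by (intro divide_right_mono b_le) simp
        with elim show ?case by (simp add: add_divide_distrib)
      qed
    qed
  qed
qed

end

section \<open>Sums over the fibres of a piecewise monotone map\<close>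

text \<open>By monotonicity the absolute differences telescope. These indicators are the test
  functions from which conformality is extended to all Borel sets.\<close>

lemma BV_indicator_atMost: "indicator {..a} \<in> BV A"
proof -
  let ?f = "indicator {..a} :: real \<Rightarrow> real"
  have anti: "?f y \<le> ?f x" if "x \<le> y" for x y
    using that by (auto simp: indicator_def)
  have "variation_on A ?f \<le> 1"
    unfolding variation_on_def
  proof (rule SUP_least)
    fix xs :: "real list" assume xs: "xs \<in> {xs. sorted_wrt (<) xs \<and> set xs \<subseteq> A}"
    have "(\<Sum>i<length xs - 1. \<bar>?f (xs ! Suc i) - ?f (xs ! i)\<bar>)
        = (\<Sum>i<length xs - 1. ?f (xs ! i) - ?f (xs ! Suc i))"
    proof (rule sum.cong)
      fix i assume "i \<in> {..<length xs - 1}"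
      then have "xs ! i < xs ! Suc i"
        using xs by (intro sorted_wrt_nth_less[of "(<)" xs]) auto
      then show "\<bar>?f (xs ! Suc i) - ?f (xs ! i)\<bar> = ?f (xs ! i) - ?f (xs ! Suc i)"
        using anti[of "xs ! i" "xs ! Suc i"] by simp
    qed simp
    \<comment> \<open>For the empty list, truncated subtraction makes both indices 0, so the
      difference is 0 whatever \<open>xs ! 0\<close> is.\<close>
    also have "\<dots> = ?f (xs ! 0) - ?f (xs ! (length xs - 1))"
      by (rule sum_lessThan_telescope')
    also have "\<dots> \<le> 1" by (auto simp: indicator_def)
    finally show "ereal (\<Sum>i<length xs - 1. \<bar>?f (xs ! Suc i) - ?f (xs ! i)\<bar>) \<le> 1"
      by (simp add: one_ereal_def)
  qed
  also have "(1 :: ereal) < \<infinity>" by simp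
  finally have "variation_on A ?f < \<infinity>" .
  moreover have "bounded (?f ` A)"
    by (rule boundedI[where B = 1]) (auto simp: indicator_def)
  ultimately show ?thesis by (simp add: BV_def)
qed

text \<open>Both transfer operators have this form, with the weight and, in the open case, the
  indicator of the open fibre absorbed into \<open>F\<close>.\<close>

definition fibre_sum :: "real set \<Rightarrow> (real \<Rightarrow> real) \<Rightarrow> (real \<Rightarrow> real) \<Rightarrow> real \<Rightarrow> real" where
  "fibre_sum I T F x = (\<Sum>y | y \<in> I \<and> T y = x. F y)"

section \<open>Preimages, inverse branches and duality for a single map\<close>

locale piecewise_monotone =
  fixes I :: "real set" and Z :: "real set set" and T :: "real \<Rightarrow> real"
  assumes compact_I: "compact I"
    and finite_Z: "finite Z" and partition_Z: "partition_on I Z"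
    and T_image: "T ` I \<subseteq> I"
    and interval: "A \<in> Z \<Longrightarrow> is_interval (T ` A)"
    and monotone: "A \<in> Z \<Longrightarrow> strict_mono_on A T \<or> strict_antimono_on A T"
begin

abbreviation B :: "real measure" where
  "B \<equiv> restrict_space borel I"

lemma I_borel [measurable]: "I \<in> sets borel"
  using compact_I by (simp add: borel_closed compact_imp_closed)

lemma Z_subset: "A \<in> Z \<Longrightarrow> A \<subseteq> I"
  using partition_Z by (auto simp: partition_on_def)

lemma inj: "A \<in> Z \<Longrightarrow> inj_on T A"
  using monotone unfolding inj_on_def monotone_on_def by (metis less_irrefl linorder_less_linear)

text \<open>Each preimage lies in exactly one partition element and is the value of the inverse
  branch belonging to it.\<close>

lemma preimages_branches:
  "bij_betw (\<lambda>A. inv_into A T x) {A \<in> Z. x \<in> T ` A} {y. y \<in> I \<and> T y = x}"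
proof (rule bij_betwI')
  fix A A' assume *: "A \<in> {A \<in> Z. x \<in> T ` A}" "A' \<in> {A \<in> Z. x \<in> T ` A}"
  then have "inv_into A T x \<in> A" "inv_into A' T x \<in> A'"
    by (auto intro: inv_into_into)
  with * partition_Z show "(inv_into A T x = inv_into A' T x) = (A = A')"
    by (metis (no_types, lifting) disjointD disjoint_iff mem_Collect_eq partition_onD2)
next
  fix A assume *: "A \<in> {A \<in> Z. x \<in> T ` A}"
  then have "inv_into A T x \<in> A" "T (inv_into A T x) = x"
    by (auto intro: inv_into_into f_inv_into_f)
  with * Z_subset show "inv_into A T x \<in> {y. y \<in> I \<and> T y = x}" by auto
next
  fix y assume "y \<in> {y. y \<in> I \<and> T y = x}"
  then obtain A where "A \<in> Z" "y \<in> A" "T y = x"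
    using partition_Z by (auto simp: partition_on_def)
  with inj show "\<exists>A\<in>{A \<in> Z. x \<in> T ` A}. y = inv_into A T x"
    by (intro bexI[of _ A]) (auto simp: inv_into_f_f)
qed

lemma finite_preimages: "finite {y. y \<in> I \<and> T y = x}"
  using bij_betw_finite[OF preimages_branches] finite_Z by auto

lemma card_preimages: "card {y. y \<in> I \<and> T y = x} \<le> card Z"
  using bij_betw_same_card[OF preimages_branches, of x] finite_Z
  by (metis (no_types, lifting) card_mono mem_Collect_eq subsetI)

text \<open>The index set of the sum no longer varies with \<open>x\<close>, which makes
  measurability accessible term by term.\<close>

lemma fibre_sum_branches:
  "fibre_sum I T F x = (\<Sum>A\<in>Z. if x \<in> T ` A then F (inv_into A T x) else 0)"
proof -
  have "fibre_sum I T F x = (\<Sum>A\<in>{A \<in> Z. x \<in> T ` A}. F (inv_into A T x))"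
    unfolding fibre_sum_def by (rule sum.reindex_bij_betw[OF preimages_branches, symmetric])
  also have "\<dots> = (\<Sum>A\<in>Z. if x \<in> T ` A then F (inv_into A T x) else 0)"
    using finite_Z by (simp add: sum.inter_filter)
  finally show ?thesis .
qed

text \<open>The inverse of a strictly monotone branch is monotone on the image, hence Borel; a
  decreasing branch is handled through the negative of its inverse.\<close>

lemma inverse_branch_measurable:
  assumes A: "A \<in> Z"
  shows "inv_into A T \<in> measurable (restrict_space borel (T ` A)) B"
proof (rule measurable_restrict_space2)
  show "inv_into A T \<in> space (restrict_space borel (T ` A)) \<rightarrow> I"
    using Z_subset[OF A] inv_into_into[of _ T A] by (simp add: Pi_iff space_restrict_space subset_iff)
  from monotone[OF A] show "inv_into A T \<in> borel_measurable (restrict_space borel (T ` A))"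
  proof
    assume mono: "strict_mono_on A T"
    have "mono_on (T ` A) (inv_into A T)"
    proof (rule mono_onI)
      fix r s assume rs: "r \<in> T ` A" "s \<in> T ` A" "r \<le> s"
      show "inv_into A T r \<le> inv_into A T s"
      proof (rule ccontr)
        assume "\<not> inv_into A T r \<le> inv_into A T s"
        then have "T (inv_into A T s) < T (inv_into A T r)"
          using mono rs by (auto intro!: strict_mono_onD[OF mono] inv_into_into)
        with rs show False by (simp add: f_inv_into_f)
      qed
    qed
    then show ?thesis by (rule borel_measurable_mono_on_fnc)
  next
    assume anti: "strict_antimono_on A T"
    have "mono_on (T ` A) (\<lambda>x. - inv_into A T x)"
    proof (rule mono_onI)
      fix r s assume rs: "r \<in> T ` A" "s \<in> T ` A" "r \<le> s"
      show "- inv_into A T r \<le> - inv_into A T s"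
      proof (rule ccontr)
        assume "\<not> - inv_into A T r \<le> - inv_into A T s"
        then have "T (inv_into A T s) < T (inv_into A T r)"
          using anti rs by (auto intro!: monotone_onD[OF anti] inv_into_into)
        with rs show False by (simp add: f_inv_into_f)
      qed
    qed
    then have "(\<lambda>x. - (- inv_into A T x)) \<in> borel_measurable (restrict_space borel (T ` A))"
      by (intro borel_measurable_uminus borel_measurable_mono_on_fnc)
    then show ?thesis by simp
  qed
qed

text \<open>Each term of the branch sum is a composition with an inverse branch on the image of a
  branch, which is an interval and so Borel, and is 0 elsewhere.\<close>

lemma fibre_sum_measurable:
  assumes F: "F \<in> borel_measurable B"
  shows "fibre_sum I T F \<in> borel_measurable B"
proof -
  have "(\<lambda>x. if x \<in> T ` A then F (inv_into A T x) else 0) \<in> borel_measurable B" if A: "A \<in> Z" for A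
  proof -
    have TA [measurable]: "T ` A \<in> sets borel"
      using interval[OF A] by (rule real_interval_borel_measurable)
    have sub: "T ` A \<subseteq> I" using Z_subset[OF A] T_image by auto
    have "{x \<in> space B. x \<in> T ` A} = T ` A"
      using sub by (auto simp only: space_restrict_space space_borel Int_UNIV_right)
    then have "{x \<in> space B. x \<in> T ` A} \<in> sets B"
      using TA sub by (simp add: sets_restrict_space_iff)
    moreover have "restrict_space B {x. x \<in> T ` A} = restrict_space borel (T ` A)"
      using TA sub by (subst restrict_restrict_space) (simp_all add: Int_absorb1 inf.absorb2)
    ultimately show ?thesis
      using measurable_compose[OF inverse_branch_measurable[OF A] F]
      by (subst measurable_If_restrict_space_iff) auto
  qed
  then show ?thesis
    unfolding fibre_sum_branches[abs_def] by (intro borel_measurable_sum)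
qed

lemma fibre_sum_bound:
  assumes "\<And>y. y \<in> I \<Longrightarrow> \<bar>F y\<bar> \<le> C" and "0 \<le> C"
  shows "\<bar>fibre_sum I T F x\<bar> \<le> real (card Z) * C"
proof -
  have "\<bar>fibre_sum I T F x\<bar> \<le> (\<Sum>y | y \<in> I \<and> T y = x. \<bar>F y\<bar>)"
    unfolding fibre_sum_def by (rule sum_abs)
  also have "\<dots> \<le> real (card {y. y \<in> I \<and> T y = x}) * C"
    using assms by (intro sum_bounded_above) auto
  also have "\<dots> \<le> real (card Z) * C"
    using card_preimages assms by (intro mult_right_mono) auto
  finally show ?thesis .
qed

text \<open>This is the generator, closed under intersections, on which Dynkin's lemma
  starts.\<close>

lemma sets_B: "sets B = sigma_sets I (range (\<lambda>a. I \<inter> {..a}))"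
proof -
  have "sets B = (\<inter>) I ` sigma_sets UNIV (range atMost)"
    by (simp add: sets_restrict_space borel_eq_atMost)
  also have "\<dots> = sigma_sets I ((\<inter>) I ` range atMost)"
    by (rule sigma_sets_Int) (use I_borel in \<open>simp_all add: borel_eq_atMost\<close>)
  finally show ?thesis by (simp add: image_image)
qed

text \<open>Dynkin's lemma extends the duality from the initial intervals to all Borel sets.\<close>

lemma fibre_sum_duality:
  assumes N: "prob_space N" "sets N = sets B" and N': "prob_space N'" "sets N' = sets B"
    and w: "w \<in> borel_measurable B" "\<And>y. y \<in> I \<Longrightarrow> 0 \<le> w y" "\<And>y. y \<in> I \<Longrightarrow> w y \<le> W"
    and const: "(\<integral>x. fibre_sum I T w x \<partial>N') = \<kappa>"
    and atMost: "\<And>a. (\<integral>x. fibre_sum I T (\<lambda>y. w y * indicator {..a} y) x \<partial>N')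
                     = \<kappa> * (\<integral>x. indicator {..a} x \<partial>N)"
    and f: "f \<in> borel_measurable B" "\<And>y. y \<in> I \<Longrightarrow> 0 \<le> f y" "\<And>y. y \<in> I \<Longrightarrow> f y \<le> C"
  shows "(\<integral>x. fibre_sum I T (\<lambda>y. w y * f y) x \<partial>N') = \<kappa> * (\<integral>x. f x \<partial>N)"
proof -
  interpret N: prob_space N by fact
  interpret N': prob_space N' by fact
  have space_N: "space N = I" "space N' = I"
    using sets_eq_imp_space_eq[OF N(2)] sets_eq_imp_space_eq[OF N'(2)]
    by (simp_all add: space_restrict_space)
  have meas_N: "borel_measurable N = borel_measurable B" "borel_measurable N' = borel_measurable B"
    using N(2) N'(2) by (auto intro: measurable_cong_sets)
  define W' where "W' = max W 0"
  have w': "0 \<le> W'" "\<And>y. y \<in> I \<Longrightarrow> w y \<le> W'" using w by (auto simp: W'_def intro: max.coboundedI1)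
  define P where "P f x = fibre_sum I T (\<lambda>y. w y * f y) x" for f x
  \<comment> \<open>\<open>Q f\<close> is the duality for \<open>f\<close>. It depends only on the
    values on \<open>I\<close> and is stable under bounded sums, multiples and bounded pointwise
    limits.\<close>
  define Q where "Q f \<longleftrightarrow> (\<integral>x. P f x \<partial>N') = \<kappa> * (\<integral>x. f x \<partial>N)" for f
  have int_N: "integrable N u" if "u \<in> borel_measurable B" "\<And>y. y \<in> I \<Longrightarrow> \<bar>u y\<bar> \<le> D" for u and D :: real
    by (rule N.integrable_const_bound[where B = D]) (use that in \<open>auto simp: meas_N space_N\<close>)
  have P_meas: "P u \<in> borel_measurable B" if "u \<in> borel_measurable B" for u
    unfolding P_def using that w by (intro fibre_sum_measurable) auto
  have P_bound: "\<bar>P u x\<bar> \<le> real (card Z) * (W' * D)" if "\<And>y. y \<in> I \<Longrightarrow> \<bar>u y\<bar> \<le> D" "0 \<le> D" for u x and D :: real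
    unfolding P_def using that w w'
    by (intro fibre_sum_bound) (auto simp: abs_mult intro!: mult_mono)
  have int_P: "integrable N' (P u)" if "u \<in> borel_measurable B" "\<And>y. y \<in> I \<Longrightarrow> \<bar>u y\<bar> \<le> D" "0 \<le> D" for u and D :: real
    by (rule N'.integrable_const_bound[where B = "real (card Z) * (W' * D)"])
       (use that P_meas P_bound in \<open>auto simp: meas_N\<close>)
  have P_cong: "P u x = P v x" if "\<And>y. y \<in> I \<Longrightarrow> u y = v y" for u v x
    unfolding P_def fibre_sum_def using that by (intro sum.cong) auto
  have Q_cong: "Q u = Q v" if "\<And>y. y \<in> I \<Longrightarrow> u y = v y" for u v
  proof -
    have "P u = P v" using P_cong[OF that] by (intro ext)
    moreover have "(\<integral>x. u x \<partial>N) = (\<integral>x. v x \<partial>N)"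
      by (rule Bochner_Integration.integral_cong) (use that space_N in auto)
    ultimately show ?thesis unfolding Q_def by simp
  qed
  have Q_add: "Q (\<lambda>x. u x + v x)"
    if "Q u" "Q v" "u \<in> borel_measurable B" "\<And>y. y \<in> I \<Longrightarrow> \<bar>u y\<bar> \<le> D"
      "v \<in> borel_measurable B" "\<And>y. y \<in> I \<Longrightarrow> \<bar>v y\<bar> \<le> D" "0 \<le> D" for u v and D :: real
  proof -
    have P_add: "P (\<lambda>x. u x + v x) = (\<lambda>x. P u x + P v x)"
      by (rule ext) (simp add: P_def fibre_sum_def distrib_left sum.distrib)
    have "integrable N' (P u)" "integrable N' (P v)" "integrable N u" "integrable N v"
      by (simp_all only: int_P[OF that(3,4,7)] int_P[OF that(5,6,7)] int_N[OF that(3,4)] int_N[OF that(5,6)])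
    then have "(\<integral>x. P u x + P v x \<partial>N') = (\<integral>x. P u x \<partial>N') + (\<integral>x. P v x \<partial>N')"
      "(\<integral>x. u x + v x \<partial>N) = (\<integral>x. u x \<partial>N) + (\<integral>x. v x \<partial>N)"
      by simp_all
    then show ?thesis
      using that(1,2) by (simp add: Q_def P_add distrib_left)
  qed
  have Q_cmult: "Q (\<lambda>x. c * u x)" if "Q u" for c u
  proof -
    have "P (\<lambda>x. c * u x) = (\<lambda>x. c * P u x)"
      by (rule ext) (simp add: P_def fibre_sum_def sum_distrib_left mult_ac)
    then show ?thesis using that by (simp add: Q_def mult_ac)
  qed
  have Q_lim: "Q u"
    if Q: "\<And>i. Q (U i)" and U: "\<And>i. U i \<in> borel_measurable B" "\<And>i y. y \<in> I \<Longrightarrow> \<bar>U i y\<bar> \<le> D"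
      and D: "0 \<le> D" and lim: "\<And>y. y \<in> I \<Longrightarrow> (\<lambda>i. U i y) \<longlonglongrightarrow> u y" for u U and D :: real
  proof -
    have u: "u \<in> borel_measurable B"
      by (rule borel_measurable_LIMSEQ_real[OF _ U(1)]) (use lim in \<open>auto simp: space_restrict_space\<close>)
    have "(\<lambda>i. \<integral>x. P (U i) x \<partial>N') \<longlonglongrightarrow> (\<integral>x. P u x \<partial>N')"
    proof (rule integral_dominated_convergence[where w = "\<lambda>_. real (card Z) * (W' * D)"])
      show "AE x in N'. (\<lambda>i. P (U i) x) \<longlonglongrightarrow> P u x"
        unfolding P_def fibre_sum_def
        by (intro AE_I2 tendsto_sum tendsto_mult tendsto_const lim) auto
    qed (use P_meas U u D P_bound in \<open>auto simp: meas_N\<close>)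
    moreover have "(\<lambda>i. \<integral>x. U i x \<partial>N) \<longlonglongrightarrow> (\<integral>x. u x \<partial>N)"
      by (rule integral_dominated_convergence[where w = "\<lambda>_. D"])
         (use U u lim in \<open>auto simp: meas_N space_N\<close>)
    then have "(\<lambda>i. \<kappa> * (\<integral>x. U i x \<partial>N)) \<longlonglongrightarrow> \<kappa> * (\<integral>x. u x \<partial>N)"
      by (rule tendsto_mult_left)
    ultimately show ?thesis
      using Q unfolding Q_def by (simp add: LIMSEQ_unique)
  qed
  have Q_const: "Q (\<lambda>_. 1)"
    using const by (simp add: Q_def P_def N.prob_space)
  have Q_sets: "Q (indicator A)" if "A \<in> sets B" for A
  proof -
    have ind [simp]: "indicator E \<in> borel_measurable B" if "E \<in> sigma_sets I (range (\<lambda>a. I \<inter> {..a}))" for E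
      using that by (simp add: sets_B[symmetric])
    have "I \<inter> {..a} \<inter> (I \<inter> {..b}) = I \<inter> {..min a b}" for a b :: real by auto
    then have "Int_stable (range (\<lambda>a. I \<inter> {..a}))" by (auto simp: Int_stable_def)
    moreover have "range (\<lambda>a. I \<inter> {..a}) \<subseteq> Pow I" by auto
    moreover have "A \<in> sigma_sets I (range (\<lambda>a. I \<inter> {..a}))" using that by (simp add: sets_B)
    ultimately show ?thesis
    proof (induction rule: sigma_sets_induct_disjoint)
      case (basic E)
      then obtain a where "E = I \<inter> {..a}" by auto
      then have "Q (indicator E) = Q (indicator {..a})" by (intro Q_cong) (auto simp: indicator_def)
      also have "\<dots>" using atMost[of a] by (simp add: Q_def P_def)
      finally show ?case .
    next
      case (compl E)
      have "Q (\<lambda>x. 1 + (- 1) * indicator E x)"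
        using compl by (intro Q_add[of _ _ 1] Q_const Q_cmult) (auto split: split_indicator)
      also have "Q (\<lambda>x. 1 + (- 1) * indicator E x) = Q (indicator (I - E))"
        by (intro Q_cong) (auto simp: indicator_def)
      finally show ?case .
    next
      case (union E)
      \<comment> \<open>Partial sums of the disjoint indicators reduce the countable union to
        \<open>Q_add\<close> and \<open>Q_lim\<close>.\<close>
      define U where "U n x = (\<Sum>i<n. indicator (E i) x :: real)" for n :: nat and x
      have U_eq: "U n = indicator (\<Union>i<n. E i)" for n
        unfolding U_def using union(1)
        by (intro ext indicator_UN_disjoint[symmetric]) (auto intro: disjoint_family_on_mono)
      have U_meas: "U n \<in> borel_measurable B" for n
        unfolding U_def using union by (intro borel_measurable_sum ind) auto
      have "Q (U n)" for n
      proof (induction n)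
        case 0
        show ?case by (simp add: U_def Q_def P_def fibre_sum_def)
      next
        case (Suc n)
        have "Q (\<lambda>x. U n x + indicator (E n) x)"
        proof (rule Q_add[of _ _ 1])
          show "indicator (E n) \<in> borel_measurable B" using union by (intro ind) auto
        qed (use Suc union U_meas in \<open>auto simp: U_eq split: split_indicator\<close>)
        then show ?case by (simp add: U_def[abs_def])
      qed
      moreover have "(\<lambda>n. U n x) \<longlonglongrightarrow> indicator (\<Union>i. E i) x" for x
        unfolding U_eq by (rule LIMSEQ_indicator_UN)
      moreover have "\<bar>U n x\<bar> \<le> 1" for n x
        unfolding U_eq by (rule indicator_abs_le_1)
      ultimately show ?case
        using U_meas by - (rule Q_lim[of U 1]; simp)
    qed (simp add: Q_def P_def fibre_sum_def)
  qed
  \<comment> \<open>The induction over nonnegative Borel functions asks for nonnegativity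
    everywhere, while \<open>f\<close> is controlled on \<open>I\<close> only.\<close>
  define f' where "f' x = (if x \<in> I then f x else 0)" for x
  have "f' \<in> borel_measurable B"
    using f(1) by (subst measurable_cong[where g = f]) (auto simp: f'_def space_restrict_space)
  moreover have "\<And>x. 0 \<le> f' x" using f(2) by (auto simp: f'_def)
  \<comment> \<open>The bound stays general because the pieces need other bounds: for
    \<open>c * u\<close> the factor \<open>u\<close> is bounded by \<open>D / c\<close>.\<close>
  ultimately have "(\<forall>y\<in>I. f' y \<le> D) \<longrightarrow> Q f'" for D :: real
  proof (induction arbitrary: D rule: borel_measurable_induct_real)
    case (set A)
    then show ?case using Q_sets by blast
  next
    case (mult u c)
    show ?case
    proof (cases "c = 0")
      case False
      with mult have "(\<forall>y\<in>I. u y \<le> D / c) \<longrightarrow> Q u" by blast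
      with False mult(1) show ?thesis by (auto intro!: Q_cmult simp: field_simps)
    qed (auto simp: Q_def P_def fibre_sum_def)
  next
    case (add u v)
    show ?case
    proof
      assume *: "\<forall>y\<in>I. v y + u y \<le> D"
      have "u y \<le> D" "v y \<le> D" if "y \<in> I" for y
        using *[rule_format, OF that] add.hyps(2)[of y] add.hyps(4)[of y] by linarith+
      moreover from this have "Q u" "Q v" using add by blast+
      ultimately show "Q (\<lambda>x. v x + u x)"
        using add by - (rule Q_add[of _ _ "max D 0"], auto intro: max.coboundedI1)
    qed
  next
    case (seq U)
    show ?case
    proof
      assume *: "\<forall>y\<in>I. f' y \<le> D"
      have le: "U i y \<le> D" if "y \<in> I" for i y
      proof -
        have "U i y \<le> f' y"
          using seq.hyps(3,4) that
          by (intro incseq_le) (auto simp: incseq_def le_fun_def space_restrict_space)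
        with * that show ?thesis by force
      qed
      then have "Q (U i)" for i using seq.IH by blast
      with le seq show "Q f'"
        by - (rule Q_lim[of U "max D 0"], auto simp: space_restrict_space intro: max.coboundedI1)
    qed
  qed
  then have "Q f'" using f(3) by (auto simp: f'_def)
  also have "Q f' = Q f" by (rule Q_cong) (simp add: f'_def)
  finally show ?thesis by (simp add: Q_def P_def)
qed

end

section \<open>Transfer operators on bounded Borel functions\<close>

text \<open>The almost sure identities, such as conformality of the two measures, are not assumed
  here; they enter pointwise through \<open>regular\<close>.\<close>

locale open_dynamics =
  fixes S :: "'w open_system" and Z :: "'w \<Rightarrow> real set set" and \<nu>c \<nu> :: "'w \<Rightarrow> real measure"
  assumes closed: "closed_system S Z"
    and pot_measurable: "(\<lambda>(\<omega>, x). pot S \<omega> x) \<in> borel_measurable (base S \<Otimes>\<^sub>M fibre_borel S)"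
    and hole_sets: "hole S \<in> sets (base S \<Otimes>\<^sub>M fibre_borel S)"
    and random_\<nu>c: "random_prob_measure S \<nu>c" and random_\<nu>: "random_prob_measure S \<nu>"
begin

abbreviation "M \<equiv> base S"
abbreviation "I \<equiv> fibre S"

sublocale ergodic_automorphism M "shift S"
  using closed by (auto simp: closed_system_def ergodic_automorphism_def ergodic_automorphism_axioms_def)

lemma shift_pow_0 [simp]: "shift_pow S 0 \<omega> = \<omega>"
  and shift_pow_Suc: "shift_pow S (Suc n) \<omega> = shift S (shift_pow S n \<omega>)"
  by (simp_all add: shift_pow_def)

lemma shift_pow_add: "shift_pow S n (shift_pow S k \<omega>) = shift_pow S (k + n) \<omega>"
  by (simp add: shift_pow_def add.commute[of k] funpow_add)

lemma shift_pow_1: "shift_pow S (Suc 0) \<omega> = shift S \<omega>"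
  by (simp add: shift_pow_Suc)

lemma shift_pow_space: "\<omega> \<in> space M \<Longrightarrow> shift_pow S n \<omega> \<in> space M"
  by (simp add: shift_pow_def s_pow_space)

lemma shift_back_space: "\<omega> \<in> space M \<Longrightarrow> shift_back S n \<omega> \<in> space M"
  by (simp add: shift_back_def s_inv_pow_space)

lemma shift_pow_back: "\<omega> \<in> space M \<Longrightarrow> shift_pow S n (shift_back S n \<omega>) = \<omega>"
  by (simp add: shift_pow_def shift_back_def s_pow_s_inv_pow)

lemma shift_back_pow: "\<omega> \<in> space M \<Longrightarrow> shift_back S n (shift_pow S n \<omega>) = \<omega>"
  by (simp add: shift_pow_def shift_back_def s_inv_pow_s_pow)

lemma piecewise_monotone: "\<omega> \<in> space M \<Longrightarrow> piecewise_monotone I (Z \<omega>) (fmap S \<omega>)"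
  using closed by (auto simp: closed_system_def piecewise_monotone_def)

lemma I_nonempty: "I \<noteq> {}"
  using closed by (simp add: closed_system_def)

lemma fmap_image: "\<omega> \<in> space M \<Longrightarrow> fmap S \<omega> ` I = I"
  using closed by (simp add: closed_system_def)

lemma fmap_I: "\<omega> \<in> space M \<Longrightarrow> x \<in> I \<Longrightarrow> fmap S \<omega> x \<in> I"
  using fmap_image by blast

lemma fmap_iter_I: "\<omega> \<in> space M \<Longrightarrow> x \<in> I \<Longrightarrow> fmap_iter S n \<omega> x \<in> I"
  by (induction n) (auto intro: fmap_I shift_pow_space)

lemma space_fibre_borel [simp]: "space (fibre_borel S) = I"
  by (simp add: fibre_borel_def space_restrict_space)

lemma weight_1: "weight S (Suc 0) \<omega> x = exp (pot S \<omega> x)"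
  by (simp add: weight_def)

lemma closed_op_fibre_sum:
  "closed_op S \<omega> f = fibre_sum I (fmap S \<omega>) (\<lambda>y. weight S 1 \<omega> y * f y)"
  by (rule ext) (simp add: closed_op_def fibre_sum_def)

lemma open_op_fibre_sum:
  "open_op S \<omega> f = fibre_sum I (fmap S \<omega>) (\<lambda>y. weight S 1 \<omega> y * open_unit S \<omega> y * f y)"
  by (rule ext) (simp add: open_op_def closed_op_def fibre_sum_def mult_ac)

text \<open>The test functions for the extended dualities. They include indicators of survivor sets,
  which need not have bounded variation, and are preserved by the open operator at regular
  points.\<close>

definition tame :: "(real \<Rightarrow> real) \<Rightarrow> bool" where
  "tame f \<longleftrightarrow> f \<in> borel_measurable (fibre_borel S) \<and> (\<exists>C. \<forall>x\<in>I. 0 \<le> f x \<and> f x \<le> C)"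

lemma tameE:
  assumes "tame f"
  obtains C where "f \<in> borel_measurable (fibre_borel S)" "0 \<le> C"
    "\<And>x. x \<in> I \<Longrightarrow> 0 \<le> f x" "\<And>x. x \<in> I \<Longrightarrow> f x \<le> C"
proof -
  from assms obtain C where C: "f \<in> borel_measurable (fibre_borel S)" "\<forall>x\<in>I. 0 \<le> f x \<and> f x \<le> C"
    by (auto simp: tame_def)
  moreover from C I_nonempty have "0 \<le> C" by force
  ultimately show ?thesis using that by blast
qed

lemma tame_const: "0 \<le> c \<Longrightarrow> tame (\<lambda>_. c)"
  by (auto simp: tame_def)

lemma tame_indicator: "A \<in> sets (fibre_borel S) \<Longrightarrow> tame (indicator A)"
  by (auto simp: tame_def indicator_def intro!: exI[of _ 1])

lemma tame_mult:
  assumes "tame f" "tame g" shows "tame (\<lambda>x. f x * g x)"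
proof -
  from assms obtain C D where
    "f \<in> borel_measurable (fibre_borel S)" "\<And>x. x \<in> I \<Longrightarrow> 0 \<le> f x" "\<And>x. x \<in> I \<Longrightarrow> f x \<le> C"
    "g \<in> borel_measurable (fibre_borel S)" "\<And>x. x \<in> I \<Longrightarrow> 0 \<le> g x" "\<And>x. x \<in> I \<Longrightarrow> g x \<le> D"
    by (metis tameE)
  then show ?thesis
    unfolding tame_def by (auto intro!: exI[of _ "C * D"] mult_mono intro: order_trans)
qed

lemma tame_compose:
  assumes "tame f" and T: "T \<in> measurable (fibre_borel S) (fibre_borel S)"
  shows "tame (\<lambda>x. f (T x))"
proof -
  from assms(1) obtain C where C: "f \<in> borel_measurable (fibre_borel S)"
    "\<And>x. x \<in> I \<Longrightarrow> 0 \<le> f x \<and> f x \<le> C" by (auto simp: tame_def)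
  have "T x \<in> I" if "x \<in> I" for x using measurable_space[OF T, of x] that by simp
  then show ?thesis
    unfolding tame_def using C measurable_compose[OF T C(1)] by blast
qed

section \<open>Measurability of the fibre maps, weights and survivor sets\<close>

lemma skew_measurable: "skew_product S \<in> measurable (M \<Otimes>\<^sub>M fibre_borel S) (M \<Otimes>\<^sub>M fibre_borel S)"
  using closed by (simp add: closed_system_def)

lemma skew_pow: "(skew_product S ^^ n) (\<omega>, x) = (shift_pow S n \<omega>, fmap_iter S n \<omega> x)"
  by (induction n) (simp_all add: skew_product_def shift_pow_Suc)

lemma skew_pow_measurable:
  "(skew_product S ^^ n) \<in> measurable (M \<Otimes>\<^sub>M fibre_borel S) (M \<Otimes>\<^sub>M fibre_borel S)"
  by (induction n) (simp_all add: measurable_comp[OF _ skew_measurable, unfolded comp_def] comp_def)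

lemma fmap_measurable:
  assumes \<omega>: "\<omega> \<in> space M"
  shows "fmap S \<omega> \<in> measurable (fibre_borel S) (fibre_borel S)"
proof -
  have "(\<lambda>x. snd (skew_product S (\<omega>, x))) \<in> measurable (fibre_borel S) (fibre_borel S)"
    by (rule measurable_compose[OF measurable_compose[OF measurable_Pair1'[OF \<omega>] skew_measurable] measurable_snd])
  then show ?thesis by (simp add: skew_product_def)
qed

lemma weight_measurable:
  assumes \<omega>: "\<omega> \<in> space M"
  shows "weight S 1 \<omega> \<in> borel_measurable (fibre_borel S)"
proof -
  have "(\<lambda>x. pot S \<omega> x) \<in> borel_measurable (fibre_borel S)"
    using measurable_compose[OF measurable_Pair1'[OF \<omega>] pot_measurable] by simp
  then show ?thesis by (simp add: weight_1[abs_def])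
qed

text \<open>The survivor set is a finite intersection of preimages of the complement of the hole
  under iterates of the skew product.\<close>

lemma survivor_set_measurable:
  "(SIGMA \<omega>:space M. survivors S n \<omega>) \<in> sets (M \<Otimes>\<^sub>M fibre_borel S)"
proof -
  let ?P = "M \<Otimes>\<^sub>M fibre_borel S"
  have "(SIGMA \<omega>:space M. survivors S n \<omega>)
      = (\<Inter>j\<in>{..n}. (skew_product S ^^ j) -` (space ?P - hole S) \<inter> space ?P)"
    by (auto simp: survivors_def open_fibre_def hole_at_def skew_pow space_pair_measure
        shift_pow_space fmap_iter_I)
  also have "\<dots> \<in> sets ?P"
    using hole_sets by (intro sets.finite_INT measurable_sets[OF skew_pow_measurable]) auto
  finally show ?thesis .
qed

lemma survivors_sets:
  assumes \<omega>: "\<omega> \<in> space M" shows "survivors S n \<omega> \<in> sets (fibre_borel S)"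
proof -
  have "survivors S n \<omega> = Pair \<omega> -` (SIGMA \<omega>:space M. survivors S n \<omega>)"
    using \<omega> by auto
  then show ?thesis using sets_Pair1[OF survivor_set_measurable] by metis
qed

lemma survivors_0: "survivors S 0 \<omega> = open_fibre S \<omega>"
  by (auto simp: survivors_def open_fibre_def)

lemma survivors_antimono: "m \<le> n \<Longrightarrow> survivors S n \<omega> \<subseteq> survivors S m \<omega>"
  by (auto simp: survivors_def)

lemma tame_open_unit: "\<omega> \<in> space M \<Longrightarrow> tame (open_unit S \<omega>)"
  using tame_indicator survivors_sets[of \<omega> 0] by (simp add: survivors_0)

text \<open>Conformality is recorded for one step; iterated dualities are derived along the orbit,
  whence \<open>forward_regular\<close>.\<close>

definition regular :: "'w \<Rightarrow> bool" where
  "regular \<omega> \<longleftrightarrow> \<omega> \<in> space M \<and> bounded (pot S \<omega> ` I) \<and> prob_space (\<nu>c \<omega>) \<and> prob_space (\<nu> \<omega>) \<and>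
     support_set_inf S \<omega> \<noteq> {} \<and>
     (\<forall>f\<in>BV I. (\<integral>x. closed_op S \<omega> f x \<partial>\<nu>c (shift S \<omega>))
        = closed_eigenvalue S \<nu>c 1 \<omega> * (\<integral>x. f x \<partial>\<nu>c \<omega>)) \<and>
     (\<forall>f\<in>BV I. (\<integral>x. open_op S \<omega> f x \<partial>\<nu> (shift S \<omega>))
        = open_eigenvalue S \<nu> \<omega> * (\<integral>x. f x \<partial>\<nu> \<omega>))"

definition forward_regular :: "'w \<Rightarrow> bool" where
  "forward_regular \<omega> \<longleftrightarrow> (\<forall>n. regular (shift_pow S n \<omega>))"

lemma forward_regularD: "forward_regular \<omega> \<Longrightarrow> regular (shift_pow S n \<omega>)"
  "forward_regular \<omega> \<Longrightarrow> regular \<omega>" "forward_regular \<omega> \<Longrightarrow> regular (shift S \<omega>)"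
  "forward_regular \<omega> \<Longrightarrow> forward_regular (shift_pow S n \<omega>)"
  unfolding forward_regular_def shift_pow_add
  using shift_pow_0[of \<omega>] shift_pow_1[of \<omega>] by metis+

lemma regular_space: "regular \<omega> \<Longrightarrow> \<omega> \<in> space M"
  by (simp add: regular_def)

lemma tame_weight:
  assumes "regular \<omega>" shows "tame (weight S 1 \<omega>)"
proof -
  from assms obtain K where "\<And>x. x \<in> I \<Longrightarrow> \<bar>pot S \<omega> x\<bar> \<le> K"
    by (auto simp: regular_def bounded_real)
  then have "weight S 1 \<omega> x \<le> exp K" if "x \<in> I" for x
    using that by (auto simp: weight_1 dest: order_trans[OF abs_ge_self])
  moreover have "0 \<le> weight S 1 \<omega> x" for x by (simp add: weight_def)
  ultimately show ?thesis
    using weight_measurable[OF regular_space[OF assms]] unfolding tame_def by blast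
qed

lemma tame_fibre_sum:
  assumes \<omega>: "\<omega> \<in> space M" and F: "tame F"
  shows "tame (fibre_sum I (fmap S \<omega>) F)"
proof -
  interpret piecewise_monotone I "Z \<omega>" "fmap S \<omega>" by (rule piecewise_monotone[OF \<omega>])
  from F obtain C where C: "F \<in> borel_measurable (fibre_borel S)" "0 \<le> C"
    "\<And>x. x \<in> I \<Longrightarrow> 0 \<le> F x" "\<And>x. x \<in> I \<Longrightarrow> F x \<le> C" by (metis tameE)
  have "fibre_sum I (fmap S \<omega>) F \<in> borel_measurable (fibre_borel S)"
    using fibre_sum_measurable C(1) by (simp add: fibre_borel_def)
  moreover have "0 \<le> fibre_sum I (fmap S \<omega>) F x" for x
    unfolding fibre_sum_def by (intro sum_nonneg) (auto simp: C)
  moreover have "fibre_sum I (fmap S \<omega>) F x \<le> real (card (Z \<omega>)) * C" for x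
    using fibre_sum_bound[of F C x] C by (auto simp: abs_of_nonneg)
  ultimately show ?thesis unfolding tame_def by blast
qed

lemma tame_open_op: "regular \<omega> \<Longrightarrow> tame f \<Longrightarrow> tame (open_op S \<omega> f)"
  unfolding open_op_fibre_sum
  by (intro tame_fibre_sum tame_mult tame_weight tame_open_unit regular_space)

lemma tame_open_op_iter: "forward_regular \<omega> \<Longrightarrow> tame f \<Longrightarrow> tame (open_op_iter S n \<omega> f)"
  by (induction n) (auto intro: tame_open_op forward_regularD)

lemma sets_\<nu>c: "\<omega> \<in> space M \<Longrightarrow> sets (\<nu>c \<omega>) = sets (fibre_borel S)"
  and sets_\<nu>: "\<omega> \<in> space M \<Longrightarrow> sets (\<nu> \<omega>) = sets (fibre_borel S)"
  using random_\<nu>c random_\<nu> by (auto simp: random_prob_measure_def)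

lemma space_\<nu>c: "\<omega> \<in> space M \<Longrightarrow> space (\<nu>c \<omega>) = I"
  and space_\<nu>: "\<omega> \<in> space M \<Longrightarrow> space (\<nu> \<omega>) = I"
  using sets_eq_imp_space_eq[OF sets_\<nu>c] sets_eq_imp_space_eq[OF sets_\<nu>] by auto

lemma integrable_tame:
  assumes "regular \<omega>" "tame f" shows "integrable (\<nu>c \<omega>) f" "integrable (\<nu> \<omega>) f"
proof -
  interpret c: prob_space "\<nu>c \<omega>" using assms by (simp add: regular_def)
  interpret o: prob_space "\<nu> \<omega>" using assms by (simp add: regular_def)
  note \<omega> = regular_space[OF assms(1)]
  from assms(2) obtain C where C: "f \<in> borel_measurable (fibre_borel S)" "0 \<le> C"
    "\<And>x. x \<in> I \<Longrightarrow> 0 \<le> f x" "\<And>x. x \<in> I \<Longrightarrow> f x \<le> C" by (metis tameE)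
  show "integrable (\<nu>c \<omega>) f"
    using C by (intro c.integrable_const_bound[where B = C])
      (auto simp: space_\<nu>c[OF \<omega>] cong: measurable_cong_sets[OF sets_\<nu>c[OF \<omega>]])
  show "integrable (\<nu> \<omega>) f"
    using C by (intro o.integrable_const_bound[where B = C])
      (auto simp: space_\<nu>[OF \<omega>] cong: measurable_cong_sets[OF sets_\<nu>[OF \<omega>]])
qed

text \<open>Conformality on \<open>BV\<close> covers the indicators of half-lines;
  \<open>fibre_sum_duality\<close> extends it to all tame functions.\<close>

lemma closed_duality:
  assumes reg: "regular \<omega>" "regular (shift S \<omega>)" and f: "tame f"
  shows "(\<integral>x. closed_op S \<omega> f x \<partial>\<nu>c (shift S \<omega>)) = closed_eigenvalue S \<nu>c 1 \<omega> * (\<integral>x. f x \<partial>\<nu>c \<omega>)"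
proof -
  note \<omega> = regular_space[OF reg(1)] regular_space[OF reg(2)]
  interpret piecewise_monotone I "Z \<omega>" "fmap S \<omega>" by (rule piecewise_monotone[OF \<omega>(1)])
  from f obtain C where C: "f \<in> borel_measurable (fibre_borel S)" "0 \<le> C"
    "\<And>x. x \<in> I \<Longrightarrow> 0 \<le> f x" "\<And>x. x \<in> I \<Longrightarrow> f x \<le> C" by (metis tameE)
  from tame_weight[OF reg(1)] obtain W where W: "weight S 1 \<omega> \<in> borel_measurable (fibre_borel S)" "0 \<le> W"
    "\<And>x. x \<in> I \<Longrightarrow> 0 \<le> weight S 1 \<omega> x" "\<And>x. x \<in> I \<Longrightarrow> weight S 1 \<omega> x \<le> W" by (metis tameE)
  show ?thesis
    unfolding closed_op_fibre_sum
  proof (rule fibre_sum_duality)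
    show "(\<integral>x. fibre_sum I (fmap S \<omega>) (weight S 1 \<omega>) x \<partial>\<nu>c (shift S \<omega>)) = closed_eigenvalue S \<nu>c 1 \<omega>"
      by (simp add: closed_eigenvalue_def closed_op_fibre_sum shift_pow_1)
    show "(\<integral>x. fibre_sum I (fmap S \<omega>) (\<lambda>y. weight S 1 \<omega> y * indicator {..a} y) x \<partial>\<nu>c (shift S \<omega>))
        = closed_eigenvalue S \<nu>c 1 \<omega> * (\<integral>x. indicator {..a} x \<partial>\<nu>c \<omega>)" for a
      using reg(1) BV_indicator_atMost[of a I]
      unfolding regular_def closed_op_fibre_sum by blast
  qed (use reg C W \<omega> in \<open>auto simp: regular_def sets_\<nu>c fibre_borel_def\<close>)
qed

text \<open>The argument for the closed operator applies with the weight cut off outside the open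
  fibre.\<close>

lemma open_duality:
  assumes reg: "regular \<omega>" "regular (shift S \<omega>)" and f: "tame f"
  shows "(\<integral>x. open_op S \<omega> f x \<partial>\<nu> (shift S \<omega>)) = open_eigenvalue S \<nu> \<omega> * (\<integral>x. f x \<partial>\<nu> \<omega>)"
proof -
  note \<omega> = regular_space[OF reg(1)] regular_space[OF reg(2)]
  interpret piecewise_monotone I "Z \<omega>" "fmap S \<omega>" by (rule piecewise_monotone[OF \<omega>(1)])
  let ?w = "\<lambda>x. weight S 1 \<omega> x * open_unit S \<omega> x"
  from f obtain C where C: "f \<in> borel_measurable (fibre_borel S)" "0 \<le> C"
    "\<And>x. x \<in> I \<Longrightarrow> 0 \<le> f x" "\<And>x. x \<in> I \<Longrightarrow> f x \<le> C" by (metis tameE)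
  have "tame ?w" using reg \<omega> by (intro tame_mult tame_weight tame_open_unit)
  then obtain W where W: "?w \<in> borel_measurable (fibre_borel S)" "0 \<le> W"
    "\<And>x. x \<in> I \<Longrightarrow> 0 \<le> ?w x" "\<And>x. x \<in> I \<Longrightarrow> ?w x \<le> W" by (rule tameE) (rule that)
  show ?thesis
    unfolding open_op_fibre_sum
  proof (rule fibre_sum_duality)
    \<comment> \<open>The eigenvalue is defined with \<open>open_unit\<close> as argument, so the
      cut occurs twice; the indicator is idempotent.\<close>
    have "open_op S \<omega> (open_unit S \<omega>) = fibre_sum I (fmap S \<omega>) ?w"
      unfolding open_op_fibre_sum by (simp add: mult.assoc flip: indicator_inter_arith)
    then show "(\<integral>x. fibre_sum I (fmap S \<omega>) ?w x \<partial>\<nu> (shift S \<omega>)) = open_eigenvalue S \<nu> \<omega>"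
      by (simp add: open_eigenvalue_def)
    show "(\<integral>x. fibre_sum I (fmap S \<omega>) (\<lambda>y. ?w y * indicator {..a} y) x \<partial>\<nu> (shift S \<omega>))
        = open_eigenvalue S \<nu> \<omega> * (\<integral>x. indicator {..a} x \<partial>\<nu> \<omega>)" for a
      using reg(1) BV_indicator_atMost[of a I]
      unfolding regular_def open_op_fibre_sum by blast
  qed (use reg C W \<omega> in \<open>auto simp: regular_def sets_\<nu> fibre_borel_def\<close>)
qed

text \<open>In the duality for the open unit, the left side is the eigenvalue by definition and can
  be cancelled.\<close>

lemma integral_open_unit:
  assumes reg: "regular \<omega>" "regular (shift S \<omega>)" and pos: "0 < open_eigenvalue S \<nu> \<omega>"
  shows "(\<integral>x. open_unit S \<omega> x \<partial>\<nu> \<omega>) = 1"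
  using open_duality[OF reg tame_open_unit[OF regular_space[OF reg(1)]]] pos
  by (simp add: open_eigenvalue_def)

definition closed_product :: "nat \<Rightarrow> 'w \<Rightarrow> real" where
  "closed_product n \<omega> = (\<Prod>j<n. closed_eigenvalue S \<nu>c 1 (shift_pow S j \<omega>))"

definition open_product :: "nat \<Rightarrow> 'w \<Rightarrow> real" where
  "open_product n \<omega> = (\<Prod>j<n. open_eigenvalue S \<nu> (shift_pow S j \<omega>))"

lemma open_duality_iter:
  assumes reg: "forward_regular \<omega>" and f: "tame f"
  shows "(\<integral>x. open_op_iter S n \<omega> f x \<partial>\<nu> (shift_pow S n \<omega>)) = open_product n \<omega> * (\<integral>x. f x \<partial>\<nu> \<omega>)"
proof (induction n)
  case (Suc n)
  have "regular (shift S (shift_pow S n \<omega>))"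
    using forward_regularD(1)[OF reg, of "Suc n"] by (simp add: shift_pow_Suc)
  from open_duality[OF forward_regularD(1)[OF reg] this tame_open_op_iter[OF reg f]] Suc
  show ?case by (simp add: shift_pow_Suc open_product_def)
qed (simp add: open_product_def)

text \<open>Integrals of iterates of the open operator become integrals over survivors at the
  initial time. The factor \<open>\<phi>\<close> is carried along for the induction, where it
  absorbs the cut at the last time.\<close>

lemma closed_duality_iter:
  assumes reg: "forward_regular \<omega>" and f: "tame f" and \<phi>: "tame \<phi>"
  shows "(\<integral>x. \<phi> x * open_unit S (shift_pow S n \<omega>) x * open_op_iter S n \<omega> f x \<partial>\<nu>c (shift_pow S n \<omega>))
    = closed_product n \<omega> * (\<integral>x. \<phi> (fmap_iter S n \<omega> x) * indicator (survivors S n \<omega>) x * f x \<partial>\<nu>c \<omega>)"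
  using \<phi>
proof (induction n arbitrary: \<phi>)
  case 0
  show ?case by (simp add: closed_product_def survivors_0)
next
  case (Suc n)
  define \<tau> where "\<tau> = shift_pow S n \<omega>"
  have \<tau>: "regular \<tau>" "regular (shift S \<tau>)" "\<tau> \<in> space M" "shift S \<tau> \<in> space M"
    using forward_regularD(1)[OF reg, of "Suc n"] forward_regularD(1)[OF reg, of n]
    by (simp_all add: \<tau>_def shift_pow_Suc regular_space)
  \<comment> \<open>The test function and the cut at time \<open>Suc n\<close>, pulled back by one
    step, can be taken inside the sum over preimages.\<close>
  define \<psi> where "\<psi> y = \<phi> (fmap S \<tau> y) * open_unit S (shift S \<tau>) (fmap S \<tau> y)" for y
  have \<psi>: "tame \<psi>"
    unfolding \<psi>_def using Suc.prems \<tau>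
    by (intro tame_mult tame_compose[OF _ fmap_measurable] tame_open_unit) auto
  let ?G = "open_op_iter S n \<omega> f"
  \<comment> \<open>Surviving up to time \<open>n\<close> and landing in the open fibre at the next
    step is survival up to time \<open>Suc n\<close>.\<close>
  have "\<psi> (fmap_iter S n \<omega> x) * indicator (survivors S n \<omega>) x
      = \<phi> (fmap_iter S (Suc n) \<omega> x) * indicator (survivors S (Suc n) \<omega>) x" for x
    by (auto simp: \<psi>_def \<tau>_def indicator_def survivors_def shift_pow_Suc le_Suc_eq)
  then have integrand: "(\<lambda>x. \<psi> (fmap_iter S n \<omega> x) * indicator (survivors S n \<omega>) x * f x)
      = (\<lambda>x. \<phi> (fmap_iter S (Suc n) \<omega> x) * indicator (survivors S (Suc n) \<omega>) x * f x)"
    by simp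
  have "\<phi> x * open_unit S (shift S \<tau>) x * open_op S \<tau> ?G x
      = closed_op S \<tau> (\<lambda>y. \<psi> y * open_unit S \<tau> y * ?G y) x" for x
    unfolding open_op_def closed_op_def \<psi>_def sum_distrib_left by (intro sum.cong) auto
  then have "(\<integral>x. \<phi> x * open_unit S (shift S \<tau>) x * open_op S \<tau> ?G x \<partial>\<nu>c (shift S \<tau>))
      = closed_eigenvalue S \<nu>c 1 \<tau> * (\<integral>x. \<psi> x * open_unit S \<tau> x * ?G x \<partial>\<nu>c \<tau>)"
    using closed_duality[OF \<tau>(1,2), of "\<lambda>y. \<psi> y * open_unit S \<tau> y * ?G y"]
      \<psi> \<tau> tame_open_op_iter[OF reg f] by (simp add: tame_mult tame_open_unit)
  also have "(\<integral>x. \<psi> x * open_unit S \<tau> x * ?G x \<partial>\<nu>c \<tau>)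
      = closed_product n \<omega> * (\<integral>x. \<psi> (fmap_iter S n \<omega> x) * indicator (survivors S n \<omega>) x * f x \<partial>\<nu>c \<omega>)"
    unfolding \<tau>_def by (rule Suc.IH[OF \<psi>])
  also note integrand
  finally show ?case
    by (simp add: \<tau>_def shift_pow_Suc closed_product_def mult_ac del: fmap_iter.simps)
qed

section \<open>Positivity and homogeneity of the open operator\<close>

lemma open_op_mono:
  assumes "\<And>x. x \<in> I \<Longrightarrow> f x \<le> g x" shows "open_op S \<omega> f x \<le> open_op S \<omega> g x"
  unfolding open_op_fibre_sum fibre_sum_def
  by (intro sum_mono mult_left_mono) (auto simp: assms weight_def)

lemma open_op_iter_mono:
  assumes "\<And>x. x \<in> I \<Longrightarrow> f x \<le> g x"
  shows "x \<in> I \<Longrightarrow> open_op_iter S n \<omega> f x \<le> open_op_iter S n \<omega> g x"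
  using assms by (induction n arbitrary: x) (auto intro: open_op_mono)

lemma open_op_cmult: "open_op S \<omega> (\<lambda>x. c * f x) = (\<lambda>x. c * open_op S \<omega> f x)"
  unfolding open_op_fibre_sum fibre_sum_def by (simp add: sum_distrib_left mult_ac)

lemma open_op_iter_cmult: "open_op_iter S n \<omega> (\<lambda>x. c * f x) = (\<lambda>x. c * open_op_iter S n \<omega> f x)"
  by (induction n) (simp_all add: open_op_cmult)

text \<open>The first application of the operator makes this cut anyway; at \<open>n = 0\<close> no
  operator has been applied.\<close>

lemma open_op_iter_cut:
  assumes "1 \<le> n" shows "open_op_iter S n \<omega> (\<lambda>x. f x * open_unit S \<omega> x) = open_op_iter S n \<omega> f"
  using assms
proof (induction n rule: dec_induct)
  case base
  show ?case by (simp add: open_op_def mult.assoc flip: indicator_inter_arith)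
qed simp

lemma open_op_iter_nonneg:
  assumes "\<And>x. x \<in> I \<Longrightarrow> 0 \<le> f x" shows "x \<in> I \<Longrightarrow> 0 \<le> open_op_iter S n \<omega> f x"
  using open_op_iter_mono[of "\<lambda>_. 0" f x n \<omega>] open_op_iter_cmult[of n \<omega> 0 "\<lambda>_. 0"] assms
  by simp

lemma open_op_unit_nonneg: "x \<in> I \<Longrightarrow> 0 \<le> open_op_unit S n \<omega> x"
  by (rule open_op_iter_nonneg) auto

text \<open>After cutting, \<open>f\<close> is compared with \<open>C\<close> times the open unit.
  This bounds the quotients in the definition of \<open>Lam\<close> uniformly in
  \<open>n\<close>.\<close>

lemma open_op_iter_le_unit:
  assumes "\<And>x. x \<in> I \<Longrightarrow> f x \<le> C" "1 \<le> n" "x \<in> I"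
  shows "open_op_iter S n \<omega> f x \<le> C * open_op_unit S n \<omega> x"
proof -
  have "open_op_iter S n \<omega> (\<lambda>x. f x * open_unit S \<omega> x) x \<le> open_op_iter S n \<omega> (\<lambda>x. C * open_unit S \<omega> x) x"
    using assms by (intro open_op_iter_mono mult_right_mono) auto
  then show ?thesis using assms by (simp add: open_op_iter_cut open_op_iter_cmult)
qed

section \<open>The functional \<open>Lam\<close> as an increasing limit\<close>

context
  fixes \<omega> f
  assumes reg: "forward_regular \<omega>" and tame: "tame f"
begin

definition quot :: "nat \<Rightarrow> real" where
  "quot n = (INF x\<in>support_set S n (shift_pow S n \<omega>). open_op_iter S n \<omega> f x / open_op_unit S n \<omega> x)"

lemma support_eq: "support_set S n (shift_pow S n \<omega>) = {x \<in> I. open_op_unit S n \<omega> x \<noteq> 0}"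
  using regular_space[OF forward_regularD(2)[OF reg]] by (simp add: support_set_def shift_back_pow)

text \<open>Regularity of the \<open>n\<close>-th orbit point makes its
  \<open>support_set_inf\<close> nonempty, and that set lies in each support set with
  \<open>1 \<le> n\<close>.\<close>

lemma support_nonempty: "1 \<le> n \<Longrightarrow> support_set S n (shift_pow S n \<omega>) \<noteq> {}"
  using forward_regularD(1)[OF reg, of n] by (auto simp: regular_def support_set_inf_def)

lemma quot_bounds:
  obtains C where "\<And>n x. 1 \<le> n \<Longrightarrow> x \<in> support_set S n (shift_pow S n \<omega>) \<Longrightarrow>
      0 \<le> open_op_iter S n \<omega> f x / open_op_unit S n \<omega> x \<and>
      open_op_iter S n \<omega> f x / open_op_unit S n \<omega> x \<le> C"
proof -
  from tame obtain C where C: "\<And>x. x \<in> I \<Longrightarrow> 0 \<le> f x" "\<And>x. x \<in> I \<Longrightarrow> f x \<le> C" by (metis tameE)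
  show ?thesis
  proof (rule that[of C])
    fix n x assume n: "1 \<le> n" and x: "x \<in> support_set S n (shift_pow S n \<omega>)"
    then have "x \<in> I" "0 < open_op_unit S n \<omega> x"
      using open_op_unit_nonneg[of x n \<omega>] by (auto simp: support_eq)
    then show "0 \<le> open_op_iter S n \<omega> f x / open_op_unit S n \<omega> x \<and>
      open_op_iter S n \<omega> f x / open_op_unit S n \<omega> x \<le> C"
      using open_op_iter_nonneg[of f x n \<omega>] open_op_iter_le_unit[of f C n x \<omega>] C n
      by (simp add: divide_le_eq)
  qed
qed

text \<open>On the support set this is the infimum bound; elsewhere the left side is 0.\<close>

lemma quot_le:
  assumes n: "1 \<le> n" and x: "x \<in> I"
  shows "quot n * open_op_unit S n \<omega> x \<le> open_op_iter S n \<omega> f x"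
proof (cases "open_op_unit S n \<omega> x = 0")
  case True
  then show ?thesis using open_op_iter_nonneg[of f x n \<omega>] tame x by (auto elim: tameE)
next
  case False
  obtain C where C: "\<And>n x. 1 \<le> n \<Longrightarrow> x \<in> support_set S n (shift_pow S n \<omega>) \<Longrightarrow>
      0 \<le> open_op_iter S n \<omega> f x / open_op_unit S n \<omega> x" by (metis quot_bounds)
  have "quot n \<le> open_op_iter S n \<omega> f x / open_op_unit S n \<omega> x"
    unfolding quot_def using False x C[OF n] by (intro cINF_lower bdd_belowI2) (auto simp: support_eq)
  then show ?thesis
    using False open_op_unit_nonneg[OF x, of n \<omega>] by (simp add: le_divide_eq)
qed

lemma quot_nonneg: "1 \<le> n \<Longrightarrow> 0 \<le> quot n"
  unfolding quot_def by (intro cINF_greatest support_nonempty) (metis quot_bounds)+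

text \<open>One more application of the positive operator to \<open>quot_le\<close> keeps the
  constant, so \<open>quot n\<close> is also a lower bound for the quotients at time
  \<open>Suc n\<close>.\<close>

lemma quot_mono:
  assumes n: "1 \<le> n" shows "quot n \<le> quot (Suc n)"
proof -
  have *: "quot n * open_op_unit S (Suc n) \<omega> x \<le> open_op_iter S (Suc n) \<omega> f x" for x
    using open_op_mono[OF quot_le[OF n]] by (simp add: open_op_cmult)
  show ?thesis
    unfolding quot_def[of "Suc n"]
  proof (intro cINF_greatest support_nonempty)
    fix x assume "x \<in> support_set S (Suc n) (shift_pow S (Suc n) \<omega>)"
    then have "0 < open_op_unit S (Suc n) \<omega> x"
      using open_op_unit_nonneg[of x "Suc n" \<omega>] unfolding support_eq by force
    with * show "quot n \<le> open_op_iter S (Suc n) \<omega> f x / open_op_unit S (Suc n) \<omega> x"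
      by (simp add: le_divide_eq del: open_op_iter.simps)
  qed simp
qed

lemma quot_tendsto: "quot \<longlonglongrightarrow> Lam S \<omega> f"
proof -
  obtain C where C: "\<And>n x. 1 \<le> n \<Longrightarrow> x \<in> support_set S n (shift_pow S n \<omega>) \<Longrightarrow>
      0 \<le> open_op_iter S n \<omega> f x / open_op_unit S n \<omega> x \<and>
      open_op_iter S n \<omega> f x / open_op_unit S n \<omega> x \<le> C" by (metis quot_bounds)
  have "quot n \<le> C" if n: "1 \<le> n" for n
  proof -
    obtain x where x: "x \<in> support_set S n (shift_pow S n \<omega>)" using support_nonempty[OF n] by auto
    have "quot n \<le> open_op_iter S n \<omega> f x / open_op_unit S n \<omega> x"
      unfolding quot_def using x C[OF n] by (intro cINF_lower bdd_belowI2) auto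
    then show ?thesis using C[OF n x] by linarith
  qed
  \<comment> \<open>The index is shifted because the bounds and the monotonicity are available from
    1 on.\<close>
  moreover have "incseq (\<lambda>n. quot (Suc n))" by (intro incseq_SucI quot_mono) simp
  ultimately obtain L where "(\<lambda>n. quot (Suc n)) \<longlonglongrightarrow> L"
    by (metis incseq_convergent[of "\<lambda>n. quot (Suc n)" C] le_add1 plus_1_eq_Suc)
  then have "quot \<longlonglongrightarrow> L" by (rule LIMSEQ_imp_Suc)
  moreover from this have "L = Lam S \<omega> f" by (simp add: Lam_def quot_def[abs_def] limI)
  ultimately show ?thesis by simp
qed

lemma Lam_nonneg: "0 \<le> Lam S \<omega> f"
  by (rule LIMSEQ_le_const[OF quot_tendsto]) (use quot_nonneg in blast)

text \<open>Integrating \<open>quot_le\<close> over the fibre at time \<open>n\<close> produces the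
  positive factor \<open>open_product n \<omega>\<close> on both sides. It cancels, since the open
  unit has integral 1.\<close>

lemma Lam_le_integral:
  assumes pos: "\<And>j. 0 < open_eigenvalue S \<nu> (shift_pow S j \<omega>)"
  shows "Lam S \<omega> f \<le> (\<integral>x. f x \<partial>\<nu> \<omega>)"
proof (rule LIMSEQ_le_const2[OF quot_tendsto], intro exI allI impI)
  fix n :: nat assume n: "1 \<le> n"
  have \<omega>: "\<omega> \<in> space M" by (rule regular_space[OF forward_regularD(2)[OF reg]])
  have LL: "0 < open_product n \<omega>" unfolding open_product_def by (intro prod_pos) (simp add: pos)
  note int = integrable_tame(2)[OF forward_regularD(1)[OF reg] tame_open_op_iter[OF reg]]
  have "(\<integral>x. quot n * open_op_unit S n \<omega> x \<partial>\<nu> (shift_pow S n \<omega>))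
      \<le> (\<integral>x. open_op_iter S n \<omega> f x \<partial>\<nu> (shift_pow S n \<omega>))"
    using int[OF tame] int[OF tame_open_unit[OF \<omega>]] quot_le[OF n] space_\<nu>[OF shift_pow_space[OF \<omega>]]
    by (intro integral_mono) auto
  then have "open_product n \<omega> * quot n \<le> open_product n \<omega> * (\<integral>x. f x \<partial>\<nu> \<omega>)"
    using integral_open_unit[OF forward_regularD(2,3)[OF reg]] pos[of 0]
    by (simp add: open_duality_iter[OF reg] tame tame_open_unit[OF \<omega>] mult_ac)
  with LL show "quot n \<le> (\<integral>x. f x \<partial>\<nu> \<omega>)" by simp
qed

end

end

section \<open>The eigenfunction and the survivor masses\<close>

lemma uniform_limit_integral:
  fixes f :: "nat \<Rightarrow> 'a \<Rightarrow> real"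
  assumes "prob_space N" and lim: "uniform_limit (space N) f g sequentially"
    and f: "\<And>n. integrable N (f n)" and g: "integrable N g"
  shows "(\<lambda>n. \<integral>x. f n x \<partial>N) \<longlonglongrightarrow> (\<integral>x. g x \<partial>N)"
proof (rule tendstoI)
  interpret prob_space N by fact
  fix e :: real assume "e > 0"
  then have "eventually (\<lambda>n. \<forall>x\<in>space N. dist (f n x) (g x) < e / 2) sequentially"
    using lim by (intro uniform_limitD) auto
  then show "eventually (\<lambda>n. dist (\<integral>x. f n x \<partial>N) (\<integral>x. g x \<partial>N) < e) sequentially"
  proof eventually_elim
    case (elim n)
    have "\<bar>\<integral>x. f n x - g x \<partial>N\<bar> \<le> (\<integral>x. \<bar>f n x - g x\<bar> \<partial>N)"
      by (rule integral_abs_bound)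
    also have "\<dots> \<le> (\<integral>x. e / 2 \<partial>N)"
      using elim f g by (intro integral_mono) (auto simp: dist_real_def intro: less_imp_le)
    also have "\<dots> < e" using \<open>e > 0\<close> by (simp add: prob_space)
    finally show ?case using f g by (simp add: dist_real_def)
  qed
qed

lemma has_escape_rateI:
  assumes pos: "\<And>n. 0 < measure (\<zeta> \<omega>) (survivors S n \<omega>)"
    and lim: "(\<lambda>n. ln (measure (\<zeta> \<omega>) (survivors S n \<omega>)) / n) \<longlonglongrightarrow> - r"
  shows "has_escape_rate S \<zeta> \<omega> (ereal r)"
proof -
  have "(\<lambda>n. elog (measure (\<zeta> \<omega>) (survivors S n \<omega>)) / ereal (real n)) \<longlonglongrightarrow> ereal (- r)"
  proof (rule Lim_transform_eventually)
    show "(\<lambda>n. ereal (ln (measure (\<zeta> \<omega>) (survivors S n \<omega>)) / n)) \<longlonglongrightarrow> ereal (- r)"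
      using lim by (simp add: tendsto_ereal)
    \<comment> \<open>At \<open>n = 0\<close> the real quotient is 0 while the extended one need not
      be, so the sequences are compared for positive \<open>n\<close>.\<close>
    show "eventually (\<lambda>n. ereal (ln (measure (\<zeta> \<omega>) (survivors S n \<omega>)) / n)
        = elog (measure (\<zeta> \<omega>) (survivors S n \<omega>)) / ereal (real n)) sequentially"
      using eventually_gt_at_top[of 0] by eventually_elim (simp add: elog_def pos)
  qed
  then show ?thesis
    unfolding has_escape_rate_def lower_escape_rate_def upper_escape_rate_def
    by (simp add: lim_imp_Liminf lim_imp_Limsup)
qed

context open_dynamics
begin

section \<open>Survivor masses and their measurability\<close>

lemma open_eigenvalue_nonneg: "0 \<le> open_eigenvalue S \<nu> \<omega>"
  unfolding open_eigenvalue_def open_op_fibre_sum fibre_sum_def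
  by (intro Bochner_Integration.integral_nonneg sum_nonneg) (auto simp: weight_def)

lemma open_op_cong: "(\<And>x. x \<in> I \<Longrightarrow> f x = g x) \<Longrightarrow> open_op S \<omega> f x = open_op S \<omega> g x"
  by (intro antisym open_op_mono) auto

lemma shift_back_0: "shift_back S 0 \<omega> = \<omega>"
  by (simp add: shift_back_def)

definition survivor_mass :: "nat \<Rightarrow> 'w \<Rightarrow> real" where
  "survivor_mass n \<omega> = measure (\<nu>c \<omega>) (survivors S n \<omega>)"

text \<open>This is \<open>closed_duality_iter\<close> for the constant 1 and the open unit, which
  is 1 on the survivors.\<close>

lemma survivor_mass_eq:
  assumes reg: "forward_regular \<omega>"
  shows "(\<integral>x. open_unit S (shift_pow S n \<omega>) x * open_op_unit S n \<omega> x \<partial>\<nu>c (shift_pow S n \<omega>))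
    = closed_product n \<omega> * survivor_mass n \<omega>"
proof -
  have \<omega>: "\<omega> \<in> space M" by (rule regular_space[OF forward_regularD(2)[OF reg]])
  have "(\<lambda>x. indicator (survivors S n \<omega>) x * open_unit S \<omega> x) = (indicator (survivors S n \<omega>) :: real \<Rightarrow> real)"
    using survivors_antimono[of 0 n \<omega>] by (auto simp: survivors_0 indicator_def fun_eq_iff)
  then have "(\<integral>x. open_unit S (shift_pow S n \<omega>) x * open_op_unit S n \<omega> x \<partial>\<nu>c (shift_pow S n \<omega>))
    = closed_product n \<omega> * (\<integral>x. indicator (survivors S n \<omega>) x \<partial>\<nu>c \<omega>)"
    using closed_duality_iter[OF reg tame_open_unit[OF \<omega>] tame_const[of 1], of n] by simp
  also have "(\<integral>x. indicator (survivors S n \<omega>) x \<partial>\<nu>c \<omega>) = survivor_mass n \<omega>"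
    using survivors_sets[OF \<omega>] sets.sets_into_space[OF survivors_sets[OF \<omega>], of n] space_\<nu>c[OF \<omega>]
    by (simp add: survivor_mass_def Int_absorb2)
  finally show ?thesis .
qed

lemma survivor_mass_antimono:
  assumes "regular \<omega>" shows "survivor_mass (Suc n) \<omega> \<le> survivor_mass n \<omega>"
proof -
  interpret c: prob_space "\<nu>c \<omega>" using assms by (simp add: regular_def)
  note \<omega> = regular_space[OF assms]
  show ?thesis
    unfolding survivor_mass_def using survivors_antimono[of n "Suc n" \<omega>] survivors_sets[OF \<omega>]
    by (intro c.finite_measure_mono) (auto simp: sets_\<nu>c[OF \<omega>])
qed

text \<open>Since \<open>\<nu>c\<close> consists of probability measures only almost surely,
  \<open>K\<close> puts a point mass at the exceptional points. It is then a kernel, so the masses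
  of the sections of the survivor set are measurable.\<close>

lemma survivor_mass_measurable:
  obtains a where "\<And>n. a n \<in> borel_measurable M"
    "AE \<omega> in M. \<forall>n. a n \<omega> = survivor_mass n \<omega>"
proof -
  obtain x0 where x0: "x0 \<in> I" using I_nonempty by auto
  define K where "K \<omega> = (if emeasure (\<nu>c \<omega>) I = 1 then \<nu>c \<omega> else return (fibre_borel S) x0)" for \<omega>
  have [measurable]: "(\<lambda>\<omega>. emeasure (\<nu>c \<omega>) A) \<in> borel_measurable M" if "A \<in> sets (fibre_borel S)" for A
    using random_\<nu>c that by (auto simp: random_prob_measure_def)
  have I_sets [measurable]: "I \<in> sets (fibre_borel S)"
    using sets.top[of "fibre_borel S"] by simp
  have K: "K \<in> measurable M (subprob_algebra (fibre_borel S))"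
  proof (rule measurable_subprob_algebra)
    fix \<omega> assume \<omega>: "\<omega> \<in> space M"
    show "subprob_space (K \<omega>)"
    proof (cases "emeasure (\<nu>c \<omega>) I = 1")
      case True
      then have "prob_space (\<nu>c \<omega>)" by (intro prob_spaceI) (simp add: space_\<nu>c[OF \<omega>])
      with True show ?thesis by (simp add: K_def prob_space_imp_subprob_space)
    next
      case False
      then show ?thesis
        using x0 by (simp add: K_def prob_space_imp_subprob_space prob_space_return)
    qed
    show "sets (K \<omega>) = sets (fibre_borel S)" by (simp add: K_def sets_\<nu>c[OF \<omega>])
  next
    fix A assume A [measurable]: "A \<in> sets (fibre_borel S)"
    have "(\<lambda>\<omega>. emeasure (K \<omega>) A)
        = (\<lambda>\<omega>. if emeasure (\<nu>c \<omega>) I = 1 then emeasure (\<nu>c \<omega>) A else indicator A x0)"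
      by (auto simp: K_def A)
    then show "(\<lambda>\<omega>. emeasure (K \<omega>) A) \<in> borel_measurable M"
      by (simp add: I_sets A)
  qed
  show ?thesis
  proof (rule that[of "\<lambda>n \<omega>. measure (K \<omega>) (survivors S n \<omega>)"])
    show "(\<lambda>\<omega>. measure (K \<omega>) (survivors S n \<omega>)) \<in> borel_measurable M" for n
      by (rule measure_measurable_subprob_algebra2[OF survivor_set_measurable K])
    have "AE \<omega> in M. prob_space (\<nu>c \<omega>)" using random_\<nu>c by (simp add: random_prob_measure_def)
    with AE_space show "AE \<omega> in M. \<forall>n. measure (K \<omega>) (survivors S n \<omega>) = survivor_mass n \<omega>"
    proof eventually_elim
      case (elim \<omega>)
      then have "emeasure (\<nu>c \<omega>) I = 1"
        using prob_space.emeasure_space_1[of "\<nu>c \<omega>"] by (simp add: space_\<nu>c)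
      then show ?case by (simp add: K_def survivor_mass_def)
    qed
  qed
qed

context
  fixes q :: "'w \<Rightarrow> real \<Rightarrow> real"
  assumes q_BV: "q \<in> random_BV S"
begin

abbreviation "N \<equiv> eta_normalizer S \<nu>c q"

definition approximant :: "nat \<Rightarrow> 'w \<Rightarrow> real \<Rightarrow> real" where
  "approximant n \<omega> x = open_op_unit S n (shift_back S n \<omega>) x
     / Lam S \<omega> (open_op_unit S n (shift_back S n \<omega>))"

lemma tame_unit_iter: "forward_regular \<omega> \<Longrightarrow> tame (open_op_unit S n \<omega>)"
  by (intro tame_open_op_iter tame_open_unit regular_space forward_regularD(2))

section \<open>The limit formula at a single point\<close>

context
  fixes \<omega>
  assumes reg: "\<And>n. forward_regular (shift_back S n \<omega>)"
    and unif: "uniform_limit I (\<lambda>n. approximant n \<omega>) (q \<omega>) sequentially"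
begin

lemma reg0: "forward_regular \<omega>"
  using reg[of 0] by (simp add: shift_back_0)

lemma space0: "\<omega> \<in> space M"
  using regular_space[OF forward_regularD(2)[OF reg0]] .

lemma tame_approximant: "tame (approximant n \<omega>)"
  using tame_mult[OF tame_unit_iter[OF reg] tame_const,
      of "inverse (Lam S \<omega> (open_op_unit S n (shift_back S n \<omega>)))" n n]
    Lam_nonneg[OF reg0 tame_unit_iter[OF reg], of n n]
  by (simp add: approximant_def[abs_def] divide_inverse)

text \<open>Measurability and nonnegativity pass from the approximants to the limit; boundedness
  comes from bounded variation.\<close>

lemma tame_q: "tame (q \<omega>)"
proof -
  have lim: "(\<lambda>n. approximant n \<omega> x) \<longlonglongrightarrow> q \<omega> x" if "x \<in> I" for x
    using tendsto_uniform_limitI[OF unif that] .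
  have "q \<omega> \<in> borel_measurable (fibre_borel S)"
    by (rule borel_measurable_LIMSEQ_real[of _ "\<lambda>n. approximant n \<omega>"])
       (use lim tame_approximant in \<open>auto simp: tame_def\<close>)
  moreover have "0 \<le> q \<omega> x" if "x \<in> I" for x
    using lim[OF that] tame_approximant that by (intro LIMSEQ_le_const) (auto simp: tame_def)
  moreover have "bounded (q \<omega> ` I)"
    using q_BV space0 by (auto simp: random_BV_def BV_def)
  then obtain C where "\<And>x. x \<in> I \<Longrightarrow> \<bar>q \<omega> x\<bar> \<le> C" by (auto simp: bounded_real)
  then have "\<And>x. x \<in> I \<Longrightarrow> q \<omega> x \<le> C" by (metis abs_le_D1)
  ultimately show ?thesis unfolding tame_def by blast
qed

text \<open>If the eigenvalue were 0, the sums over preimages of the nonnegative terms would vanish.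
  Every point of \<open>I\<close> is a preimage of its image and has positive weight, so
  \<open>q\<close> would vanish on the open fibre and \<open>N \<omega>\<close> would be 0.\<close>

lemma open_eigenvalue_pos:
  assumes eq: "\<And>x. x \<in> I \<Longrightarrow> open_op S \<omega> (q \<omega>) x = open_eigenvalue S \<nu> \<omega> * q (shift S \<omega>) x"
    and N: "0 < N \<omega>"
  shows "0 < open_eigenvalue S \<nu> \<omega>"
proof (rule ccontr)
  interpret piecewise_monotone I "Z \<omega>" "fmap S \<omega>" by (rule piecewise_monotone[OF space0])
  assume "\<not> 0 < open_eigenvalue S \<nu> \<omega>"
  then have "open_eigenvalue S \<nu> \<omega> = 0" using open_eigenvalue_nonneg[of \<omega>] by simp
  with eq have zero: "open_op S \<omega> (q \<omega>) x = 0" if "x \<in> I" for x using that by simp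
  have "open_unit S \<omega> y * q \<omega> y = 0" if y: "y \<in> I" for y
  proof -
    let ?F = "\<lambda>y. weight S 1 \<omega> y * open_unit S \<omega> y * q \<omega> y"
    have "(\<Sum>z | z \<in> I \<and> fmap S \<omega> z = fmap S \<omega> y. ?F z) = 0"
      using zero[OF fmap_I[OF space0 y]] by (simp add: open_op_fibre_sum fibre_sum_def)
    moreover have "0 \<le> ?F z" if "z \<in> I" for z
      using tame_q that by (auto simp: weight_def elim: tameE)
    ultimately have "?F y = 0"
      using finite_preimages y by (subst (asm) sum_nonneg_eq_0_iff) auto
    then show ?thesis by (simp add: weight_def)
  qed
  then have "N \<omega> = (\<integral>x. 0 \<partial>\<nu>c \<omega>)"
    unfolding eta_normalizer_def
    by (intro Bochner_Integration.integral_cong) (auto simp: space_\<nu>c[OF space0])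
  with N show False by simp
qed

context
  assumes pos: "\<And>n j. 0 < open_eigenvalue S \<nu> (shift_pow S j (shift_back S n \<omega>))"
    and N: "0 < N \<omega>"
begin

lemma pos0: "0 < open_eigenvalue S \<nu> (shift_pow S j \<omega>)"
  using pos[of j 0] by (simp add: shift_back_0)

text \<open>The limit formula is integrated over \<open>\<nu> \<omega>\<close>, where duality
  evaluates the numerator.\<close>

lemma open_limit:
  "(\<lambda>n. open_product n (shift_back S n \<omega>) / Lam S \<omega> (open_op_unit S n (shift_back S n \<omega>)))
     \<longlonglongrightarrow> (\<integral>x. q \<omega> x \<partial>\<nu> \<omega>)"
proof -
  have "(\<integral>x. approximant n \<omega> x \<partial>\<nu> \<omega>)
      = open_product n (shift_back S n \<omega>) / Lam S \<omega> (open_op_unit S n (shift_back S n \<omega>))" for n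
  proof -
    let ?\<tau> = "shift_back S n \<omega>"
    have \<tau>: "?\<tau> \<in> space M" by (rule shift_back_space[OF space0])
    have "(\<integral>x. open_unit S ?\<tau> x \<partial>\<nu> ?\<tau>) = 1"
      using integral_open_unit[OF forward_regularD(2,3)[OF reg]] pos[of 0 n] by simp
    then have "(\<integral>x. open_op_unit S n ?\<tau> x \<partial>\<nu> \<omega>) = open_product n ?\<tau>"
      using open_duality_iter[OF reg tame_open_unit[OF \<tau>], of n n] by (simp add: shift_pow_back[OF space0])
    then show ?thesis by (simp add: approximant_def)
  qed
  moreover have "(\<lambda>n. \<integral>x. approximant n \<omega> x \<partial>\<nu> \<omega>) \<longlonglongrightarrow> (\<integral>x. q \<omega> x \<partial>\<nu> \<omega>)"
  proof (rule uniform_limit_integral)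
    show "prob_space (\<nu> \<omega>)" using forward_regularD(2)[OF reg0] by (simp add: regular_def)
    show "uniform_limit (space (\<nu> \<omega>)) (\<lambda>n. approximant n \<omega>) (q \<omega>) sequentially"
      using unif by (simp add: space_\<nu>[OF space0])
  qed (use integrable_tame(2)[OF forward_regularD(2)[OF reg0]] tame_approximant tame_q in blast)+
  ultimately show ?thesis by simp
qed

text \<open>The limit formula is integrated over the open fibre with respect to
  \<open>\<nu>c \<omega>\<close>, which turns the numerator into a survivor mass.\<close>

lemma closed_limit:
  "(\<lambda>n. closed_product n (shift_back S n \<omega>) * survivor_mass n (shift_back S n \<omega>)
       / Lam S \<omega> (open_op_unit S n (shift_back S n \<omega>))) \<longlonglongrightarrow> N \<omega>"
proof -
  have "(\<integral>x. open_unit S \<omega> x * approximant n \<omega> x \<partial>\<nu>c \<omega>)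
      = closed_product n (shift_back S n \<omega>) * survivor_mass n (shift_back S n \<omega>)
       / Lam S \<omega> (open_op_unit S n (shift_back S n \<omega>))" for n
    using survivor_mass_eq[OF reg, of n n] by (simp add: shift_pow_back[OF space0] approximant_def)
  moreover have "(\<lambda>n. \<integral>x. open_unit S \<omega> x * approximant n \<omega> x \<partial>\<nu>c \<omega>) \<longlonglongrightarrow> N \<omega>"
    unfolding eta_normalizer_def
  proof (rule uniform_limit_integral)
    show "prob_space (\<nu>c \<omega>)" using forward_regularD(2)[OF reg0] by (simp add: regular_def)
    show "uniform_limit (space (\<nu>c \<omega>)) (\<lambda>n x. open_unit S \<omega> x * approximant n \<omega> x)
        (\<lambda>x. open_unit S \<omega> x * q \<omega> x) sequentially"
      unfolding space_\<nu>c[OF space0] uniform_limit_iff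
    proof (intro allI impI)
      fix e :: real assume "e > 0"
      from uniform_limitD[OF unif this]
      show "eventually (\<lambda>n. \<forall>x\<in>I. dist (open_unit S \<omega> x * approximant n \<omega> x) (open_unit S \<omega> x * q \<omega> x) < e) sequentially"
        by eventually_elim (use \<open>e > 0\<close> in \<open>auto simp: indicator_def\<close>)
    qed
  qed (use integrable_tame(1)[OF forward_regularD(2)[OF reg0]] tame_mult[OF tame_open_unit[OF space0]]
        tame_approximant tame_q in blast)+
  ultimately show ?thesis by simp
qed

text \<open>Division by 0 gives 0, so quotients with the positive limit \<open>N \<omega>\<close>
  eventually have nonzero denominators.\<close>

lemma Lam_pos: "eventually (\<lambda>n. 0 < Lam S \<omega> (open_op_unit S n (shift_back S n \<omega>))) sequentially"
  using order_tendstoD(1)[OF closed_limit N]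
proof eventually_elim
  case (elim n)
  then have "Lam S \<omega> (open_op_unit S n (shift_back S n \<omega>)) \<noteq> 0" by auto
  with Lam_nonneg[OF reg0 tame_unit_iter[OF reg]] show ?case by (simp add: order_less_le)
qed

text \<open>By \<open>Lam_le_integral\<close> the quotients in \<open>open_limit\<close> are at
  least 1 once their denominators are positive.\<close>

lemma integral_q_ge_1: "1 \<le> (\<integral>x. q \<omega> x \<partial>\<nu> \<omega>)"
proof (rule tendsto_lowerbound[OF open_limit])
  show "eventually (\<lambda>n. 1 \<le> open_product n (shift_back S n \<omega>) / Lam S \<omega> (open_op_unit S n (shift_back S n \<omega>))) sequentially"
    using Lam_pos
  proof eventually_elim
    case (elim n)
    let ?\<tau> = "shift_back S n \<omega>"
    have "Lam S \<omega> (open_op_unit S n ?\<tau>) \<le> (\<integral>x. open_op_unit S n ?\<tau> x \<partial>\<nu> \<omega>)"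
      by (rule Lam_le_integral[OF reg0 tame_unit_iter[OF reg] pos0])
    also have "\<dots> = open_product n ?\<tau>"
      using open_duality_iter[OF reg tame_open_unit[OF shift_back_space[OF space0]], of n n]
        integral_open_unit[OF forward_regularD(2,3)[OF reg], of n] pos[of 0 n]
      by (simp add: shift_pow_back[OF space0])
    finally show ?case using elim by simp
  qed
qed simp

text \<open>Dividing the two limits cancels \<open>Lam\<close>; what remains involves only
  eigenvalue products and survivor masses.\<close>

lemma normalizer_limit:
  assumes "(\<integral>x. q \<omega> x \<partial>\<nu> \<omega>) = 1"
  shows "(\<lambda>n. closed_product n (shift_back S n \<omega>) * survivor_mass n (shift_back S n \<omega>)
      / open_product n (shift_back S n \<omega>)) \<longlonglongrightarrow> N \<omega>"
proof (rule Lim_transform_eventually)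
  show "(\<lambda>n. closed_product n (shift_back S n \<omega>) * survivor_mass n (shift_back S n \<omega>)
       / Lam S \<omega> (open_op_unit S n (shift_back S n \<omega>)) /
       (open_product n (shift_back S n \<omega>) / Lam S \<omega> (open_op_unit S n (shift_back S n \<omega>)))) \<longlonglongrightarrow> N \<omega>"
    using tendsto_divide[OF closed_limit open_limit] assms by simp
  show "eventually (\<lambda>n. closed_product n (shift_back S n \<omega>) * survivor_mass n (shift_back S n \<omega>)
       / Lam S \<omega> (open_op_unit S n (shift_back S n \<omega>)) /
       (open_product n (shift_back S n \<omega>) / Lam S \<omega> (open_op_unit S n (shift_back S n \<omega>)))
      = closed_product n (shift_back S n \<omega>) * survivor_mass n (shift_back S n \<omega>)
      / open_product n (shift_back S n \<omega>)) sequentially"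
    using Lam_pos by eventually_elim simp
qed

end

section \<open>Consequences of the eigenfunction equation along the orbit\<close>

context
  assumes eq: "\<And>j x. x \<in> I \<Longrightarrow> open_op S (shift_pow S j \<omega>) (q (shift_pow S j \<omega>)) x
    = open_eigenvalue S \<nu> (shift_pow S j \<omega>) * q (shift_pow S (Suc j) \<omega>) x"
begin

lemma eigenfunction_iter:
  "x \<in> I \<Longrightarrow> open_op_iter S n \<omega> (q \<omega>) x = open_product n \<omega> * q (shift_pow S n \<omega>) x"
proof (induction n arbitrary: x)
  case (Suc n)
  have "open_op_iter S (Suc n) \<omega> (q \<omega>) x
      = open_op S (shift_pow S n \<omega>) (\<lambda>x. open_product n \<omega> * q (shift_pow S n \<omega>) x) x"
    using Suc.IH by (simp del: mult_cancel_left) (rule open_op_cong)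
  also have "\<dots> = open_product (Suc n) \<omega> * q (shift_pow S (Suc n) \<omega>) x"
    by (simp add: open_op_cmult eq[OF Suc.prems] open_product_def)
  finally show ?case .
qed (simp add: open_product_def)

text \<open>The integral of the \<open>n\<close>-th iterate of \<open>q\<close> over the open fibre
  is evaluated twice, by the eigenfunction equation and by duality.\<close>

lemma normalizer_iter:
  "open_product n \<omega> * N (shift_pow S n \<omega>)
    = closed_product n \<omega> * (\<integral>x. indicator (survivors S n \<omega>) x * q \<omega> x \<partial>\<nu>c \<omega>)"
proof -
  have "open_product n \<omega> * N (shift_pow S n \<omega>)
      = (\<integral>x. open_unit S (shift_pow S n \<omega>) x * open_op_iter S n \<omega> (q \<omega>) x \<partial>\<nu>c (shift_pow S n \<omega>))"
    unfolding eta_normalizer_def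
    by (subst Bochner_Integration.integral_mult_right_zero[symmetric], intro Bochner_Integration.integral_cong)
       (auto simp: space_\<nu>c[OF shift_pow_space[OF space0]] eigenfunction_iter)
  also have "\<dots> = closed_product n \<omega> * (\<integral>x. indicator (survivors S n \<omega>) x * q \<omega> x \<partial>\<nu>c \<omega>)"
    using closed_duality_iter[OF reg0 tame_q tame_const[of 1], of n] by simp
  finally show ?thesis .
qed

text \<open>Survivors lie in the open fibre at time 0, so the indicator in the density of
  \<open>eta\<close> is absorbed.\<close>

lemma eta_survivors:
  assumes N: "0 < N \<omega>"
  shows "measure (eta S \<nu>c q \<omega>) (survivors S n \<omega>)
    = (\<integral>x. indicator (survivors S n \<omega>) x * q \<omega> x \<partial>\<nu>c \<omega>) / N \<omega>"
proof -
  have sets: "survivors S n \<omega> \<in> sets (\<nu>c \<omega>)"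
    using survivors_sets[OF space0] by (simp add: sets_\<nu>c[OF space0])
  have q_meas: "q \<omega> \<in> borel_measurable (\<nu>c \<omega>)" "open_unit S \<omega> \<in> borel_measurable (\<nu>c \<omega>)"
    using tame_q tame_open_unit[OF space0] by (auto simp: tame_def cong: measurable_cong_sets[OF sets_\<nu>c[OF space0]])
  let ?f = "\<lambda>x. indicator (survivors S n \<omega>) x * q \<omega> x / N \<omega>"
  have "emeasure (eta S \<nu>c q \<omega>) (survivors S n \<omega>)
      = (\<integral>\<^sup>+x. ennreal (open_unit S \<omega> x * q \<omega> x / N \<omega>) * indicator (survivors S n \<omega>) x \<partial>\<nu>c \<omega>)"
    unfolding eta_def using q_meas sets by (intro emeasure_density) auto
  also have "\<dots> = (\<integral>\<^sup>+x. ennreal (?f x) \<partial>\<nu>c \<omega>)"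
    using survivors_antimono[of 0 n \<omega>] by (intro nn_integral_cong) (auto simp: survivors_0 indicator_def)
  also have "\<dots> = ennreal (\<integral>x. ?f x \<partial>\<nu>c \<omega>)"
  proof (rule nn_integral_eq_integral)
    show "integrable (\<nu>c \<omega>) ?f"
      using integrable_tame(1)[OF forward_regularD(2)[OF reg0]
          tame_mult[OF tame_indicator[OF survivors_sets[OF space0]] tame_q]] by simp
    show "AE x in \<nu>c \<omega>. 0 \<le> ?f x"
      using tame_q N by (intro AE_I2) (auto simp: space_\<nu>c[OF space0] elim!: tameE)
  qed
  also have "(\<integral>x. ?f x \<partial>\<nu>c \<omega>) = (\<integral>x. indicator (survivors S n \<omega>) x * q \<omega> x \<partial>\<nu>c \<omega>) / N \<omega>"
    by simp
  finally have "emeasure (eta S \<nu>c q \<omega>) (survivors S n \<omega>)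
    = ennreal ((\<integral>x. indicator (survivors S n \<omega>) x * q \<omega> x \<partial>\<nu>c \<omega>) / N \<omega>)" .
  moreover have "0 \<le> (\<integral>x. indicator (survivors S n \<omega>) x * q \<omega> x \<partial>\<nu>c \<omega>) / N \<omega>"
    using tame_q N by (intro divide_nonneg_pos integral_nonneg_AE AE_I2)
      (auto simp: space_\<nu>c[OF space0] elim!: tameE)
  ultimately show ?thesis by (simp add: measure_def)
qed

lemma survivor_mass_lower:
  obtains C where "0 < C"
    "\<And>n. (\<integral>x. indicator (survivors S n \<omega>) x * q \<omega> x \<partial>\<nu>c \<omega>) \<le> C * survivor_mass n \<omega>"
proof -
  obtain C where C: "0 \<le> C" "\<And>x. x \<in> I \<Longrightarrow> q \<omega> x \<le> C" using tame_q by (metis tameE)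
  note int = integrable_tame(1)[OF forward_regularD(2)[OF reg0]]
  have ind: "tame (indicator (survivors S n \<omega>))" for n
    using tame_indicator[OF survivors_sets[OF space0]] .
  show ?thesis
  \<comment> \<open>Adding 1 makes the constant positive, as needed for logarithms later.\<close>
  proof (rule that[of "C + 1"])
    fix n
    have "(\<integral>x. indicator (survivors S n \<omega>) x * q \<omega> x \<partial>\<nu>c \<omega>)
        \<le> (\<integral>x. indicator (survivors S n \<omega>) x * (C + 1) \<partial>\<nu>c \<omega>)"
      using C int[OF tame_mult[OF ind tame_q]] int[OF tame_mult[OF ind tame_const[of "C + 1"]]]
      by (intro integral_mono) (auto simp: space_\<nu>c[OF space0] indicator_def intro: add_increasing2)
    also have "\<dots> = (C + 1) * survivor_mass n \<omega>"
      using sets.sets_into_space[OF survivors_sets[OF space0], of n]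
      by (simp add: survivor_mass_def space_\<nu>c[OF space0] Int_absorb2)
    finally show "(\<integral>x. indicator (survivors S n \<omega>) x * q \<omega> x \<partial>\<nu>c \<omega>) \<le> (C + 1) * survivor_mass n \<omega>" .
  qed (use C in simp)
qed

end

end

end

end

section \<open>Escape rates\<close>

context open_dynamics
begin

lemma AE_orbit:
  assumes "AE \<omega> in M. P \<omega>"
  shows "AE \<omega> in M. \<forall>n j. P (shift_pow S j (shift_back S n \<omega>))"
  using AE_s_inv_pow[OF AE_s_pow[OF assms]] by (simp add: shift_pow_def shift_back_def)

text \<open>There are at most \<open>card (Z \<omega>)\<close> preimages, each with weight at most
  the exponential of the supremum of the potential. This is the upper bound for the integrability of
  the logarithm.\<close>

lemma open_eigenvalue_le:
  assumes reg: "forward_regular \<omega>"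
  shows "open_eigenvalue S \<nu> \<omega> \<le> real (card (Z \<omega>)) * exp (SUP x\<in>I. pot S \<omega> x)"
proof -
  have r: "regular \<omega>" "regular (shift S \<omega>)" using forward_regularD(2,3)[OF reg] by auto
  note \<omega> = regular_space[OF r(1)] regular_space[OF r(2)]
  interpret piecewise_monotone I "Z \<omega>" "fmap S \<omega>" by (rule piecewise_monotone[OF \<omega>(1)])
  interpret o: prob_space "\<nu> (shift S \<omega>)" using r(2) by (simp add: regular_def)
  let ?E = "exp (SUP x\<in>I. pot S \<omega> x)"
  have "bdd_above (pot S \<omega> ` I)" using r(1) by (simp add: regular_def bounded_imp_bdd_above)
  then have pot_le: "pot S \<omega> y \<le> (SUP x\<in>I. pot S \<omega> x)" if "y \<in> I" for y
    using that by (intro cSUP_upper)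
  have "open_op S \<omega> (open_unit S \<omega>) x \<le> real (card (Z \<omega>)) * ?E" for x
  proof -
    have "\<bar>open_op S \<omega> (open_unit S \<omega>) x\<bar> \<le> real (card (Z \<omega>)) * ?E"
      unfolding open_op_fibre_sum
      by (intro fibre_sum_bound) (auto simp: weight_1 pot_le indicator_def)
    then show ?thesis by simp
  qed
  then have "open_eigenvalue S \<nu> \<omega> \<le> (\<integral>x. real (card (Z \<omega>)) * ?E \<partial>\<nu> (shift S \<omega>))"
    unfolding open_eigenvalue_def
    using integrable_tame(2)[OF r(2) tame_open_op[OF r(1) tame_open_unit[OF \<omega>(1)]]]
    by (intro integral_mono) auto
  then show ?thesis by (simp add: o.prob_space)
qed

text \<open>Both sides apply a functional at the next point to the same function, and
  \<open>Lam\<close> is dominated by integration. This is the lower bound for the integrability of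
  the logarithm.\<close>

lemma rho_le_open_eigenvalue:
  assumes reg: "forward_regular \<omega>" and pos: "\<And>j. 0 < open_eigenvalue S \<nu> (shift_pow S j \<omega>)"
  shows "rho S \<omega> \<le> open_eigenvalue S \<nu> \<omega>"
proof -
  have "forward_regular (shift S \<omega>)"
    using forward_regularD(4)[OF reg, of 1] by (simp add: shift_pow_1)
  moreover have "tame (open_op S \<omega> (open_unit S \<omega>))"
    using forward_regularD(2)[OF reg] by (intro tame_open_op tame_open_unit regular_space)
  moreover have "0 < open_eigenvalue S \<nu> (shift_pow S j (shift S \<omega>))" for j
    using pos[of "Suc j"] shift_pow_add[of j 1 \<omega>] by (simp add: shift_pow_1)
  ultimately show ?thesis
    unfolding rho_def open_eigenvalue_def[of S \<nu> \<omega>] by (rule Lam_le_integral)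
qed

end

theorem theorem4:
  fixes S :: "'w open_system"
    and Z :: "'w \<Rightarrow> real set set"
    and \<A> :: "nat \<Rightarrow> 'w \<Rightarrow> real set set"
    and \<nu>c \<nu> :: "'w \<Rightarrow> real measure"
    and q :: "'w \<Rightarrow> real \<Rightarrow> real"
  assumes system: "random_weighted_open_system S Z \<A> \<nu>c"
    and nu: "open_conformal S \<nu>"
    and lambda_measurable: "open_eigenvalue S \<nu> \<in> borel_measurable (base S)"
    and q: "open_eigenfunction S \<nu> q"
    and eta_defined: "AE \<omega> in base S. 0 < eta_normalizer S \<nu>c q \<omega>"
  shows "AE \<omega> in base S.
           has_escape_rate S \<nu>c \<omega>
             (ereal (expected_pressure (base S) (closed_eigenvalue S \<nu>c 1)
                       - expected_pressure (base S) (open_eigenvalue S \<nu>))) \<and>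
           has_escape_rate S (eta S \<nu>c q) \<omega>
             (ereal (expected_pressure (base S) (closed_eigenvalue S \<nu>c 1)
                       - expected_pressure (base S) (open_eigenvalue S \<nu>)))"
proof -
  note defs = random_weighted_open_system_def closed_conformal_def admissible_potential_def
    admissible_hole_def open_conformal_def open_eigenfunction_def
  have conf: "closed_system S Z" "admissible_potential S" "closed_conformal S \<nu>c" "admissible_hole S \<nu>c"
    "AE \<omega> in base S. support_set_inf S \<omega> \<noteq> {}" "log_integrable (base S) (rho S)"
    using system by (auto simp: random_weighted_open_system_def)
  interpret open_dynamics S Z \<nu>c \<nu>
    using conf nu by unfold_locales (auto simp: defs)

  \<comment> \<open>Properties along almost every orbit\<close>
  have q_BV: "q \<in> random_BV S" using q by (simp add: open_eigenfunction_def)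
  let ?N = "eta_normalizer S \<nu>c q"
  let ?lc = "closed_eigenvalue S \<nu>c 1" and ?lo = "open_eigenvalue S \<nu>"
  define G where "G \<omega> \<longleftrightarrow> regular \<omega> \<and> 0 < ?lc \<omega> \<and> 0 < ?N \<omega> \<and>
    (\<forall>x\<in>I. open_op S \<omega> (q \<omega>) x = ?lo \<omega> * q (shift S \<omega>) x) \<and>
    uniform_limit I (\<lambda>n. approximant n \<omega>) (q \<omega>) sequentially" for \<omega>
  have "AE \<omega> in M. \<forall>f\<in>BV I. (\<integral>x. closed_op S \<omega> f x \<partial>\<nu>c (shift S \<omega>)) = ?lc \<omega> * (\<integral>x. f x \<partial>\<nu>c \<omega>)"
  proof -
    have "AE \<omega> in M. \<forall>n. \<forall>f\<in>BV I. (\<integral>x. closed_op_iter S n \<omega> f x \<partial>\<nu>c (shift_pow S n \<omega>))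
        = closed_eigenvalue S \<nu>c n \<omega> * (\<integral>x. f x \<partial>\<nu>c \<omega>)"
      using conf(3) by (simp add: closed_conformal_def)
    then show ?thesis
    proof eventually_elim
      case (elim \<omega>)
      show ?case using elim[rule_format, of _ 1] by (simp add: shift_pow_1)
    qed
  qed
  moreover have "AE \<omega> in M. bounded (pot S \<omega> ` I)" "AE \<omega> in M. prob_space (\<nu>c \<omega>)"
    "AE \<omega> in M. prob_space (\<nu> \<omega>)" "AE \<omega> in M. 0 < ?lc \<omega>"
    "AE \<omega> in M. \<forall>f\<in>BV I. (\<integral>x. open_op S \<omega> f x \<partial>\<nu> (shift S \<omega>)) = ?lo \<omega> * (\<integral>x. f x \<partial>\<nu> \<omega>)"
    "AE \<omega> in M. \<forall>x\<in>I. open_op S \<omega> (q \<omega>) x = ?lo \<omega> * q (shift S \<omega>) x"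
    using conf nu q by (simp_all add: defs random_prob_measure_def log_integrable_def)
  moreover have "AE \<omega> in M. uniform_limit I (\<lambda>n. approximant n \<omega>) (q \<omega>) sequentially"
    using q unfolding open_eigenfunction_def approximant_def[OF q_BV, abs_def] by simp
  ultimately have "AE \<omega> in M. G \<omega>"
    using AE_space conf(5) eta_defined
    by eventually_elim (simp add: G_def regular_def)
  from AE_orbit[OF this]
  have "AE \<omega> in M. G \<omega> \<and> 0 < ?lo \<omega>"
  proof eventually_elim
    case (elim \<omega>)
    have G: "G \<omega>" using elim[rule_format, of 0 0] by (simp add: shift_back_0)
    have reg: "forward_regular (shift_back S n \<omega>)" for n
      using elim by (simp add: forward_regular_def G_def)
    have "0 < ?lo \<omega>"
      by (rule open_eigenvalue_pos[OF q_BV reg]) (use G in \<open>auto simp: G_def\<close>)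
    with G show ?case by blast
  qed
  \<comment> \<open>Positivity of the open eigenvalue at a point uses \<open>G\<close> along the
    orbit, so the passage to orbits is made a second time to include it.\<close>
  note orbit = AE_orbit[OF this]
  have reg: "forward_regular (shift_back S n \<omega>)"
    if "\<forall>n j. G (shift_pow S j (shift_back S n \<omega>)) \<and> 0 < ?lo (shift_pow S j (shift_back S n \<omega>))" for n \<omega>
    using that by (simp add: forward_regular_def G_def)
  have G0: "G (shift_pow S j \<omega>) \<and> 0 < ?lo (shift_pow S j \<omega>)"
    if "\<forall>n j. G (shift_pow S j (shift_back S n \<omega>)) \<and> 0 < ?lo (shift_pow S j (shift_back S n \<omega>))" for j \<omega>
    using that[rule_format, of j 0] by (simp add: shift_back_0)

  \<comment> \<open>Normalization of the eigenfunction on almost every fibre\<close>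
  have q_integral: "AE \<omega> in M. (\<integral>x. q \<omega> x \<partial>\<nu> \<omega>) = 1"
  proof -
    let ?Q = "\<lambda>\<omega>. \<integral>x. q \<omega> x \<partial>\<nu> \<omega>"
    have Q: "(\<integral>\<omega>. ?Q \<omega> \<partial>M) = 1" using q by (simp add: open_eigenfunction_def)
    \<comment> \<open>A nonintegrable function would have integral 0 rather than 1.\<close>
    then have int: "integrable M ?Q" using not_integrable_integral_eq by fastforce
    have ge: "AE \<omega> in M. 0 \<le> ?Q \<omega> - 1"
      using orbit
    proof eventually_elim
      case (elim \<omega>)
      have "1 \<le> ?Q \<omega>"
        by (rule integral_q_ge_1[OF q_BV reg[OF elim]])
           (use elim G0[OF elim, of 0] in \<open>auto simp: G_def\<close>)
      then show ?case by simp
    qed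
    have "(\<integral>\<omega>. ?Q \<omega> - 1 \<partial>M) = 0" using int Q by (simp add: prob_space)
    then have "AE \<omega> in M. ?Q \<omega> - 1 = 0"
      using integral_nonneg_eq_0_iff_AE[OF _ ge] int by simp
    then show ?thesis by simp
  qed

  \<comment> \<open>Integrability of the logarithms of the eigenvalues\<close>
  have ln_lc: "integrable M (\<lambda>\<omega>. ln (?lc \<omega>))"
    using conf(3) by (simp add: closed_conformal_def log_integrable_def)
  have ln_lo: "integrable M (\<lambda>\<omega>. ln (?lo \<omega>))"
  proof (rule Bochner_Integration.integrable_bound)
    \<comment> \<open>The first summand controls the logarithm from below, the other two from
      above.\<close>
    let ?B = "\<lambda>\<omega>. \<bar>ln (rho S \<omega>)\<bar> + \<bar>ln (real (card (Z \<omega>)))\<bar> + \<bar>SUP x\<in>I. pot S \<omega> x\<bar>"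
    show "integrable M ?B"
      using conf by (auto simp: defs closed_system_def log_integrable_def)
    show "(\<lambda>\<omega>. ln (?lo \<omega>)) \<in> borel_measurable M" using lambda_measurable by measurable
    have "AE \<omega> in M. 0 < rho S \<omega>" "AE \<omega> in M. 0 < real (card (Z \<omega>))"
      using conf by (auto simp: closed_system_def log_integrable_def)
    with orbit show "AE \<omega> in M. norm (ln (?lo \<omega>)) \<le> norm (?B \<omega>)"
    proof eventually_elim
      case (elim \<omega>)
      have r: "forward_regular \<omega>" using reg[OF elim(1), of 0] by (simp add: shift_back_0)
      have lo: "0 < ?lo \<omega>" using G0[OF elim(1), of 0] by simp
      have "ln (rho S \<omega>) \<le> ln (?lo \<omega>)"
        using rho_le_open_eigenvalue[OF r] G0[OF elim(1)] elim(2) lo by simp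
      moreover have "ln (?lo \<omega>) \<le> ln (real (card (Z \<omega>)) * exp (SUP x\<in>I. pot S \<omega> x))"
        using open_eigenvalue_le[OF r] lo elim(3) by simp
      then have "ln (?lo \<omega>) \<le> ln (real (card (Z \<omega>))) + (SUP x\<in>I. pot S \<omega> x)"
        using elim(3) by (simp add: ln_mult)
      ultimately show ?case unfolding real_norm_def by linarith
    qed
  qed
  define h where "h \<omega> = ln (?lc \<omega>) - ln (?lo \<omega>)" for \<omega>
  have h: "integrable M h" unfolding h_def using ln_lc ln_lo by simp
  have [measurable]: "h \<in> borel_measurable M" using h by blast
  let ?R = "expected_pressure M ?lc - expected_pressure M ?lo"
  have h_integral: "(\<integral>\<omega>. h \<omega> \<partial>M) = ?R"
    unfolding h_def expected_pressure_def using ln_lc ln_lo by simp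

  \<comment> \<open>Pointwise relations between masses, products and normalizers\<close>
  obtain a where a [measurable]: "\<And>n. a n \<in> borel_measurable M"
    and a_eq: "AE \<omega> in M. \<forall>n. a n \<omega> = survivor_mass n \<omega>"
    by (rule survivor_mass_measurable) (rule that)
  \<comment> \<open>This is the logarithm of the survivor mass times the ratio of the eigenvalue
    products, formed with the measurable version \<open>a\<close>.\<close>
  define b where "b n \<omega> = ln (a n \<omega>) + (\<Sum>j<n. h (shift_pow S j \<omega>))" for n \<omega>
  have [measurable]: "shift_pow S j \<in> measurable M M" for j
    using s_pow_measurable[of j] by (simp add: shift_pow_def[abs_def])
  have b: "b n \<in> borel_measurable M" for n unfolding b_def by measurable

  have forward: "AE \<omega> in M. (\<forall>n. 0 < survivor_mass n \<omega> \<and> a n \<omega> = survivor_mass n \<omega>) \<and>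
      (\<forall>n. exp (\<Sum>j<n. h (shift_pow S j \<omega>)) = closed_product n \<omega> / open_product n \<omega> \<and>
           0 < closed_product n \<omega> \<and> 0 < open_product n \<omega> \<and> 0 < ?N (shift_pow S n \<omega>)) \<and>
      (\<forall>n. measure (eta S \<nu>c q \<omega>) (survivors S n \<omega>)
         = ?N (shift_pow S n \<omega>) / ?N \<omega> * exp (- (\<Sum>j<n. h (shift_pow S j \<omega>)))) \<and>
      (\<exists>C>0. \<forall>n. ?N (shift_pow S n \<omega>) * exp (- (\<Sum>j<n. h (shift_pow S j \<omega>))) \<le> C * survivor_mass n \<omega>) \<and>
      (\<forall>n. survivor_mass (Suc n) \<omega> \<le> survivor_mass n \<omega>)"
    using orbit a_eq
  proof eventually_elim
    case (elim \<omega>)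
    note G = G0[OF elim(1)]
    have lc: "0 < ?lc (shift_pow S j \<omega>)" and lo: "0 < ?lo (shift_pow S j \<omega>)"
      and N: "0 < ?N (shift_pow S j \<omega>)" for j using G[of j] by (auto simp: G_def)
    have cp: "0 < closed_product n \<omega>" and op: "0 < open_product n \<omega>" for n
      unfolding closed_product_def open_product_def by (intro prod_pos; simp add: lc[simplified] lo)+
    have expS: "exp (\<Sum>j<n. h (shift_pow S j \<omega>)) = closed_product n \<omega> / open_product n \<omega>" for n
      using lc lo by (simp add: h_def exp_sum exp_diff closed_product_def open_product_def prod_dividef)
    have unif: "uniform_limit I (\<lambda>n. approximant n \<omega>) (q \<omega>) sequentially"
      using G[of 0] by (simp add: G_def)
    have eq: "open_op S (shift_pow S j \<omega>) (q (shift_pow S j \<omega>)) x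
        = ?lo (shift_pow S j \<omega>) * q (shift_pow S (Suc j) \<omega>) x" if "x \<in> I" for j x
      using G[of j] that by (simp add: G_def shift_pow_Suc)
    let ?J = "\<lambda>n. \<integral>x. indicator (survivors S n \<omega>) x * q \<omega> x \<partial>\<nu>c \<omega>"
    have J: "?J n = ?N (shift_pow S n \<omega>) * exp (- (\<Sum>j<n. h (shift_pow S j \<omega>)))" for n
      using normalizer_iter[OF q_BV reg[OF elim(1)] unif eq, of n] cp[of n] op[of n]
      by (simp add: exp_minus expS field_simps)
    have eta: "measure (eta S \<nu>c q \<omega>) (survivors S n \<omega>) = ?J n / ?N \<omega>" for n
      using eta_survivors[OF q_BV reg[OF elim(1)] unif eq] N[of 0] by simp
    obtain C where C: "0 < C" "\<And>n. ?J n \<le> C * survivor_mass n \<omega>"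
      using survivor_mass_lower[OF q_BV reg[OF elim(1)] unif eq] by metis
    \<comment> \<open>The positive integral \<open>?J n\<close> is at most a multiple of the mass,
      so the logarithm of the mass is genuine.\<close>
    have "0 < survivor_mass n \<omega>" for n
    proof -
      have "0 < ?J n" unfolding J using N[of n] by simp
      also note C(2)[of n]
      finally show ?thesis using C(1) by (simp add: zero_less_mult_iff)
    qed
    moreover have "survivor_mass (Suc n) \<omega> \<le> survivor_mass n \<omega>" for n
      using G[of 0] by (intro survivor_mass_antimono) (simp add: G_def)
    ultimately show ?case
      using elim(2) cp op N expS C J eta by auto
  qed

  \<comment> \<open>Backward convergence and the growth of the increments\<close>
  have backward: "AE \<omega> in M. (\<lambda>n. b n ((s_inv ^^ n) \<omega>)) \<longlonglongrightarrow> ln (?N \<omega>)"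
    using orbit q_integral AE_s_inv_pow[OF forward]
  proof eventually_elim
    case (elim \<omega>)
    have lim: "(\<lambda>n. closed_product n (shift_back S n \<omega>) * survivor_mass n (shift_back S n \<omega>)
      / open_product n (shift_back S n \<omega>)) \<longlonglongrightarrow> ?N \<omega>"
      by (rule normalizer_limit[OF q_BV reg[OF elim(1)]])
         (use elim(1,2) G0[OF elim(1), of 0] in \<open>auto simp: G_def\<close>)
    have "b n ((s_inv ^^ n) \<omega>) = ln (closed_product n (shift_back S n \<omega>) * survivor_mass n (shift_back S n \<omega>)
      / open_product n (shift_back S n \<omega>))" for n
    proof -
      let ?\<tau> = "shift_back S n \<omega>"
      have *: "0 < survivor_mass n ?\<tau>" "a n ?\<tau> = survivor_mass n ?\<tau>"
        "exp (\<Sum>j<n. h (shift_pow S j ?\<tau>)) = closed_product n ?\<tau> / open_product n ?\<tau>"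
        using elim(3)[rule_format, of n] by (auto simp: shift_back_def)
      have "ln (closed_product n ?\<tau> * survivor_mass n ?\<tau> / open_product n ?\<tau>)
          = ln (survivor_mass n ?\<tau> * exp (\<Sum>j<n. h (shift_pow S j ?\<tau>)))"
        by (simp add: *(3) mult.commute)
      also have "\<dots> = b n ?\<tau>" using *(1) by (simp add: b_def *(2) ln_mult)
      finally show ?thesis by (simp add: shift_back_def)
    qed
    moreover have "0 < ?N \<omega>" using G0[OF elim(1), of 0] by (simp add: G_def)
    ultimately show ?case using tendsto_ln[OF lim] by simp
  qed

  have step: "AE \<omega> in M. \<forall>n. b (Suc n) \<omega> - b n \<omega> \<le> h ((shift S ^^ n) \<omega>)"
    using forward
  proof eventually_elim
    case (elim \<omega>)
    show ?case
    proof
      fix n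
      \<comment> \<open>The mass decreases, so the increment of \<open>b\<close> is at most the
        newly added term of \<open>h\<close>.\<close>
      have "ln (a (Suc n) \<omega>) \<le> ln (a n \<omega>)" using elim by simp
      then show "b (Suc n) \<omega> - b n \<omega> \<le> h ((shift S ^^ n) \<omega>)"
        by (simp add: b_def shift_pow_def)
    qed
  qed

  \<comment> \<open>The two exponential rates\<close>
  from forward birkhoff[OF h] backward_limit_growth[OF b h backward step]
  show ?thesis
  proof eventually_elim
    case (elim \<omega>)
    let ?H = "\<lambda>n. \<Sum>j<n. h (shift_pow S j \<omega>)"
    have H: "(\<lambda>n. ?H n / n) \<longlonglongrightarrow> ?R"
      using elim(2) by (simp add: shift_pow_def h_integral)
    have L: "(\<lambda>n. ln (?N (shift_pow S n \<omega>)) / n) \<longlonglongrightarrow> 0"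
      using elim(3) by (simp add: shift_pow_def)
    have mass: "0 < survivor_mass n \<omega>" "a n \<omega> = survivor_mass n \<omega>" "0 < ?N (shift_pow S n \<omega>)" for n
      using elim(1) by auto
    have N: "0 < ?N \<omega>" using mass(3)[of 0] by simp
    obtain C where C: "0 < C"
      "\<And>n. ?N (shift_pow S n \<omega>) * exp (- ?H n) \<le> C * survivor_mass n \<omega>" using elim(1) by auto
    \<comment> \<open>Taking logarithms and moving the sum of \<open>h\<close> to the other side
      turns the lower bound for the mass into one for \<open>b n\<close>.\<close>
    have b_lower: "ln (?N (shift_pow S n \<omega>)) - ln C \<le> b n \<omega>" for n
    proof -
      have "ln (?N (shift_pow S n \<omega>) * exp (- ?H n)) \<le> ln (C * survivor_mass n \<omega>)"
        using C mass[of n] by (intro ln_mono) auto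
      then show ?thesis using C(1) mass[of n] by (simp add: ln_mult b_def)
    qed
    have "(\<lambda>n. b n \<omega> / n) \<longlonglongrightarrow> 0"
    proof (rule tendstoI)
      fix r :: real assume r: "r > 0"
      have "(\<lambda>n. ln (?N (shift_pow S n \<omega>)) / n - ln C / n) \<longlonglongrightarrow> 0 - 0"
        by (intro tendsto_diff L lim_const_over_n)
      then have "eventually (\<lambda>n. - r < ln (?N (shift_pow S n \<omega>)) / n - ln C / n) sequentially"
        using r by (intro order_tendstoD) auto
      moreover have "eventually (\<lambda>n. b n \<omega> / n < r) sequentially" using elim(4) r by blast
      ultimately show "eventually (\<lambda>n. dist (b n \<omega> / n) 0 < r) sequentially"
      proof eventually_elim
        case (elim n)
        have "(ln (?N (shift_pow S n \<omega>)) - ln C) / n \<le> b n \<omega> / n"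
          by (intro divide_right_mono b_lower) simp
        with elim show ?case by (simp add: diff_divide_distrib dist_real_def abs_less_iff)
      qed
    qed
    from tendsto_diff[OF this H]
    have closed_lim: "(\<lambda>n. ln (survivor_mass n \<omega>) / n) \<longlonglongrightarrow> - ?R"
      by (simp add: b_def mass add_divide_distrib)
    have eta_eq: "measure (eta S \<nu>c q \<omega>) (survivors S n \<omega>)
         = ?N (shift_pow S n \<omega>) / ?N \<omega> * exp (- ?H n)" for n
      using elim(1) by blast
    have "ln (measure (eta S \<nu>c q \<omega>) (survivors S n \<omega>))
        = ln (?N (shift_pow S n \<omega>)) - ln (?N \<omega>) - ?H n" for n
      unfolding eta_eq using mass(3)[of n] N by (simp add: ln_mult ln_div)
    then have "(\<lambda>n. ln (measure (eta S \<nu>c q \<omega>) (survivors S n \<omega>)) / n)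
        = (\<lambda>n. ln (?N (shift_pow S n \<omega>)) / n - ln (?N \<omega>) / n - ?H n / n)"
      by (simp add: diff_divide_distrib)
    \<comment> \<open>In the exact formula for the \<open>eta\<close>-mass, both normalizer terms
      vanish after division by \<open>n\<close>, and only the average of \<open>h\<close>
      remains.\<close>
    moreover have "(\<lambda>n. ln (?N (shift_pow S n \<omega>)) / n - ln (?N \<omega>) / n - ?H n / n) \<longlonglongrightarrow> 0 - 0 - ?R"
      by (intro tendsto_diff L lim_const_over_n H)
    ultimately have eta_lim: "(\<lambda>n. ln (measure (eta S \<nu>c q \<omega>) (survivors S n \<omega>)) / n) \<longlonglongrightarrow> - ?R"
      by simp
    show ?case
    proof
      show "has_escape_rate S \<nu>c \<omega> (ereal ?R)"
        by (rule has_escape_rateI) (use mass closed_lim in \<open>auto simp: survivor_mass_def\<close>)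
      show "has_escape_rate S (eta S \<nu>c q) \<omega> (ereal ?R)"
      proof (rule has_escape_rateI)
        show "0 < measure (eta S \<nu>c q \<omega>) (survivors S n \<omega>)" for n
          by (simp add: eta_eq mass N)
      qed (rule eta_lim)
    qed
  qed
qed

end
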